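(* Let $\Gamma(\pi)$ be the repeated game with data $(K,I,J,C,D,\pi,g,q)$ described in the context. Assume: (HA') (player 1 is informed) there exist maps $\hat k:C\to K$ and $\hat d:C\to D$ such that, with $E=\{(k,c,d)\in K\times C\times D:\ \hat k(c)=k,\ \hat d(c)=d\}$, one has $\pi(E)=1$ and $q(k,i,j)(E)=1$ for all $(k,i,j)\in K\times I\times J$; (HB') (player 1 controls the transition) for every $(k,i)\in K\times I$, the marginal of $q(k,i,j)$ on $K\times D$ does not depend on $j\in J$. Then $\Gamma(\pi)$ has a uniform value, i.e. $\underline v(\pi)=\overline v(\pi)$.
   Context: Repeated game. $K$ (states), $I$ (actions of player 1), $J$ (actions of player 2), $C$ (signals of player 1), $D$ (signals of player 2) are nonempty finite sets; $\Delta(S)$ denotes the set of probability distributions on a finite set $S$; $g:K\times I\times J\to[0,1]$ is the payoff of player 1 and $q:K\times I\times J\to\Delta(K\times C\times D)$ the transition. For $\pi\in\Delta(K\times C\times D)$ the zero-sum game $\Gamma(\pi)$ is played as follows: $(k_1,c_1,d_1)$ is drawn from $\pi$. At each stage $t\ge1$, player 1 learns $c_t$ and player 2 learns $d_t$; simultaneously player 1 chooses $i_t\in I$ and player 2 chooses $j_t\in J$; the stage payoff is $g(k_t,i_t,j_t)$ for player 1 and its opposite for player 2; then $(k_{t+1},c_{t+1},d_{t+1})$ is drawn from $q(k_t,i_t,j_t)$. A (behavior) strategy of player 1 is a sequence $\sigma=(\sigma_t)_{t\ge1}$ of maps $\sigma_t:(C\times I)^{t-1}\times C\to\Delta(I)$;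 a strategy of player 2 is a sequence $\tau=(\tau_t)_{t\ge1}$ of maps $\tau_t:(D\times J)^{t-1}\times D\to\Delta(J)$. The sets of strategies are $\Sigma$ and $\mathcal T$. A pair $(\sigma,\tau)$ induces a probability $\mathbb P_{\pi,\sigma,\tau}$ on plays $(K\times C\times D\times I\times J)^\infty$. For $N\ge1$, $\gamma_N^\pi(\sigma,\tau)=\mathbb E_{\mathbb P_{\pi,\sigma,\tau}}\big(\frac1N\sum_{n=1}^N g(k_n,i_n,j_n)\big)$. Set $$\underline v(\pi)=\sup_{\sigma\in\Sigma}\liminf_n\Big(\inf_{\tau\in\mathcal T}\gamma_n^\pi(\sigma,\tau)\Big),\qquad \overline v(\pi)=\inf_{\tau\in\mathcal T}\limsup_n\Big(\sup_{\sigma\in\Sigma}\gamma_n^\pi(\sigma,\tau)\Big).$$ $\Gamma(\pi)$ has a uniform value if $\underline v(\pi)=\overline v(\pi)$, and then this common quantity is the uniform value. *)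

theory Defs
  imports "HOL-Probability.Probability"
begin

text \<open>
  The sets of states, actions and signals are the finite (nonempty) types \<open>'k, 'i, 'j, 'c, 'd\<close>.
  Stages are numbered from \<open>0\<close>, so stage \<open>n\<close> below is stage \<open>n + 1\<close> in the usual numbering.
  A play is a sequence of tuples (state, signal of player 1, signal of player 2, action of
  player 1, action of player 2).
\<close>

type_synonym ('k, 'c, 'd, 'i, 'j) play = "nat \<Rightarrow> 'k \<times> 'c \<times> 'd \<times> 'i \<times> 'j"

text \<open>
  A behavior strategy maps the list (oldest first) of a player's own past (signal, action) pairs
  and the current signal to a mixed action. The length of the list is the stage, so such a
  function is the same thing as a sequence of maps from \<open>(C \<times> I)\<^sup>n \<times> C\<close> to \<open>\<Delta>(I)\<close>.
\<close>

type_synonym ('s, 'a) strategy = "('s \<times> 'a) list \<Rightarrow> 's \<Rightarrow> 'a pmf"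

definition history1 :: "('k, 'c, 'd, 'i, 'j) play \<Rightarrow> nat \<Rightarrow> ('c \<times> 'i) list" where
  "history1 \<omega> n = map (\<lambda>m. case \<omega> m of (k, c, d, i, j) \<Rightarrow> (c, i)) [0..<n]"

definition history2 :: "('k, 'c, 'd, 'i, 'j) play \<Rightarrow> nat \<Rightarrow> ('d \<times> 'j) list" where
  "history2 \<omega> n = map (\<lambda>m. case \<omega> m of (k, c, d, i, j) \<Rightarrow> (d, j)) [0..<n]"

definition draw_law ::
  "('k \<times> 'c \<times> 'd) pmf \<Rightarrow> ('k \<Rightarrow> 'i \<Rightarrow> 'j \<Rightarrow> ('k \<times> 'c \<times> 'd) pmf) \<Rightarrow>
   nat \<Rightarrow> ('k, 'c, 'd, 'i, 'j) play \<Rightarrow> ('k \<times> 'c \<times> 'd) pmf" where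
  "draw_law \<pi> q n \<omega> =
     (case n of 0 \<Rightarrow> \<pi> | Suc m \<Rightarrow> (case \<omega> m of (k, c, d, i, j) \<Rightarrow> q k i j))"

text \<open>
  The conditional law of stage \<open>n\<close> given the past; only the values of \<open>\<omega>\<close> before \<open>n\<close> matter.
\<close>

definition stage_law ::
  "('k \<times> 'c \<times> 'd) pmf \<Rightarrow> ('k \<Rightarrow> 'i \<Rightarrow> 'j \<Rightarrow> ('k \<times> 'c \<times> 'd) pmf) \<Rightarrow>
   ('c, 'i) strategy \<Rightarrow> ('d, 'j) strategy \<Rightarrow>
   nat \<Rightarrow> ('k, 'c, 'd, 'i, 'j) play \<Rightarrow> ('k \<times> 'c \<times> 'd \<times> 'i \<times> 'j) pmf" where
  "stage_law \<pi> q \<sigma> \<tau> n \<omega> =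
     do {
       (k, c, d) \<leftarrow> draw_law \<pi> q n \<omega>;
       i \<leftarrow> \<sigma> (history1 \<omega> n) c;
       j \<leftarrow> \<tau> (history2 \<omega> n) d;
       return_pmf (k, c, d, i, j)
     }"

text \<open>
  The probability on infinite plays, obtained from the stage kernels by the Ionescu-Tulcea
  theorem; \<open>Ionescu_Tulcea_stage_law\<close> below shows that its
  hypotheses hold.
\<close>

definition play_measure ::
  "('k \<times> 'c \<times> 'd) pmf \<Rightarrow> ('k \<Rightarrow> 'i \<Rightarrow> 'j \<Rightarrow> ('k \<times> 'c \<times> 'd) pmf) \<Rightarrow>
   ('c, 'i) strategy \<Rightarrow> ('d, 'j) strategy \<Rightarrow> ('k, 'c, 'd, 'i, 'j) play measure" where
  "play_measure \<pi> q \<sigma> \<tau> =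
     projective_family.lim UNIV
       (Ionescu_Tulcea.CI
          (\<lambda>n \<omega>. measure_pmf (stage_law \<pi> q \<sigma> \<tau> n \<omega>)) (\<lambda>_. count_space UNIV))
       (\<lambda>_. count_space UNIV)"

lemma stage_law_cong:
  assumes "\<And>m. m < n \<Longrightarrow> \<omega> m = \<omega>' m"
  shows "stage_law \<pi> q \<sigma> \<tau> n \<omega> = stage_law \<pi> q \<sigma> \<tau> n \<omega>'"
proof -
  have "history1 \<omega> n = history1 \<omega>' n" "history2 \<omega> n = history2 \<omega>' n"
    using assms by (auto simp: history1_def history2_def)
  moreover have "draw_law \<pi> q n \<omega> = draw_law \<pi> q n \<omega>'"
    using assms by (auto simp: draw_law_def split: nat.split)
  ultimately show ?thesis by (simp add: stage_law_def)
qed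

lemma Ionescu_Tulcea_stage_law:
  fixes \<pi> :: "('k::finite \<times> 'c::finite \<times> 'd::finite) pmf"
    and q :: "'k \<Rightarrow> 'i::finite \<Rightarrow> 'j::finite \<Rightarrow> ('k \<times> 'c \<times> 'd) pmf"
  shows "Ionescu_Tulcea (\<lambda>n \<omega>. measure_pmf (stage_law \<pi> q \<sigma> \<tau> n \<omega>)) (\<lambda>_. count_space UNIV)"
proof
  fix n :: nat
  have eq: "PiM {0..<n} (\<lambda>_. count_space (UNIV :: ('k \<times> 'c \<times> 'd \<times> 'i \<times> 'j) set))
      = count_space ({0..<n} \<rightarrow>\<^sub>E UNIV)"
    by (rule count_space_PiM_finite) auto
  show "(\<lambda>\<omega>. measure_pmf (stage_law \<pi> q \<sigma> \<tau> n \<omega>))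
      \<in> PiM {0..<n} (\<lambda>_. count_space UNIV) \<rightarrow>\<^sub>M subprob_algebra (count_space UNIV)"
    unfolding eq by (auto simp: space_subprob_algebra intro: measure_pmf.subprob_space_axioms)
qed

lemma prob_space_play_measure:
  fixes \<pi> :: "('k::finite \<times> 'c::finite \<times> 'd::finite) pmf"
    and q :: "'k \<Rightarrow> 'i::finite \<Rightarrow> 'j::finite \<Rightarrow> ('k \<times> 'c \<times> 'd) pmf"
  shows "prob_space (play_measure \<pi> q \<sigma> \<tau>)"
proof -
  interpret Ionescu_Tulcea
    "\<lambda>n \<omega>. measure_pmf (stage_law \<pi> q \<sigma> \<tau> n \<omega>)" "\<lambda>_. count_space UNIV"
    by (rule Ionescu_Tulcea_stage_law)
  have "prob_space (distr PF.lim (PiM {} (\<lambda>_. count_space UNIV)) (\<lambda>x. restrict x {}))"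
    by (subst distr_lim) (auto intro: PF.prob_space_P)
  then show ?thesis
    unfolding play_measure_def
    by (rule prob_space_distrD[rotated])
      (auto simp: measurable_cong_sets[OF PF.sets_lim refl] intro: measurable_restrict)
qed

lemma emeasure_play_measure_cylinder:
  fixes \<pi> :: "('k::finite \<times> 'c::finite \<times> 'd::finite) pmf"
    and q :: "'k \<Rightarrow> 'i::finite \<Rightarrow> 'j::finite \<Rightarrow> ('k \<times> 'c \<times> 'd) pmf"
  shows "emeasure (play_measure \<pi> q \<sigma> \<tau>) {\<omega>. \<forall>m<n. \<omega> m = x m}
       = (\<Prod>m<n. ennreal (pmf (stage_law \<pi> q \<sigma> \<tau> m x) (x m)))"
proof -
  let ?M = "\<lambda>_::nat. count_space (UNIV :: ('k \<times> 'c \<times> 'd \<times> 'i \<times> 'j) set)"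
  interpret Ionescu_Tulcea
    "\<lambda>n \<omega>. measure_pmf (stage_law \<pi> q \<sigma> \<tau> n \<omega>)" ?M
    by (rule Ionescu_Tulcea_stage_law)
  have PiM_eq: "PiM {0..<m} ?M = count_space ({0..<m} \<rightarrow>\<^sub>E UNIV)" for m
    by (rule count_space_PiM_finite) auto
  define X where "X m = {restrict x {0..<m}}" for m
  have X: "X m \<in> sets (PiM {0..<m} ?M)" for m
    by (auto simp: PiM_eq X_def)
  have space0: "(\<lambda>_. undefined) \<in> space (PiM {0..<0} ?M)" by simp
  have C: "emeasure (C 0 n (\<lambda>_. undefined)) (X n)
      = (\<Prod>m<n. ennreal (pmf (stage_law \<pi> q \<sigma> \<tau> m x) (x m)))"
  proof (induction n)
    case 0
    show ?case using X[of 0] by (simp add: X_def restrict_def)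
  next
    case (Suc n)
    have "emeasure (C 0 (Suc n) (\<lambda>_. undefined)) (X (Suc n))
        = (\<integral>\<^sup>+\<omega>. emeasure (eP n \<omega>) (X (Suc n)) \<partial>C 0 n (\<lambda>_. undefined))"
      using X[of "Suc n"] measurable_eP[of n]
      by (simp, subst emeasure_bind[where N = "PiM {0..<Suc n} ?M"])
        (auto simp: space_C[OF space0] measurable_cong_sets[OF sets_C[OF space0] refl])
    also have "\<dots> = (\<integral>\<^sup>+\<omega>. ennreal (pmf (stage_law \<pi> q \<sigma> \<tau> n x) (x n)) * indicator (X n) \<omega>
        \<partial>C 0 n (\<lambda>_. undefined))"
    proof (rule nn_integral_cong)
      fix \<omega> assume "\<omega> \<in> space (C 0 n (\<lambda>_. undefined))"
      then have \<omega>: "\<omega> \<in> space (PiM {0..<n} ?M)" using space_C[OF space0, of n] by simp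
      then have ext: "\<omega> \<in> extensional {0..<n}" by (auto simp: space_PiM PiE_def)
      have eq: "fun_upd \<omega> n y \<in> X (Suc n) \<longleftrightarrow> \<omega> \<in> X n \<and> y = x n" for y
        using ext by (auto simp: X_def fun_eq_iff extensional_def restrict_def less_Suc_eq)
      have "emeasure (eP n \<omega>) (X (Suc n))
          = emeasure (measure_pmf (stage_law \<pi> q \<sigma> \<tau> n \<omega>)) {y. \<omega> \<in> X n \<and> y = x n}"
        by (simp add: emeasure_eP[OF \<omega> X] eq vimage_def)
      also have "\<dots> = ennreal (pmf (stage_law \<pi> q \<sigma> \<tau> n x) (x n)) * indicator (X n) \<omega>"
      proof (cases "\<omega> \<in> X n")
        case True
        then have "stage_law \<pi> q \<sigma> \<tau> n \<omega> = stage_law \<pi> q \<sigma> \<tau> n x"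
          by (intro stage_law_cong) (auto simp: X_def)
        with True show ?thesis by (simp add: emeasure_pmf_single)
      qed simp
      finally show "emeasure (eP n \<omega>) (X (Suc n))
          = ennreal (pmf (stage_law \<pi> q \<sigma> \<tau> n x) (x n)) * indicator (X n) \<omega>" .
    qed
    also have "\<dots> = ennreal (pmf (stage_law \<pi> q \<sigma> \<tau> n x) (x n))
        * emeasure (C 0 n (\<lambda>_. undefined)) (X n)"
      using X[of n] sets_C[OF space0, of n] by (subst nn_integral_cmult_indicator) auto
    finally show ?case by (simp add: Suc.IH mult.commute)
  qed
  have "{\<omega>. \<forall>m<n. \<omega> m = x m} = prod_emb UNIV ?M {0..<n} (X n)"
    by (auto simp: prod_emb_def X_def fun_eq_iff restrict_def space_PiM) metis
  then have "emeasure (play_measure \<pi> q \<sigma> \<tau>) {\<omega>. \<forall>m<n. \<omega> m = x m} = emeasure (CI {0..<n}) (X n)"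
    unfolding play_measure_def using lim[OF _ X] by simp
  also have "\<dots> = emeasure (C 0 n (\<lambda>_. undefined)) (X n)"
  proof -
    have "prod_emb {0..<n} ?M {0..<n} (X n) = X n"
      using X by (intro prod_emb_id) (auto simp: X_def)
    then show ?thesis using emeasure_CI[OF order_refl X[of n]] by simp
  qed
  finally show ?thesis using C by simp
qed

definition mean_payoff ::
  "('k \<times> 'c \<times> 'd) pmf \<Rightarrow> ('k \<Rightarrow> 'i \<Rightarrow> 'j \<Rightarrow> ('k \<times> 'c \<times> 'd) pmf) \<Rightarrow>
   ('k \<Rightarrow> 'i \<Rightarrow> 'j \<Rightarrow> real) \<Rightarrow> nat \<Rightarrow> ('c, 'i) strategy \<Rightarrow> ('d, 'j) strategy \<Rightarrow> real" where
  "mean_payoff \<pi> q g N \<sigma> \<tau> =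
     (\<integral>\<omega>. (1 / real N) * (\<Sum>n<N. case \<omega> n of (k, c, d, i, j) \<Rightarrow> g k i j)
        \<partial>play_measure \<pi> q \<sigma> \<tau>)"

text \<open>
  The values are taken in \<^typ>\<open>ereal\<close> so that all suprema and infima are defined; for a bounded
  payoff they are finite. The junk value of \<^const>\<open>mean_payoff\<close> at \<open>N = 0\<close> does not affect them.
\<close>

definition lower_value ::
  "('k \<times> 'c \<times> 'd) pmf \<Rightarrow> ('k \<Rightarrow> 'i \<Rightarrow> 'j \<Rightarrow> ('k \<times> 'c \<times> 'd) pmf) \<Rightarrow>
   ('k \<Rightarrow> 'i \<Rightarrow> 'j \<Rightarrow> real) \<Rightarrow> ereal" where
  "lower_value \<pi> q g = (SUP \<sigma>. liminf (\<lambda>n. INF \<tau>. ereal (mean_payoff \<pi> q g n \<sigma> \<tau>)))"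

definition upper_value ::
  "('k \<times> 'c \<times> 'd) pmf \<Rightarrow> ('k \<Rightarrow> 'i \<Rightarrow> 'j \<Rightarrow> ('k \<times> 'c \<times> 'd) pmf) \<Rightarrow>
   ('k \<Rightarrow> 'i \<Rightarrow> 'j \<Rightarrow> real) \<Rightarrow> ereal" where
  "upper_value \<pi> q g = (INF \<tau>. limsup (\<lambda>n. SUP \<sigma>. ereal (mean_payoff \<pi> q g n \<sigma> \<tau>)))"

definition has_uniform_value ::
  "('k \<times> 'c \<times> 'd) pmf \<Rightarrow> ('k \<Rightarrow> 'i \<Rightarrow> 'j \<Rightarrow> ('k \<times> 'c \<times> 'd) pmf) \<Rightarrow>
   ('k \<Rightarrow> 'i \<Rightarrow> 'j \<Rightarrow> real) \<Rightarrow> bool" where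
  "has_uniform_value \<pi> q g \<longleftrightarrow> lower_value \<pi> q g = upper_value \<pi> q g"

definition player1_informed ::
  "('k \<times> 'c \<times> 'd) pmf \<Rightarrow> ('k \<Rightarrow> 'i \<Rightarrow> 'j \<Rightarrow> ('k \<times> 'c \<times> 'd) pmf) \<Rightarrow> bool" where
  "player1_informed \<pi> q \<longleftrightarrow>
     (\<exists>(khat :: 'c \<Rightarrow> 'k) (dhat :: 'c \<Rightarrow> 'd).
        let E = {(k, c, d). khat c = k \<and> dhat c = d}
        in measure_pmf.prob \<pi> E = 1 \<and> (\<forall>k i j. measure_pmf.prob (q k i j) E = 1))"

definition player1_controls_transition ::
  "('k \<Rightarrow> 'i \<Rightarrow> 'j \<Rightarrow> ('k \<times> 'c \<times> 'd) pmf) \<Rightarrow> bool" where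
  "player1_controls_transition q \<longleftrightarrow>
     (\<forall>k i j j'. map_pmf (\<lambda>(k', c, d). (k', d)) (q k i j) = map_pmf (\<lambda>(k', c, d). (k', d)) (q k i j'))"

end

theory Submission
  imports Defs
begin

text \<open>
  Only player 1 influences the law of (state, signal of player 2), so the joint law of
  (signals of player 2, state, action of player 1) is a \<^emph>\<open>flow\<close>: a family of measures
  \<open>F h\<close> on states and actions indexed by the signal histories \<open>h\<close>. A player 1 who realises a
  given flow makes it independent of the actions of player 2, and is then held at each stage to the
  sum over \<open>h\<close> of the minimum over \<open>j\<close> of linear functionals of \<open>F h\<close>. Player 2 in turn can play
  as a function of his signals alone; then the law is a flow whatever player 1 does, and by the
  minimax theorem player 2 can defend, in every block of \<open>N\<close> stages, the largest payoff
  \<open>best N\<close> that a flow gets on a window of length \<open>N\<close>. So he guarantees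
  \<open>val = inf best N / N\<close>, and it remains to find one flow whose long averages all approach \<open>val\<close>.

  A window of length \<open>N\<close> with average close to \<open>val\<close> contains a starting point from which all
  shorter averages are good too. By compactness of the set of distributions over beliefs, this
  starting point can be chosen before a stage \<open>M\<close> that depends neither on \<open>N\<close> nor on the
  initial belief, and the value \<open>val\<close> hardly decreases along the flow. Concatenating such flows with
  summable errors, each block being long compared with the delay \<open>M\<close> of the next one, gives
  the required flow.
\<close>

section \<open>Flows\<close>

text \<open>(HB') fixes only the marginal on states and signals of player 2; the signal of player 1
  may still reveal \<open>j\<close>. Hence laws are recorded from the viewpoint of player 2, with
  the signals of player 1 summed out. Beliefs stay unnormalised, their mass being the probability of
  the signal history: conditioning and averaging become sums, everything is positively homogeneous,
  and errors proportional to mass add up over histories. The obstacle is that \<open>best\<close>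
  lets the window start arbitrarily late, with a flow that depends on its length. Of the past before
  the window only the distribution of beliefs matters, and close distributions have close
  continuation payoffs, uniformly in the length, since the error of running a plan from a perturbed
  belief does not grow with time. Up to a fixed error there are finitely many distributions, so each
  can be reached early. \<open>val\<close> hardly drops along the flow because the flow is chosen
  for a far longer horizon: if it still averages about \<open>val\<close> over \<open>T\<close>
  stages after stage \<open>n\<close>, with \<open>T\<close> large, the beliefs at stage
  \<open>n\<close> must be worth about \<open>val\<close>, as no long window beats the values of the
  beliefs it starts from.\<close>

lemma finite_length_eq: "finite {h :: 'a::finite list. length h = n}"
  using finite_lists_length_eq[of "UNIV :: 'a set" n] by simp

lemma sum_length_append:
  fixes f :: "'a::finite list \<Rightarrow> real"
  shows "(\<Sum>h | length h = m + n. f h) = (\<Sum>a | length a = m. \<Sum>b | length b = n. f (a @ b))"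
proof -
  have "bij_betw (\<lambda>(a, b). a @ b) ({a. length a = m} \<times> {b. length b = n}) {h :: 'a list. length h = m + n}"
    by (rule bij_betw_byWitness[where f' = "\<lambda>h. (take m h, drop m h)"]) auto
  from sum.reindex_bij_betw[OF this, of f] show ?thesis
    by (simp add: sum.cartesian_product case_prod_unfold)
qed

lemma length_eq_1: "{b :: 'a list. length b = Suc 0} = (\<lambda>d. [d]) ` UNIV"
  by (auto simp: length_Suc_conv)

lemma sum_length_Suc:
  fixes f :: "'a::finite list \<Rightarrow> real"
  shows "(\<Sum>h | length h = Suc n. f h) = (\<Sum>d\<in>UNIV. \<Sum>h | length h = n. f (d # h))"
  using sum_length_append[of f 1 n]
  by (simp add: length_eq_1 sum.reindex inj_on_def)

lemma sum_length_snoc: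
  fixes f :: "'a::finite list \<Rightarrow> real"
  shows "(\<Sum>h | length h = Suc n. f h) = (\<Sum>h | length h = n. \<Sum>d\<in>UNIV. f (h @ [d]))"
  using sum_length_append[of f n 1]
  by (simp add: length_eq_1 sum.reindex inj_on_def)

section \<open>Unnormalised beliefs and their L1 distances\<close>

definition marg :: "('k \<Rightarrow> 'i::finite \<Rightarrow> real) \<Rightarrow> 'k \<Rightarrow> real" where
  "marg A k = (\<Sum>i\<in>UNIV. A k i)"

definition mass :: "('k::finite \<Rightarrow> real) \<Rightarrow> real" where
  "mass x = (\<Sum>k\<in>UNIV. x k)"

definition gap :: "('k::finite \<Rightarrow> real) \<Rightarrow> ('k \<Rightarrow> real) \<Rightarrow> real" where
  "gap x y = (\<Sum>k\<in>UNIV. \<bar>x k - y k\<bar>)"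

definition gap2 :: "('k::finite \<Rightarrow> 'i::finite \<Rightarrow> real) \<Rightarrow> ('k \<Rightarrow> 'i \<Rightarrow> real) \<Rightarrow> real" where
  "gap2 A B = (\<Sum>k\<in>UNIV. \<Sum>i\<in>UNIV. \<bar>A k i - B k i\<bar>)"

lemma gap_commute: "gap x y = gap y x"
  by (simp add: gap_def abs_minus_commute)

lemma mass_nonneg: "(\<forall>k. x k \<ge> 0) \<Longrightarrow> mass x \<ge> 0"
  by (simp add: mass_def sum_nonneg)

lemma mass_scale: "mass (\<lambda>k. c * x k) = c * mass x"
  by (simp add: mass_def sum_distrib_left)

lemma mass_sum: "mass (\<lambda>k. \<Sum>a\<in>S. y a k) = (\<Sum>a\<in>S. mass (y a))"
  unfolding mass_def by (rule sum.swap)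

lemma mass_eq_0:
  assumes "\<forall>k. x k \<ge> 0" "mass x = 0"
  shows "x k = 0"
  using assms by (simp add: mass_def sum_nonneg_eq_0_iff)

lemma le_mass: "(\<forall>k. x k \<ge> 0) \<Longrightarrow> x k \<le> mass x"
  unfolding mass_def by (rule member_le_sum) auto

text \<open>\<open>Q k i k' d\<close> stands for the marginal of the transition on the next state
  and the signal of player 2. The absence of \<open>j\<close> in it encodes (HB'): player 1 alone
  drives the evolution, and \<open>j\<close> enters only through \<open>g\<close>.\<close>

locale controlled_chain =
  fixes Q :: "'k::finite \<Rightarrow> 'i::finite \<Rightarrow> 'k \<Rightarrow> 'd::finite \<Rightarrow> real"
    and g :: "'k \<Rightarrow> 'i \<Rightarrow> 'j::finite \<Rightarrow> real"
  assumes Q_nonneg: "Q k i k' d \<ge> 0"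
    and Q_sum: "(\<Sum>d\<in>UNIV. \<Sum>k'\<in>UNIV. Q k i k' d) = 1"
    and g_nonneg: "g k i j \<ge> 0"
    and g_le_1: "g k i j \<le> 1"
begin

definition out :: "('k \<Rightarrow> 'i \<Rightarrow> real) \<Rightarrow> 'd \<Rightarrow> 'k \<Rightarrow> real" where
  "out A d k' = (\<Sum>k\<in>UNIV. \<Sum>i\<in>UNIV. A k i * Q k i k' d)"

definition lin :: "('k \<Rightarrow> 'i \<Rightarrow> real) \<Rightarrow> 'j \<Rightarrow> real" where
  "lin A j = (\<Sum>k\<in>UNIV. \<Sum>i\<in>UNIV. A k i * g k i j)"

text \<open>Player 2 sees the signal history, but neither the state nor the current action of player
  1, so his reply minimises the payoff aggregated over both.\<close>

definition rew :: "('k \<Rightarrow> 'i \<Rightarrow> real) \<Rightarrow> real" where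
  "rew A = Min (range (lin A))"

text \<open>Only the marginals on states are prescribed; how \<open>marg (F h) k\<close> is divided
  among the actions is the free choice of player 1. The history \<open>[]\<close> carries the
  starting measure, so the first signal of player 2 is not part of \<open>h\<close>.\<close>

definition flow :: "('k \<Rightarrow> real) \<Rightarrow> ('d list \<Rightarrow> 'k \<Rightarrow> 'i \<Rightarrow> real) \<Rightarrow> bool" where
  "flow x F \<longleftrightarrow> (\<forall>h k i. F h k i \<ge> 0) \<and> marg (F []) = x \<and>
     (\<forall>h d. marg (F (h @ [d])) = out (F h) d)"

definition stage :: "('d list \<Rightarrow> 'k \<Rightarrow> 'i \<Rightarrow> real) \<Rightarrow> nat \<Rightarrow> real" where
  "stage F t = (\<Sum>h | length h = t. rew (F h))"

lemma rew_le: "rew A \<le> lin A j"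
  by (simp add: rew_def)

lemma rew_attained: obtains j where "rew A = lin A j"
proof -
  have "rew A \<in> range (lin A)"
    unfolding rew_def by (rule Min_in) auto
  then show thesis using that by auto
qed

lemma lin_nonneg: "(\<And>k i. A k i \<ge> 0) \<Longrightarrow> lin A j \<ge> 0"
  by (simp add: lin_def sum_nonneg g_nonneg)

lemma lin_le_mass: "(\<And>k i. A k i \<ge> 0) \<Longrightarrow> lin A j \<le> mass (marg A)"
  unfolding lin_def mass_def marg_def
  by (intro sum_mono mult_left_le g_le_1)

lemma rew_nonneg: "(\<And>k i. A k i \<ge> 0) \<Longrightarrow> rew A \<ge> 0"
  by (metis rew_attained lin_nonneg)

lemma rew_le_mass: "(\<And>k i. A k i \<ge> 0) \<Longrightarrow> rew A \<le> mass (marg A)"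
  by (meson rew_le lin_le_mass order_trans)

lemma lin_sum: "lin (\<lambda>k i. \<Sum>a\<in>S. A a k i) j = (\<Sum>a\<in>S. lin (A a) j)"
  unfolding lin_def sum_distrib_right by (simp only: sum.swap[of _ _ S])

lemma lin_scale: "lin (\<lambda>k i. c * A k i) j = c * lin A j"
  by (simp add: lin_def sum_distrib_left mult.assoc)

text \<open>A reply that is optimal against the sum is also available against each summand. Hiding
  the index \<open>a\<close> from player 2 can only raise the payoff.\<close>

lemma rew_sum_ge: "(\<Sum>a\<in>S. rew (A a)) \<le> rew (\<lambda>k i. \<Sum>a\<in>S. A a k i)"
  by (rule rew_attained[of "\<lambda>k i. \<Sum>a\<in>S. A a k i"]) (simp add: lin_sum sum_mono rew_le)

lemma rew_scale:
  assumes "c \<ge> 0"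
  shows "rew (\<lambda>k i. c * A k i) = c * rew A"
proof (rule antisym)
  obtain j where "rew A = lin A j" by (rule rew_attained)
  then show "rew (\<lambda>k i. c * A k i) \<le> c * rew A"
    using rew_le[of "\<lambda>k i. c * A k i" j] by (simp add: lin_scale)
  obtain j where "rew (\<lambda>k i. c * A k i) = lin (\<lambda>k i. c * A k i) j" by (rule rew_attained)
  then show "c * rew A \<le> rew (\<lambda>k i. c * A k i)"
    using rew_le[of A j] assms by (simp add: lin_scale mult_left_mono)
qed

lemma rew_gap: "rew A \<le> rew B + gap2 A B"
proof -
  obtain j where j: "rew B = lin B j" by (rule rew_attained)
  have "lin A j - lin B j = (\<Sum>k\<in>UNIV. \<Sum>i\<in>UNIV. (A k i - B k i) * g k i j)"
    by (simp add: lin_def sum_subtractf left_diff_distrib)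
  also have "\<dots> \<le> gap2 A B"
    unfolding gap2_def
  proof (intro sum_mono)
    fix k i
    have "(A k i - B k i) * g k i j \<le> \<bar>A k i - B k i\<bar> * g k i j"
      by (intro mult_right_mono g_nonneg) simp
    also have "\<dots> \<le> \<bar>A k i - B k i\<bar>" by (intro mult_left_le g_le_1) simp
    finally show "(A k i - B k i) * g k i j \<le> \<bar>A k i - B k i\<bar>" .
  qed
  finally show ?thesis using rew_le[of A j] j by simp
qed

lemma flow_nonneg: "flow x F \<Longrightarrow> F h k i \<ge> 0"
  by (simp add: flow_def)

lemma flow_marg_nonneg: "flow x F \<Longrightarrow> \<forall>k. marg (F h) k \<ge> 0"
  by (simp add: marg_def sum_nonneg flow_nonneg)

lemma flow_start: "flow x F \<Longrightarrow> marg (F []) = x"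
  by (simp add: flow_def)

lemma flow_start_nonneg: "flow x F \<Longrightarrow> \<forall>k. x k \<ge> 0"
  using flow_marg_nonneg[of x F "[]"] flow_start by simp

lemma flow_step: "flow x F \<Longrightarrow> marg (F (h @ [d])) = out (F h) d"
  by (simp add: flow_def)

lemma flow_tail: "flow x F \<Longrightarrow> flow (marg (F h)) (\<lambda>h'. F (h @ h'))"
  by (simp add: flow_def flip: append_assoc)

lemma sum_mass_out: "(\<Sum>d\<in>UNIV. mass (out A d)) = mass (marg A)"
proof -
  have "(\<Sum>d\<in>UNIV. mass (out A d))
      = (\<Sum>d\<in>UNIV. \<Sum>k\<in>UNIV. \<Sum>i\<in>UNIV. \<Sum>k'\<in>UNIV. A k i * Q k i k' d)"
    unfolding mass_def out_def
    by (subst sum.swap, intro sum.cong refl, subst sum.swap, rule refl)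
  also have "\<dots> = (\<Sum>k\<in>UNIV. \<Sum>i\<in>UNIV. \<Sum>d\<in>UNIV. \<Sum>k'\<in>UNIV. A k i * Q k i k' d)"
    by (subst sum.swap, intro sum.cong refl, subst sum.swap, rule refl)
  also have "\<dots> = mass (marg A)"
    by (simp add: mass_def marg_def Q_sum flip: sum_distrib_left)
  finally show ?thesis .
qed

lemma flow_mass: "flow x F \<Longrightarrow> (\<Sum>h | length h = t. mass (marg (F h))) = mass x"
proof (induction t)
  case 0
  then show ?case by (simp add: flow_start)
next
  case (Suc t)
  then show ?case by (simp add: sum_length_snoc flow_step sum_mass_out)
qed

lemma flow_sum:
  assumes "\<And>a. a \<in> S \<Longrightarrow> flow (x a) (F a)"
  shows "flow (\<lambda>k. \<Sum>a\<in>S. x a k) (\<lambda>h k i. \<Sum>a\<in>S. F a h k i)"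
proof -
  have m: "marg (\<lambda>k i. \<Sum>a\<in>S. A a k i) k = (\<Sum>a\<in>S. marg (A a) k)" for A k
    unfolding marg_def by (rule sum.swap)
  have o: "out (\<lambda>k i. \<Sum>a\<in>S. A a k i) d k = (\<Sum>a\<in>S. out (A a) d k)" for A d k
    unfolding out_def sum_distrib_right by (simp only: sum.swap[of _ _ S])
  show ?thesis
    using assms by (auto simp: flow_def m o fun_eq_iff intro!: sum_nonneg)
qed

lemma flow_scale:
  assumes "flow x F" "c \<ge> 0"
  shows "flow (\<lambda>k. c * x k) (\<lambda>h k i. c * F h k i)"
proof -
  have m: "marg (\<lambda>k i. c * A k i) k = c * marg A k" for A k
    by (simp add: marg_def sum_distrib_left)
  have o: "out (\<lambda>k i. c * A k i) d k = c * out A d k" for A d k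
    by (simp add: out_def sum_distrib_left mult.assoc)
  show ?thesis
    using assms by (auto simp: flow_def m o fun_eq_iff)
qed

lemma stage_nonneg: "flow x F \<Longrightarrow> stage F t \<ge> 0"
  by (simp add: stage_def sum_nonneg rew_nonneg flow_nonneg)

lemma stage_le_mass: "flow x F \<Longrightarrow> stage F t \<le> mass x"
  unfolding stage_def flow_mass[symmetric, of x F t]
  by (intro sum_mono rew_le_mass flow_nonneg)

lemma stage_sum_ge: "(\<Sum>a\<in>S. stage (F a) t) \<le> stage (\<lambda>h k i. \<Sum>a\<in>S. F a h k i) t"
  unfolding stage_def by (subst sum.swap) (intro sum_mono rew_sum_ge)

lemma stage_scale: "c \<ge> 0 \<Longrightarrow> stage (\<lambda>h k i. c * F h k i) t = c * stage F t"
  by (simp add: stage_def rew_scale sum_distrib_left)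

lemma stage_gap: "stage F t \<le> stage G t + (\<Sum>h | length h = t. gap2 (F h) (G h))"
  unfolding stage_def sum.distrib[symmetric] by (intro sum_mono rew_gap)

lemma stage_append: "stage F (m + t) = (\<Sum>h | length h = m. stage (\<lambda>h'. F (h @ h')) t)"
  by (simp add: stage_def sum_length_append)

section \<open>Generating flows from behaviour rules\<close>

primrec plan_flow ::
  "'d list \<Rightarrow> ('d list \<Rightarrow> 'k \<Rightarrow> 'i \<Rightarrow> real) \<Rightarrow> ('k \<Rightarrow> real) \<Rightarrow> 'k \<Rightarrow> 'i \<Rightarrow> real" where
  "plan_flow [] s x = (\<lambda>k i. x k * s [] k i)"
| "plan_flow (d # h) s x =
     plan_flow h (\<lambda>h'. s (d # h')) (out (\<lambda>k i. x k * s [] k i) d)"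

definition is_plan :: "('d list \<Rightarrow> 'k \<Rightarrow> 'i \<Rightarrow> real) \<Rightarrow> bool" where
  "is_plan s \<longleftrightarrow> (\<forall>h k i. s h k i \<ge> 0) \<and> (\<forall>h k. (\<Sum>i\<in>UNIV. s h k i) = 1)"

text \<open>The conditional law of the action; uniform where the conditioning event is null.\<close>

definition plan_of :: "('d list \<Rightarrow> 'k \<Rightarrow> 'i \<Rightarrow> real) \<Rightarrow> 'd list \<Rightarrow> 'k \<Rightarrow> 'i \<Rightarrow> real" where
  "plan_of F h k i = (if marg (F h) k = 0 then 1 / of_nat CARD('i) else F h k i / marg (F h) k)"

lemma is_plan_plan_of:
  assumes "\<And>h k i. F h k i \<ge> 0"
  shows "is_plan (plan_of F)"
proof -
  have "(\<Sum>i\<in>UNIV. plan_of F h k i) = 1" for h k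
    by (cases "marg (F h) k = 0") (simp_all add: plan_of_def marg_def flip: sum_divide_distrib)
  moreover have "plan_of F h k i \<ge> 0" for h k i
    using assms by (auto simp: plan_of_def marg_def intro!: divide_nonneg_nonneg sum_nonneg)
  ultimately show ?thesis by (simp add: is_plan_def)
qed

lemma marg_mult_plan_of:
  assumes "\<And>h k i. F h k i \<ge> 0"
  shows "marg (F h) k * plan_of F h k i = F h k i"
proof (cases "marg (F h) k = 0")
  case True
  then have "F h k i = 0"
    using assms by (simp add: marg_def sum_nonneg_eq_0_iff)
  with True show ?thesis by simp
qed (simp add: plan_of_def)

text \<open>Disintegration: the starting measure and the conditional laws of the action determine
  the flow. The default value at null events is harmless, since it is multiplied by zero
  there.\<close>

lemma plan_flow_plan_of: "flow x F \<Longrightarrow> plan_flow h (plan_of F) x = F h"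
proof (induction h arbitrary: x F)
  case Nil
  then show ?case
    using marg_mult_plan_of[of F "[]"] by (simp add: flow_start flow_nonneg)
next
  case (Cons d h)
  have eq: "(\<lambda>k i. x k * plan_of F [] k i) = F []"
    using Cons.prems marg_mult_plan_of[of F "[]"] by (simp add: flow_start flow_nonneg)
  have "flow (out (F []) d) (\<lambda>h'. F (d # h'))"
    using flow_tail[OF Cons.prems, of "[d]"] flow_step[OF Cons.prems, of "[]" d] by simp
  from Cons.IH[OF this] have "plan_flow h (plan_of (\<lambda>h'. F (d # h'))) (out (F []) d) = F (d # h)" .
  moreover have "(\<lambda>h'. plan_of F (d # h')) = plan_of (\<lambda>h'. F (d # h'))"
    by (simp add: plan_of_def fun_eq_iff)
  ultimately show ?case by (simp add: eq)
qed

lemma out_nonneg: "(\<And>k i. A k i \<ge> 0) \<Longrightarrow> out A d k \<ge> 0"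
  by (simp add: out_def sum_nonneg Q_nonneg)

lemma plan_tail: "is_plan s \<Longrightarrow> is_plan (\<lambda>h. s (d # h))"
  by (simp add: is_plan_def)

lemma plan_flow_nonneg:
  assumes "is_plan s" "\<forall>k. x k \<ge> 0"
  shows "plan_flow h s x k i \<ge> 0"
  using assms
proof (induction h arbitrary: s x)
  case (Cons d h)
  then show ?case
    using out_nonneg[of "\<lambda>k i. x k * s [] k i" d] by (simp add: plan_tail) (simp add: is_plan_def)
qed (simp add: is_plan_def)

lemma marg_plan:
  assumes "is_plan s"
  shows "marg (\<lambda>k i. x k * s h k i) = x"
  using assms by (simp add: marg_def is_plan_def fun_eq_iff flip: sum_distrib_left)

lemma marg_plan_flow_snoc:
  assumes "is_plan s"
  shows "marg (plan_flow (h @ [d]) s x) = out (plan_flow h s x) d"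
  using assms
proof (induction h arbitrary: s x)
  case Nil
  then show ?case using marg_plan[OF plan_tail] by simp
next
  case (Cons d' h)
  then show ?case using plan_tail by simp
qed

lemma flow_plan_flow:
  assumes "is_plan s" "\<forall>k. x k \<ge> 0"
  shows "flow x (\<lambda>h. plan_flow h s x)"
  using assms by (simp add: flow_def plan_flow_nonneg marg_plan_flow_snoc marg_plan)

lemma gap_out: "(\<Sum>d\<in>UNIV. gap (out A d) (out B d)) \<le> gap2 A B"
proof -
  have "gap (out A d) (out B d) \<le> mass (out (\<lambda>k i. \<bar>A k i - B k i\<bar>) d)" for d
    unfolding gap_def mass_def
  proof (intro sum_mono)
    fix k'
    have "out A d k' - out B d k' = (\<Sum>k\<in>UNIV. \<Sum>i\<in>UNIV. (A k i - B k i) * Q k i k' d)"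
      by (simp add: out_def sum_subtractf left_diff_distrib)
    also have "\<bar>\<dots>\<bar> \<le> (\<Sum>k\<in>UNIV. \<bar>\<Sum>i\<in>UNIV. (A k i - B k i) * Q k i k' d\<bar>)"
      by (rule sum_abs)
    also have "\<dots> \<le> (\<Sum>k\<in>UNIV. \<Sum>i\<in>UNIV. \<bar>(A k i - B k i) * Q k i k' d\<bar>)"
      by (intro sum_mono sum_abs)
    finally show "\<bar>out A d k' - out B d k'\<bar> \<le> out (\<lambda>k i. \<bar>A k i - B k i\<bar>) d k'"
      by (simp add: out_def abs_mult Q_nonneg)
  qed
  then have "(\<Sum>d\<in>UNIV. gap (out A d) (out B d))
      \<le> (\<Sum>d\<in>UNIV. mass (out (\<lambda>k i. \<bar>A k i - B k i\<bar>) d))"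
    by (intro sum_mono)
  also have "\<dots> = gap2 A B"
    unfolding sum_mass_out by (simp add: mass_def marg_def gap2_def)
  finally show ?thesis .
qed

lemma gap2_plan:
  assumes "is_plan s"
  shows "gap2 (\<lambda>k i. x k * s h k i) (\<lambda>k i. y k * s h k i) = gap x y"
proof -
  have "\<bar>x k * s h k i - y k * s h k i\<bar> = \<bar>x k - y k\<bar> * s h k i" for k i
    using assms by (simp add: is_plan_def abs_mult flip: left_diff_distrib)
  then show ?thesis
    using assms by (simp add: gap2_def gap_def is_plan_def flip: sum_distrib_left)
qed

text \<open>A plan followed by the transition is a Markov kernel and does not increase L1 distances.
  Since \<open>plan_flow\<close> consumes the first signal, the induction hypothesis applies to the
  updated measures and the shifted plan.\<close>

lemma plan_flow_gap:
  assumes "is_plan s"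
  shows "(\<Sum>h | length h = t. gap2 (plan_flow h s x) (plan_flow h s y)) \<le> gap x y"
  using assms
proof (induction t arbitrary: s x y)
  case 0
  then show ?case by (simp add: gap2_plan)
next
  case (Suc t)
  let ?A = "\<lambda>x k i. x k * s [] k i"
  have "(\<Sum>h | length h = Suc t. gap2 (plan_flow h s x) (plan_flow h s y))
      \<le> (\<Sum>d\<in>UNIV. gap (out (?A x) d) (out (?A y) d))"
    unfolding sum_length_Suc using Suc.IH[OF plan_tail[OF Suc.prems]] by (simp add: sum_mono)
  also have "\<dots> \<le> gap2 (?A x) (?A y)" by (rule gap_out)
  also have "\<dots> = gap x y" by (rule gap2_plan[OF Suc.prems])
  finally show ?case .
qed

text \<open>Run from \<open>y\<close> the plan that generates \<open>F\<close> from
  \<open>x\<close>. The error is the same at every stage, which makes later estimates uniform in the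
  length of a window.\<close>

lemma flow_transport:
  assumes "flow x F" "\<forall>k. y k \<ge> 0"
  obtains G where "flow y G" "\<And>t. stage F t \<le> stage G t + gap x y"
proof
  let ?G = "\<lambda>h. plan_flow h (plan_of F) y"
  have plan: "is_plan (plan_of F)"
    by (rule is_plan_plan_of) (rule flow_nonneg[OF assms(1)])
  show "flow y ?G" by (rule flow_plan_flow[OF plan assms(2)])
  show "stage F t \<le> stage ?G t + gap x y" for t
    using stage_gap[of F t ?G] plan_flow_gap[OF plan, of x y t]
    by (simp add: plan_flow_plan_of[OF assms(1)])
qed

lemma flow_exists:
  assumes "\<forall>k. x k \<ge> 0"
  obtains F where "flow x F"
proof -
  have "is_plan (plan_of (\<lambda>h k i. 0))" by (rule is_plan_plan_of) simp
  from flow_plan_flow[OF this assms] show thesis by (rule that)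
qed

text \<open>The continuation may depend on the whole history at the junction, so it can be chosen
  separately for each belief reached.\<close>

definition splice :: "nat \<Rightarrow> ('d list \<Rightarrow> 'k \<Rightarrow> 'i \<Rightarrow> real) \<Rightarrow>
    ('d list \<Rightarrow> 'd list \<Rightarrow> 'k \<Rightarrow> 'i \<Rightarrow> real) \<Rightarrow> 'd list \<Rightarrow> 'k \<Rightarrow> 'i \<Rightarrow> real" where
  "splice m F G h = (if length h < m then F h else G (take m h) (drop m h))"

lemma flow_splice:
  assumes F: "flow x F" and G: "\<And>h. length h = m \<Longrightarrow> flow (marg (F h)) (G h)"
  shows "flow x (splice m F G)"
proof -
  have marg: "marg (splice m F G h) = marg (F h)" if "length h \<le> m" for h
    using that by (cases "length h = m") (auto simp: splice_def flow_start[OF G])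
  have "marg (splice m F G (h @ [d])) = out (splice m F G h) d" for h d
  proof (cases "length h < m")
    case True
    then show ?thesis using marg[of "h @ [d]"] by (simp add: flow_step[OF F]) (simp add: splice_def)
  next
    case False
    then show ?thesis by (simp add: splice_def flow_step[OF G])
  qed
  moreover have "splice m F G h k i \<ge> 0" for h k i
    using F G[of "take m h"] by (auto simp: splice_def flow_def)
  ultimately show ?thesis
    using marg[of "[]"] by (simp add: flow_def flow_start[OF F])
qed

lemma stage_splice_add: "stage (splice m F G) (m + t) = (\<Sum>h | length h = m. stage (G h) t)"
  by (simp add: stage_append) (simp add: stage_def splice_def)

end

section \<open>The value of the control problem\<close>

text \<open>Grid coordinates, with mesh \<open>1 / N\<close>, of the normalised measure. They ignore
  scale, and a null measure gets the coordinates 0 because division by zero yields zero.\<close>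

definition cell :: "nat \<Rightarrow> ('k::finite \<Rightarrow> real) \<Rightarrow> 'k \<Rightarrow> nat" where
  "cell N x k = nat \<lfloor>real N * (x k / mass x)\<rfloor>"

lemma nat_floor_eq_dist:
  fixes a b :: real
  assumes "nat \<lfloor>a\<rfloor> = nat \<lfloor>b\<rfloor>" "a \<ge> 0" "b \<ge> 0"
  shows "\<bar>a - b\<bar> \<le> 1"
proof -
  have "\<lfloor>a\<rfloor> = \<lfloor>b\<rfloor>" using assms by (simp add: nat_eq_iff)
  then show ?thesis by linarith
qed

text \<open>Cross-multiplied form of a distance at most \<open>1 / N\<close> between the normalised
  measures. It covers null measures, and the difference and its bound are linear in
  \<open>y\<close>, so the estimate can be summed over a cell.\<close>

lemma cell_dist:
  assumes x: "\<forall>k. x k \<ge> 0" and y: "\<forall>k. y k \<ge> 0" and eq: "cell N x = cell N y" and N: "N > 0"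
  shows "\<bar>mass x * y k - mass y * x k\<bar> \<le> mass x * mass y / N"
proof (cases "mass x = 0 \<or> mass y = 0")
  case True
  then show ?thesis using mass_eq_0[of x, OF x] mass_eq_0[of y, OF y] by auto
next
  case False
  then have pos: "mass x > 0" "mass y > 0"
    using mass_nonneg[of x, OF x] mass_nonneg[of y, OF y] by auto
  have "\<bar>real N * (y k / mass y) - real N * (x k / mass x)\<bar> \<le> 1"
    using fun_cong[OF eq, of k] pos x y
    by (intro nat_floor_eq_dist) (auto simp: cell_def)
  then have "real N * \<bar>y k / mass y - x k / mass x\<bar> \<le> 1"
    using abs_mult[of "real N" "y k / mass y - x k / mass x"] by (simp add: right_diff_distrib)
  then have "mass x * mass y * (real N * \<bar>y k / mass y - x k / mass x\<bar>) \<le> mass x * mass y"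
    using pos by (intro mult_left_le) auto
  moreover have "mass x * y k - mass y * x k = mass x * mass y * (y k / mass y - x k / mass x)"
    using pos by (simp add: right_diff_distrib)
  then have "\<bar>mass x * y k - mass y * x k\<bar> = mass x * mass y * \<bar>y k / mass y - x k / mass x\<bar>"
    using pos by (simp only: abs_mult)
  ultimately show ?thesis
    using N by (simp add: pos_le_divide_eq ac_simps)
qed

lemma cell_le:
  assumes "\<forall>k. x k \<ge> 0"
  shows "cell N x k \<le> N"
proof -
  have "x k / mass x \<le> 1"
    using le_mass[of x k, OF assms] mass_nonneg[of x, OF assms] by (auto simp: divide_le_eq_1)
  then have "real N * (x k / mass x) \<le> real N"
    by (rule mult_left_le) simp
  then have "\<lfloor>real N * (x k / mass x)\<rfloor> \<le> int N"
    by (metis floor_mono floor_of_nat)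
  then show ?thesis by (simp add: cell_def)
qed

lemma finite_bounded_funs: "finite {c :: 'k::finite \<Rightarrow> nat. \<forall>k. c k \<le> N}"
proof -
  have "{c :: 'k \<Rightarrow> nat. \<forall>k. c k \<le> N} = PiE UNIV (\<lambda>_. {..N})"
    by (auto simp: PiE_UNIV_domain)
  then show ?thesis by (simp add: finite_PiE)
qed

lemma gap_cell:
  fixes x y :: "'k::finite \<Rightarrow> real"
  assumes "\<forall>k. x k \<ge> 0" "\<forall>k. y k \<ge> 0" "cell N x = cell N y" "N > 0" "mass x = 1" "mass y = 1"
  shows "gap x y \<le> CARD('k) / N"
  using cell_dist[OF assms(1-4)] assms(5,6)
  unfolding gap_def
  by (intro order.trans[OF sum_bounded_above[where K = "1 / N"]]) (auto simp: abs_minus_commute)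

text \<open>Compactness in finite form: choose one representative per value of \<open>f\<close> and
  take the largest of their bounds. The bound concerns the representative \<open>a'\<close>, so any
  use has to carry the result back to \<open>a\<close> within its class.\<close>

lemma finite_range_uniform_bound:
  fixes P :: "'a \<Rightarrow> nat \<Rightarrow> bool"
  assumes "finite (f ` A)" "\<And>a. a \<in> A \<Longrightarrow> \<exists>M. P a M" "\<And>a M M'. P a M \<Longrightarrow> M \<le> M' \<Longrightarrow> P a M'"
  shows "\<exists>M. \<forall>a\<in>A. \<exists>a'\<in>A. f a' = f a \<and> P a' M"
proof -
  have "\<forall>c\<in>f ` A. \<exists>M. \<exists>a'\<in>A. f a' = c \<and> P a' M" using assms(2) by blast
  then obtain B where B: "\<And>c. c \<in> f ` A \<Longrightarrow> \<exists>a'\<in>A. f a' = c \<and> P a' (B c)" by metis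
  have "\<exists>a'\<in>A. f a' = f a \<and> P a' (Max (B ` f ` A))" if "a \<in> A" for a
  proof -
    from B[of "f a"] that obtain a' where a': "a' \<in> A" "f a' = f a" "P a' (B (f a))" by blast
    have "B (f a) \<le> Max (B ` f ` A)" using assms(1) that by (intro Max_ge) auto
    with a' assms(3) show ?thesis by blast
  qed
  then show ?thesis by blast
qed

text \<open>Block \<open>l\<close> lasts \<open>Suc (len l)\<close> stages, never zero, so each
  recursive call shortens the history. The next block starts from the belief reached at the end of
  this one.\<close>

function glue :: "(nat \<Rightarrow> nat) \<Rightarrow> (nat \<Rightarrow> ('k \<Rightarrow> real) \<Rightarrow> 'd list \<Rightarrow> 'k \<Rightarrow> 'i::finite \<Rightarrow> real) \<Rightarrow>
    nat \<Rightarrow> ('k \<Rightarrow> real) \<Rightarrow> 'd list \<Rightarrow> 'k \<Rightarrow> 'i \<Rightarrow> real" where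
  "glue len B l y h = (if length h < Suc (len l) then B l y h
     else glue len B (Suc l) (marg (B l y (take (Suc (len l)) h))) (drop (Suc (len l)) h))"
  by pat_completeness auto
termination by (relation "Wellfounded.measure (\<lambda>(len, B, l, y, h). length h)") auto

declare glue.simps [simp del]

context controlled_chain
begin

section \<open>Best window payoffs and their asymptotic average\<close>

definition window :: "('d list \<Rightarrow> 'k \<Rightarrow> 'i \<Rightarrow> real) \<Rightarrow> nat \<Rightarrow> nat \<Rightarrow> real" where
  "window F m n = (\<Sum>t<n. stage F (m + t))"

text \<open>The starting stage \<open>m\<close> is free. This makes \<open>best\<close> subadditive
  in the length, and makes \<open>best n x\<close> a bound for every later block as seen from the
  initial belief, which is what player 2 can defend.\<close>

definition best :: "nat \<Rightarrow> ('k \<Rightarrow> real) \<Rightarrow> real" where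
  "best n x = Sup {window F m n | F m. flow x F}"

text \<open>By subadditivity this infimum is also the limit of the averages;
  \<open>best_eventually_le\<close> provides the upper half of that fact.\<close>

definition val :: "('k \<Rightarrow> real) \<Rightarrow> real" where
  "val x = (INF n. best (Suc n) x / real (Suc n))"

lemma window_0 [simp]: "window F m 0 = 0"
  by (simp add: window_def)

lemma window_nonneg: "flow x F \<Longrightarrow> window F m n \<ge> 0"
  by (simp add: window_def sum_nonneg stage_nonneg)

lemma window_le: "flow x F \<Longrightarrow> window F m n \<le> n * mass x"
  unfolding window_def
  using sum_bounded_above[of "{..<n}" "\<lambda>t. stage F (m + t)" "mass x"] by (simp add: stage_le_mass)

lemma window_add: "window F m (n + n') = window F m n + window F (m + n) n'"
  by (induction n') (simp_all add: window_def add.assoc)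

lemma window_scale: "c \<ge> 0 \<Longrightarrow> window (\<lambda>h k i. c * F h k i) m n = c * window F m n"
  by (simp add: window_def stage_scale sum_distrib_left)

lemma window_tail: "(\<Sum>h | length h = m. window (\<lambda>h'. F (h @ h')) 0 n) = window F m n"
  unfolding window_def by (subst sum.swap) (simp add: stage_append)

lemma window_le_best:
  assumes "flow x F"
  shows "window F m n \<le> best n x"
  unfolding best_def
proof (rule cSup_upper)
  show "bdd_above {window F m n | F m. flow x F}"
    by (rule bdd_aboveI[where M = "n * mass x"]) (auto simp: window_le)
qed (use assms in auto)

lemma best_least:
  assumes "\<forall>k. x k \<ge> 0" "\<And>F m. flow x F \<Longrightarrow> window F m n \<le> b"
  shows "best n x \<le> b"
  unfolding best_def
proof (rule cSup_least)
  show "{window F m n | F m. flow x F} \<noteq> {}"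
    by (rule flow_exists[OF assms(1)]) auto
qed (use assms(2) in auto)

lemma best_nonneg:
  assumes "\<forall>k. x k \<ge> 0"
  shows "best n x \<ge> 0"
proof (rule flow_exists[OF assms])
  fix F assume "flow x F"
  from window_nonneg[OF this, of 0 n] window_le_best[OF this, of 0 n] show ?thesis by simp
qed

lemma best_le: "(\<forall>k. x k \<ge> 0) \<Longrightarrow> best n x \<le> n * mass x"
  by (intro best_least window_le)

lemma best_add:
  assumes "\<forall>k. x k \<ge> 0"
  shows "best (n + n') x \<le> best n x + best n' x"
  by (rule best_least[OF assms]) (auto simp: window_add intro!: add_mono window_le_best)

lemma best_mult:
  assumes "\<forall>k. x k \<ge> 0"
  shows "best (q * n) x \<le> q * best n x"
proof (induction q)
  case 0
  then show ?case using best_le[OF assms, of 0] by simp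
next
  case (Suc q)
  then show ?case using best_add[OF assms, of n "q * n"] by (simp add: algebra_simps)
qed

lemma best_gap:
  assumes "\<forall>k. x k \<ge> 0" "\<forall>k. y k \<ge> 0"
  shows "best n x \<le> best n y + n * gap x y"
proof (rule best_least[OF assms(1)])
  fix F m assume F: "flow x F"
  obtain G where G: "flow y G" "\<And>t. stage F t \<le> stage G t + gap x y"
    by (rule flow_transport[OF F assms(2)]) blast
  have "window F m n \<le> (\<Sum>t<n. stage G (m + t) + gap x y)"
    unfolding window_def by (intro sum_mono G)
  then show "window F m n \<le> best n y + n * gap x y"
    using window_le_best[OF G(1), of m n] by (simp add: sum.distrib window_def)
qed

lemma best_scale_ge:
  assumes "\<forall>k. x k \<ge> 0" "c > 0"
  shows "c * best n x \<le> best n (\<lambda>k. c * x k)"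
proof -
  have "best n x \<le> best n (\<lambda>k. c * x k) / c"
  proof (rule best_least[OF assms(1)])
    fix F m assume "flow x F"
    from window_le_best[OF flow_scale[OF this], of c m n] assms(2)
    show "window F m n \<le> best n (\<lambda>k. c * x k) / c"
      by (simp add: window_scale field_simps)
  qed
  then show ?thesis using assms(2) by (simp add: field_simps)
qed

lemma best_scale:
  assumes "\<forall>k. x k \<ge> 0" "c > 0"
  shows "best n (\<lambda>k. c * x k) = c * best n x"
  using best_scale_ge[OF assms, of n] best_scale_ge[of "\<lambda>k. c * x k" "1 / c" n] assms
  by (simp add: field_simps)

lemma bdd_below_best_average: "(\<forall>k. x k \<ge> 0) \<Longrightarrow> bdd_below (range (\<lambda>n. best (Suc n) x / real (Suc n)))"
  by (rule bdd_belowI[where m = 0]) (auto simp: best_nonneg)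

lemma val_le:
  assumes "\<forall>k. x k \<ge> 0"
  shows "n * val x \<le> best n x"
proof (cases n)
  case 0
  then show ?thesis using best_nonneg[OF assms] by simp
next
  case (Suc m)
  have "val x \<le> best (Suc m) x / real (Suc m)"
    unfolding val_def by (rule cINF_lower[OF bdd_below_best_average[OF assms]]) simp
  then show ?thesis using Suc by (simp add: field_simps)
qed

lemma val_ge: "(\<And>n. n > 0 \<Longrightarrow> n * b \<le> best n x) \<Longrightarrow> b \<le> val x"
  unfolding val_def by (rule cINF_greatest) (simp_all add: pos_le_divide_eq mult.commute del: of_nat_Suc)

lemma val_nonneg: "(\<forall>k. x k \<ge> 0) \<Longrightarrow> val x \<ge> 0"
  by (rule val_ge) (simp add: best_nonneg)

lemma val_le_mass: "(\<forall>k. x k \<ge> 0) \<Longrightarrow> val x \<le> mass x"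
  using val_le[of x 1] best_le[of x 1] by simp

lemma val_gap:
  assumes "\<forall>k. x k \<ge> 0" "\<forall>k. y k \<ge> 0"
  shows "val x \<le> val y + gap x y"
proof -
  have "val x - gap x y \<le> val y"
  proof (rule val_ge)
    fix n :: nat assume "n > 0"
    show "n * (val x - gap x y) \<le> best n y"
      using val_le[OF assms(1), of n] best_gap[OF assms, of n] by (simp add: algebra_simps)
  qed
  then show ?thesis by simp
qed

lemma val_scale:
  assumes "\<forall>k. x k \<ge> 0" "c > 0"
  shows "val (\<lambda>k. c * x k) = c * val x"
proof -
  have ge: "c * val x \<le> val (\<lambda>k. c * x k)" if "\<forall>k. x k \<ge> 0" "c > 0" for x c
    using val_le[OF that(1)] that(2) by (intro val_ge) (simp add: best_scale[OF that] mult.left_commute)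
  show ?thesis
    using ge[OF assms] ge[of "\<lambda>k. c * x k" "1 / c"] assms by (simp add: field_simps)
qed

text \<open>The argument of Fekete's lemma: cut \<open>T\<close> stages into windows of a nearly
  optimal length \<open>n\<close> and a remainder shorter than \<open>n\<close>.\<close>

lemma best_eventually_le:
  assumes x: "\<forall>k. x k \<ge> 0" and "\<epsilon> > 0"
  shows "\<exists>T0. \<forall>T\<ge>T0. best T x \<le> T * (val x + \<epsilon>)"
proof -
  have "\<not> val x + \<epsilon> / 2 \<le> val x" using \<open>\<epsilon> > 0\<close> by simp
  then obtain n where n: "n > 0" "best n x < n * (val x + \<epsilon> / 2)"
    using val_ge[of "val x + \<epsilon> / 2" x] by (meson not_le)
  \<comment> \<open>From here on the remainder, worth at most \<open>n * mass x\<close>, costs no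
    more than the second half of \<open>\<epsilon>\<close>.\<close>
  obtain T0 :: nat where T0: "real T0 \<ge> 2 * (n * mass x) / \<epsilon>"
    using real_arch_simple by blast
  have "best T x \<le> T * (val x + \<epsilon>)" if "T \<ge> T0" for T
  proof -
    let ?q = "T div n" and ?r = "T mod n"
    have T: "T = ?q * n + ?r" by simp
    have "best T x \<le> best (?q * n) x + best ?r x"
      by (subst (1) T) (rule best_add[OF x])
    also have "\<dots> \<le> ?q * best n x + ?r * mass x"
      by (intro add_mono best_mult best_le x)
    also have "\<dots> \<le> ?q * (n * (val x + \<epsilon> / 2)) + n * mass x"
      using n mass_nonneg[OF x] by (intro add_mono mult_left_mono mult_right_mono) (auto intro: less_imp_le)
    also have "\<dots> \<le> T * (val x + \<epsilon> / 2) + n * mass x"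
    proof -
      have "real ?q * n \<le> T" by (subst (2) T) (simp only: of_nat_add of_nat_mult le_add_same_cancel1 of_nat_0_le_iff)
      then have "real ?q * n * (val x + \<epsilon> / 2) \<le> T * (val x + \<epsilon> / 2)"
        using val_nonneg[OF x] \<open>\<epsilon> > 0\<close> by (intro mult_right_mono) auto
      then show ?thesis by (simp add: mult.assoc)
    qed
    also have "n * mass x \<le> T * (\<epsilon> / 2)"
    proof -
      have "2 * (n * mass x) / \<epsilon> \<le> T" using T0 that by linarith
      then show ?thesis using \<open>\<epsilon> > 0\<close> by (simp add: field_simps)
    qed
    finally show ?thesis by (simp add: algebra_simps)
  qed
  then show ?thesis by blast
qed

text \<open>The window starts at the minimum over \<open>T\<close> of the excess \<open>window F m T - c T\<close>. As
  this excess is large at the end of a long window, the minimum is attained far from the end.\<close>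

lemma good_start:
  assumes x: "\<forall>k. x k \<ge> 0" and "\<epsilon> > 0"
  obtains F m where "flow x F" "\<And>t. t \<le> n \<Longrightarrow> t * (val x - \<epsilon>) \<le> window F m t"
proof -
  \<comment> \<open>The excess will be nonpositive at its minimum and above
    \<open>n' * (\<epsilon> / 2)\<close> at the end, whereas fewer than \<open>n\<close> stages add
    at most \<open>n * (mass x + \<epsilon>)\<close>. This \<open>n'\<close> makes the two
    incompatible, so at least \<open>n\<close> stages remain after the minimum.\<close>
  obtain n' :: nat where n': "real n' \<ge> 2 * (n * (mass x + \<epsilon>)) / \<epsilon> + 1"
    using real_arch_simple by blast
  moreover have "2 * (n * (mass x + \<epsilon>)) / \<epsilon> \<ge> 0"
    using mass_nonneg[OF x] \<open>\<epsilon> > 0\<close> by simp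
  ultimately have "n' > 0" by (intro Nat.gr0I) auto
  have n'2: "n' * (\<epsilon> / 2) > n * (mass x + \<epsilon>)"
    using n' \<open>\<epsilon> > 0\<close> by (simp add: field_simps)
  have "n' * (val x - \<epsilon> / 2) < n' * val x"
    using \<open>n' > 0\<close> \<open>\<epsilon> > 0\<close> by (intro mult_strict_left_mono) auto
  then have "\<not> best n' x \<le> n' * (val x - \<epsilon> / 2)"
    using val_le[OF x, of n'] by linarith
  then obtain F m where F: "flow x F" and Fm: "window F m n' > n' * (val x - \<epsilon> / 2)"
    using best_least[OF x, of n'] by (meson not_le)
  define c where "c = val x - \<epsilon>"
  define A where "A T = window F m T - T * c" for T :: nat
  obtain T where T: "T \<le> n'" "\<And>s. s \<le> n' \<Longrightarrow> A T \<le> A s"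
    using ex_is_arg_min_if_finite[of "{..n'}" A] by (auto simp: is_arg_min_linorder)
  have split: "A (T + s) = A T + window F (m + T) s - s * c" for s
    by (simp add: A_def window_add algebra_simps)
  have "T + n \<le> n'"
  proof (rule ccontr)
    assume "\<not> T + n \<le> n'"
    obtain s where s: "n' = T + s" using T(1) le_Suc_ex by blast
    have "n' * (\<epsilon> / 2) < A n'" using Fm by (simp add: A_def c_def algebra_simps)
    also have "A n' = A T + window F (m + T) s - s * c" unfolding s by (rule split)
    also have "\<dots> \<le> s * mass x - s * c"
      using T(2)[of 0] window_le[OF F, of "m + T" s] by (simp add: A_def)
    also have "\<dots> \<le> s * (mass x + \<epsilon>)"
      using val_nonneg[OF x] by (simp add: c_def algebra_simps)
    also have "\<dots> \<le> n * (mass x + \<epsilon>)"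
      using \<open>\<not> T + n \<le> n'\<close> s mass_nonneg[OF x] \<open>\<epsilon> > 0\<close> by (intro mult_right_mono) auto
    finally show False using n'2 by simp
  qed
  show thesis
  proof (rule that[OF F])
    fix t assume "t \<le> n"
    with \<open>T + n \<le> n'\<close> have "A T \<le> A (T + t)" by (intro T(2)) simp
    then show "t * (val x - \<epsilon>) \<le> window F (m + T) t" by (simp add: split c_def)
  qed
qed

text \<open>Two families of beliefs whose aggregates over each cell are close have continuation
  payoffs that are close: merging flows does not decrease the payoff, and a flow from the merged
  point can be split among beliefs in the same direction.\<close>

lemma flow_family_transfer:
  fixes y :: "'a \<Rightarrow> 'k \<Rightarrow> real" and z :: "'b \<Rightarrow> 'k \<Rightarrow> real"
  assumes fin: "finite A" "finite B" and N: "N > 0"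
    and G: "\<And>a. a \<in> A \<Longrightarrow> flow (y a) (G a)"
    and z: "\<And>b. b \<in> B \<Longrightarrow> \<forall>k. z b k \<ge> 0"
    and gap: "(\<Sum>c | \<forall>k. c k \<le> N. gap (\<lambda>k. \<Sum>a | a \<in> A \<and> cell N (y a) = c. y a k)
                (\<lambda>k. \<Sum>b | b \<in> B \<and> cell N (z b) = c. z b k)) \<le> \<eta>"
  obtains H where "\<And>b. b \<in> B \<Longrightarrow> flow (z b) (H b)"
    "\<And>t. (\<Sum>a\<in>A. stage (G a) t) \<le> (\<Sum>b\<in>B. stage (H b) t) + \<eta> + CARD('k) / N * (\<Sum>b\<in>B. mass (z b))"
proof -
  define C where "C = {c :: 'k \<Rightarrow> nat. \<forall>k. c k \<le> N}"
  define Y where "Y c = (\<lambda>k. \<Sum>a | a \<in> A \<and> cell N (y a) = c. y a k)" for c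
  define Z where "Z c = (\<lambda>k. \<Sum>b | b \<in> B \<and> cell N (z b) = c. z b k)" for c
  have finC: "finite C" unfolding C_def by (rule finite_bounded_funs)
  have Z: "\<forall>k. Z c k \<ge> 0" for c unfolding Z_def by (intro allI sum_nonneg) (simp add: z)
  have cellA: "(\<lambda>a. cell N (y a)) ` A \<subseteq> C"
    using cell_le[OF flow_start_nonneg[OF G]] by (auto simp: C_def)
  have cellB: "(\<lambda>b. cell N (z b)) ` B \<subseteq> C"
    using cell_le[OF z] by (auto simp: C_def)
  \<comment> \<open>Within each cell the flows are first merged, at no loss, and the merged flow is
    then transported from \<open>Y c\<close> to \<open>Z c\<close>.\<close>
  have "\<forall>c. \<exists>H. flow (Z c) H \<and> (\<forall>t. (\<Sum>a | a \<in> A \<and> cell N (y a) = c. stage (G a) t) \<le> stage H t + gap (Y c) (Z c))"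
  proof
    fix c
    have "flow (Y c) (\<lambda>h k i. \<Sum>a | a \<in> A \<and> cell N (y a) = c. G a h k i)"
      unfolding Y_def by (rule flow_sum) (simp add: G)
    then obtain H where H: "flow (Z c) H"
      "\<And>t. stage (\<lambda>h k i. \<Sum>a | a \<in> A \<and> cell N (y a) = c. G a h k i) t \<le> stage H t + gap (Y c) (Z c)"
      by (rule flow_transport[OF _ Z[of c]]) blast
    show "\<exists>H. flow (Z c) H \<and> (\<forall>t. (\<Sum>a | a \<in> A \<and> cell N (y a) = c. stage (G a) t) \<le> stage H t + gap (Y c) (Z c))"
      by (intro exI[of _ H] conjI H(1) allI order.trans[OF stage_sum_ge H(2)])
  qed
  from choice[OF this] obtain H where H: "\<And>c. flow (Z c) (H c)"
    "\<And>c t. (\<Sum>a | a \<in> A \<and> cell N (y a) = c. stage (G a) t) \<le> stage (H c) t + gap (Y c) (Z c)"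
    by blast
  \<comment> \<open>The share of \<open>b\<close> in the mass of its cell, equal to 0 for a null
    cell. Multiplying \<open>H c\<close> by this share gives a flow that starts close to
    \<open>z b\<close>, because the beliefs of a cell are almost proportional.\<close>
  define \<alpha> where "\<alpha> b = mass (z b) / mass (Z (cell N (z b)))" for b
  have \<alpha>: "\<alpha> b \<ge> 0" if "b \<in> B" for b
    using that by (auto simp: \<alpha>_def intro!: divide_nonneg_nonneg mass_nonneg z Z)
  have "\<forall>b\<in>B. \<exists>K. flow (z b) K \<and> (\<forall>t. \<alpha> b * stage (H (cell N (z b))) t \<le> stage K t + mass (z b) * (CARD('k) / N))"
  proof
    fix b assume b: "b \<in> B"
    let ?c = "cell N (z b)"
    let ?M = "mass (Z ?c)"
    have M: "?M = (\<Sum>b' | b' \<in> B \<and> cell N (z b') = ?c. mass (z b'))"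
      unfolding Z_def by (rule mass_sum)
    have zM: "mass (z b) \<le> ?M"
      unfolding M using b fin by (intro member_le_sum) (auto intro!: mass_nonneg z)
    have "\<bar>\<alpha> b * Z ?c k - z b k\<bar> \<le> mass (z b) / N" for k
    proof (cases "?M = 0")
      case True
      then have "mass (z b) = 0" using zM mass_nonneg[OF z[OF b]] by simp
      then show ?thesis using mass_eq_0[of "z b", OF z[OF b]] by (simp add: \<alpha>_def)
    next
      case False
      then have pos: "?M > 0" using mass_nonneg[OF Z, of ?c] by simp
      \<comment> \<open>Written as a sum over the cell, so that the pairwise estimate of
        \<open>cell_dist\<close> applies to each term.\<close>
      have "\<bar>mass (z b) * Z ?c k - ?M * z b k\<bar>
          = \<bar>\<Sum>b' | b' \<in> B \<and> cell N (z b') = ?c. mass (z b) * z b' k - mass (z b') * z b k\<bar>"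
        unfolding M unfolding Z_def by (simp add: sum_subtractf sum_distrib_left sum_distrib_right)
      also have "\<dots> \<le> (\<Sum>b' | b' \<in> B \<and> cell N (z b') = ?c. \<bar>mass (z b) * z b' k - mass (z b') * z b k\<bar>)"
        by (rule sum_abs)
      also have "\<dots> \<le> (\<Sum>b' | b' \<in> B \<and> cell N (z b') = ?c. mass (z b) * mass (z b') / N)"
        using N by (intro sum_mono cell_dist) (auto simp: z b)
      also have "\<dots> = mass (z b) * ?M / N"
        unfolding M by (simp add: sum_distrib_left sum_divide_distrib)
      finally have "\<bar>mass (z b) * Z ?c k - ?M * z b k\<bar> / ?M \<le> mass (z b) / N"
        using pos by (simp add: field_simps)
      moreover have "\<alpha> b * Z ?c k - z b k = (mass (z b) * Z ?c k - ?M * z b k) / ?M"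
        using pos by (simp add: \<alpha>_def diff_divide_distrib)
      ultimately show ?thesis using pos by simp
    qed
    then have g: "gap (\<lambda>k. \<alpha> b * Z ?c k) (z b) \<le> mass (z b) * (CARD('k) / N)"
      unfolding gap_def
      by (intro order.trans[OF sum_bounded_above[where K = "mass (z b) / N"]]) (auto simp: mult.commute)
    obtain K where K: "flow (z b) K"
      "\<And>t. stage (\<lambda>h k i. \<alpha> b * H ?c h k i) t \<le> stage K t + gap (\<lambda>k. \<alpha> b * Z ?c k) (z b)"
      by (rule flow_transport[OF flow_scale[OF H(1)[of ?c] \<alpha>[OF b]] z[OF b]]) blast
    have "\<alpha> b * stage (H ?c) t \<le> stage K t + mass (z b) * (CARD('k) / N)" for t
      using K(2)[of t] g stage_scale[OF \<alpha>[OF b], of "H ?c" t] by linarith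
    then show "\<exists>K. flow (z b) K \<and> (\<forall>t. \<alpha> b * stage (H ?c) t \<le> stage K t + mass (z b) * (CARD('k) / N))"
      using K(1) by blast
  qed
  from bchoice[OF this] obtain K where K: "\<And>b. b \<in> B \<Longrightarrow> flow (z b) (K b)"
    "\<And>b t. b \<in> B \<Longrightarrow> \<alpha> b * stage (H (cell N (z b))) t \<le> stage (K b) t + mass (z b) * (CARD('k) / N)"
    by blast
  have cell_stage: "stage (H c) t \<le> (\<Sum>b | b \<in> B \<and> cell N (z b) = c. stage (K b) t + mass (z b) * (CARD('k) / N))" for c t
  proof -
    have "stage (H c) t \<le> (\<Sum>b | b \<in> B \<and> cell N (z b) = c. \<alpha> b * stage (H c) t)"
    proof (cases "mass (Z c) = 0")
      case True
      \<comment> \<open>In a null cell the shares do not sum to 1, but there is no payoff to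
        distribute either.\<close>
      then have "stage (H c) t = 0"
        using stage_le_mass[OF H(1), of c t] stage_nonneg[OF H(1), of c t] by simp
      then show ?thesis by simp
    next
      case False
      have "(\<Sum>b | b \<in> B \<and> cell N (z b) = c. \<alpha> b) = (\<Sum>b | b \<in> B \<and> cell N (z b) = c. mass (z b)) / mass (Z c)"
        by (simp add: \<alpha>_def sum_divide_distrib)
      also have "\<dots> = 1" using False mass_sum[of z "{b \<in> B. cell N (z b) = c}"] by (simp add: Z_def)
      finally show ?thesis by (simp flip: sum_distrib_right)
    qed
    also have "\<dots> \<le> (\<Sum>b | b \<in> B \<and> cell N (z b) = c. stage (K b) t + mass (z b) * (CARD('k) / N))"
      using K(2) by (intro sum_mono) auto
    finally show ?thesis .
  qed
  show thesis
  proof (rule that[of K])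
    fix t
    have "(\<Sum>a\<in>A. stage (G a) t) = (\<Sum>c\<in>C. \<Sum>a | a \<in> A \<and> cell N (y a) = c. stage (G a) t)"
      by (rule sum.group[OF fin(1) finC cellA, symmetric])
    also have "\<dots> \<le> (\<Sum>c\<in>C. (\<Sum>b | b \<in> B \<and> cell N (z b) = c. stage (K b) t + mass (z b) * (CARD('k) / N)) + gap (Y c) (Z c))"
      by (intro sum_mono order.trans[OF H(2)] add_right_mono cell_stage)
    also have "\<dots> = (\<Sum>b\<in>B. stage (K b) t + mass (z b) * (CARD('k) / N)) + (\<Sum>c\<in>C. gap (Y c) (Z c))"
      using sum.group[OF fin(2) finC cellB, of "\<lambda>b. stage (K b) t + mass (z b) * (CARD('k) / N)"]
      by (simp only: sum.distrib)
    also have "\<dots> \<le> (\<Sum>b\<in>B. stage (K b) t) + \<eta> + CARD('k) / N * (\<Sum>b\<in>B. mass (z b))"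
      using gap sum_distrib_right[of "\<lambda>b. mass (z b)" B "CARD('k) / N"]
      by (simp add: sum.distrib Y_def Z_def C_def mult.commute)
    finally show "(\<Sum>a\<in>A. stage (G a) t) \<le> (\<Sum>b\<in>B. stage (K b) t) + \<eta> + CARD('k) / N * (\<Sum>b\<in>B. mass (z b))" .
  qed (rule K(1))
qed


text \<open>Triples (initial belief, flow, stage) are sorted into finitely many classes by the
  rounded initial belief and the rounded law of the belief at that stage. A good window that starts
  late is replaced by the early representative of its class, followed by the continuations of the
  original flow.\<close>

lemma uniform_start:
  assumes "\<epsilon> > 0"
  obtains M where "\<And>x n. \<forall>k. x k \<ge> 0 \<Longrightarrow> mass x = 1 \<Longrightarrow>
    \<exists>F m. flow x F \<and> m \<le> M \<and> (\<forall>t\<le>n. t * (val x - \<epsilon>) \<le> window F m t)"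
proof -
  \<comment> \<open>Half of \<open>\<epsilon>\<close> goes to the good start. A sixth each pays for
    spreading continuations within cells, for rounding the aggregates with mesh
    \<open>1 / L\<close>, and for moving the initial belief from \<open>x0\<close> to
    \<open>x\<close>.\<close>
  obtain N0 :: nat where N0: "6 * CARD('k) / \<epsilon> \<le> real N0" using real_arch_simple by blast
  define N where "N = Suc N0"
  have N: "N > 0" "CARD('k) / N \<le> \<epsilon> / 6"
    using N0 \<open>\<epsilon> > 0\<close> by (auto simp: N_def field_simps)
  define C where "C = {c :: 'k \<Rightarrow> nat. \<forall>k. c k \<le> N}"
  have finC: "finite C" unfolding C_def by (rule finite_bounded_funs)
  obtain L0 :: nat where L0: "6 * (card C * CARD('k)) / \<epsilon> \<le> real L0" using real_arch_simple by blast
  define L where "L = Suc L0"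
  have L: "L > 0" "card C * (CARD('k) / L) \<le> \<epsilon> / 6"
    using L0 \<open>\<epsilon> > 0\<close> by (auto simp: L_def field_simps)
  \<comment> \<open>The law of the belief at stage \<open>m\<close>, coarsened to one total measure
    per cell.\<close>
  define agg where "agg F m c = (\<lambda>k. \<Sum>h | h \<in> {h. length h = m} \<and> cell N (marg (F h)) = c. marg (F h) k)"
    for F :: "'d list \<Rightarrow> 'k \<Rightarrow> 'i \<Rightarrow> real" and m c
  define S where "S = {(x, F, m :: nat) | x F m. (\<forall>k. x k \<ge> 0) \<and> mass x = 1 \<and> flow x F}"
  \<comment> \<open>\<open>restrict\<close> makes the second component extensional, so that the
    classes lie in a finite product set.\<close>
  define cls where "cls = (\<lambda>(x :: 'k \<Rightarrow> real, F, m). (cell N x, restrict (\<lambda>c k. nat \<lfloor>real L * agg F m c k\<rfloor>) C))"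
  have agg: "0 \<le> agg F m c k" "agg F m c k \<le> 1" if "flow x F" "mass x = 1" for x F m c k
  proof -
    show "0 \<le> agg F m c k"
      unfolding agg_def using flow_marg_nonneg[OF that(1)] by (intro sum_nonneg) auto
    have "agg F m c k \<le> (\<Sum>h | h \<in> {h. length h = m} \<and> cell N (marg (F h)) = c. mass (marg (F h)))"
      unfolding agg_def by (intro sum_mono le_mass flow_marg_nonneg[OF that(1)])
    also have "\<dots> \<le> (\<Sum>h | length h = m. mass (marg (F h)))"
      by (intro sum_mono2 finite_length_eq) (auto intro!: mass_nonneg simp: flow_marg_nonneg[OF that(1)])
    also have "\<dots> = 1" using flow_mass[OF that(1)] that(2) by simp
    finally show "agg F m c k \<le> 1" .
  qed
  have "cls ` S \<subseteq> C \<times> PiE C (\<lambda>_. {f. \<forall>k. f k \<le> L})"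
  proof -
    have "nat \<lfloor>real L * agg F m c k\<rfloor> \<le> L" if "flow x F" "mass x = 1" for x F m c k
      using mult_left_le[of "agg F m c k" "real L"] agg(2)[OF that, of m c k]
      by (simp add: nat_le_iff floor_le_iff) 
    moreover have "cell N x \<in> C" if "\<forall>k. x k \<ge> 0" for x using cell_le[OF that] by (simp add: C_def)
    ultimately show ?thesis
      unfolding S_def cls_def by (intro image_subsetI) (fastforce simp del: One_nat_def)
  qed
  moreover have "finite (C \<times> PiE C (\<lambda>_. {f :: 'k \<Rightarrow> nat. \<forall>k. f k \<le> L}))"
    using finC finite_bounded_funs by (intro finite_cartesian_product finite_PiE)
  ultimately have "finite (cls ` S)" by (rule finite_subset)
  from finite_range_uniform_bound[OF this, of "\<lambda>(x, F, m) M. m \<le> M"]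
  obtain M where M: "\<And>p. p \<in> S \<Longrightarrow> \<exists>q\<in>S. cls q = cls p \<and> (case q of (x, F, m) \<Rightarrow> m \<le> M)"
    by fastforce
  show thesis
  proof (rule that[of M])
    fix x :: "'k \<Rightarrow> real" and n :: nat
    assume x: "\<forall>k. x k \<ge> 0" "mass x = 1"
    obtain F m where F: "flow x F" and Fm: "\<And>t. t \<le> n \<Longrightarrow> t * (val x - \<epsilon> / 2) \<le> window F m t"
      using good_start[OF x(1), of "\<epsilon> / 2" n] \<open>\<epsilon> > 0\<close> by (metis half_gt_zero)
    have "(x, F, m) \<in> S" using x F by (simp add: S_def)
    from M[OF this] obtain x0 F0 m0 where x0: "\<forall>k. x0 k \<ge> 0" "mass x0 = 1" and F0: "flow x0 F0"
      and m0: "m0 \<le> M" and cls: "cls (x0, F0, m0) = cls (x, F, m)"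
      by (auto simp: S_def)
    have cell: "cell N x0 = cell N x" using cls by (simp add: cls_def)
    have close: "gap (agg F m c) (agg F0 m0 c) \<le> CARD('k) / L" if "c \<in> C" for c
    proof -
      have "\<bar>agg F m c k - agg F0 m0 c k\<bar> \<le> 1 / L" for k
      proof -
        have "nat \<lfloor>real L * agg F m c k\<rfloor> = nat \<lfloor>real L * agg F0 m0 c k\<rfloor>"
          using cls that by (auto simp: cls_def restrict_def fun_eq_iff dest: spec[of _ c])
        then have "\<bar>real L * agg F m c k - real L * agg F0 m0 c k\<bar> \<le> 1"
          by (rule nat_floor_eq_dist) (auto intro!: mult_nonneg_nonneg agg(1)[OF F x(2)] agg(1)[OF F0 x0(2)])
        then have "real L * \<bar>agg F m c k - agg F0 m0 c k\<bar> \<le> 1"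
          using abs_mult[of "real L" "agg F m c k - agg F0 m0 c k"] by (simp add: right_diff_distrib)
        then show ?thesis using L(1) by (simp add: field_simps)
      qed
      then show ?thesis
        unfolding gap_def by (intro order.trans[OF sum_bounded_above[where K = "1 / L"]]) auto
    qed
    have "(\<Sum>c\<in>C. gap (agg F m c) (agg F0 m0 c)) \<le> card C * (CARD('k) / L)"
      by (rule sum_bounded_above[OF close])
    then have "(\<Sum>c\<in>C. gap (agg F m c) (agg F0 m0 c)) \<le> \<epsilon> / 6"
      using L(2) by linarith
    then have eta: "(\<Sum>c | \<forall>k. c k \<le> N. gap (\<lambda>k. \<Sum>a | a \<in> {h. length h = m} \<and> cell N (marg (F a)) = c. marg (F a) k)
       (\<lambda>k. \<Sum>b | b \<in> {h. length h = m0} \<and> cell N (marg (F0 b)) = c. marg (F0 b) k)) \<le> \<epsilon> / 6"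
      unfolding C_def agg_def .
    obtain H where H: "\<And>b. b \<in> {h. length h = m0} \<Longrightarrow> flow (marg (F0 b)) (H b)"
      "\<And>t. (\<Sum>a | length a = m. stage (\<lambda>h. F (a @ h)) t)
          \<le> (\<Sum>b | length b = m0. stage (H b) t) + \<epsilon> / 6 + CARD('k) / N * (\<Sum>b | length b = m0. mass (marg (F0 b)))"
    proof (rule flow_family_transfer[OF finite_length_eq[of m] finite_length_eq[of m0] N(1) flow_tail[OF F] flow_marg_nonneg[OF F0] eta])
      fix H
      assume "\<And>b. b \<in> {h. length h = m0} \<Longrightarrow> flow (marg (F0 b)) (H b)"
        "\<And>t. (\<Sum>a | length a = m. stage (\<lambda>h. F (a @ h)) t)
          \<le> (\<Sum>b | length b = m0. stage (H b) t) + \<epsilon> / 6 + CARD('k) / N * (\<Sum>b | length b = m0. mass (marg (F0 b)))"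
      then show thesis by (rule that)
    qed
    \<comment> \<open>\<open>F0\<close> serves only to reach the right distribution of beliefs
      within \<open>M\<close> stages; no payoff of its own is used. All payoffs counted come from
      \<open>H\<close>, that is, from the tails of \<open>F\<close>.\<close>
    have spl: "flow x0 (splice m0 F0 H)" by (rule flow_splice[OF F0 H(1)]) simp
    obtain K where K: "flow x K" "\<And>t. stage (splice m0 F0 H) t \<le> stage K t + gap x0 x"
      by (rule flow_transport[OF spl x(1)]) blast
    have "stage F (m + t) - \<epsilon> / 2 \<le> stage K (m0 + t)" for t
    proof -
      have "stage F (m + t) \<le> stage (splice m0 F0 H) (m0 + t) + \<epsilon> / 6 + CARD('k) / N"
        using H(2)[of t] by (simp add: stage_append[of F] stage_splice_add flow_mass[OF F0] x0(2))
      moreover have "gap x0 x \<le> CARD('k) / N"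
        by (rule gap_cell[OF x0(1) x(1) cell N(1) x0(2) x(2)])
      ultimately show ?thesis using K(2)[of "m0 + t"] N(2) by linarith
    qed
    then have "(\<Sum>s<t. stage F (m + s) - \<epsilon> / 2) \<le> window K m0 t" for t
      unfolding window_def by (intro sum_mono)
    then have "window F m t - t * (\<epsilon> / 2) \<le> window K m0 t" for t
      by (simp add: window_def sum_subtractf)
    then have "t * (val x - \<epsilon>) \<le> window K m0 t" if "t \<le> n" for t
      using Fm[OF that] by (smt (verit) field_sum_of_halves right_diff_distrib)
    with K(1) m0 show "\<exists>F m. flow x F \<and> m \<le> M \<and> (\<forall>t\<le>n. t * (val x - \<epsilon>) \<le> window F m t)"
      by blast
  qed
qed

text \<open>Both \<open>val\<close> and the average of \<open>best T\<close> are 1-Lipschitz in the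
  belief, so a threshold found at one point of a small cell serves the whole cell. The three thirds
  of \<open>\<epsilon>\<close> pay for that point and for the two Lipschitz estimates.\<close>

lemma uniform_best_unit:
  assumes "\<epsilon> > 0"
  obtains T0 where "\<And>T x. T \<ge> T0 \<Longrightarrow> \<forall>k. x k \<ge> 0 \<Longrightarrow> mass x = 1 \<Longrightarrow> best T x \<le> T * (val x + \<epsilon>)"
proof -
  obtain N0 :: nat where N0: "3 * CARD('k) / \<epsilon> \<le> real N0" using real_arch_simple by blast
  define N where "N = Suc N0"
  have N: "N > 0" "CARD('k) / N \<le> \<epsilon> / 3"
    using N0 \<open>\<epsilon> > 0\<close> by (auto simp: N_def field_simps)
  define S where "S = {x :: 'k \<Rightarrow> real. (\<forall>k. x k \<ge> 0) \<and> mass x = 1}"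
  have "cell N ` S \<subseteq> {c. \<forall>k. c k \<le> N}" using cell_le by (auto simp: S_def)
  then have "finite (cell N ` S)" using finite_bounded_funs by (rule finite_subset)
  then have "\<exists>M. \<forall>x\<in>S. \<exists>y\<in>S. cell N y = cell N x \<and> (\<forall>T\<ge>M. best T y \<le> T * (val y + \<epsilon> / 3))"
    by (rule finite_range_uniform_bound) (use \<open>\<epsilon> > 0\<close> in \<open>auto simp: S_def intro!: best_eventually_le\<close>)
  then obtain M where M: "\<And>x. x \<in> S \<Longrightarrow> \<exists>y\<in>S. cell N y = cell N x \<and> (\<forall>T\<ge>M. best T y \<le> T * (val y + \<epsilon> / 3))"
    by blast
  show thesis
  proof (rule that[of M])
    fix T and x :: "'k \<Rightarrow> real" assume T: "T \<ge> M" and x: "\<forall>k. x k \<ge> 0" "mass x = 1"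
    then obtain y where y: "\<forall>k. y k \<ge> 0" "mass y = 1" and cell: "cell N x = cell N y"
      and b: "best T y \<le> T * (val y + \<epsilon> / 3)"
      using M[of x] by (auto simp: S_def)
    have gap: "gap x y \<le> \<epsilon> / 3"
      using gap_cell[OF x(1) y(1) cell N(1) x(2) y(2)] N(2) by linarith
    have "best T x \<le> T * (val y + \<epsilon> / 3) + T * gap x y"
      using best_gap[OF x(1) y(1), of T] b by linarith
    also have "\<dots> = T * (val y + \<epsilon> / 3 + gap x y)" by (simp add: algebra_simps)
    also have "\<dots> \<le> T * (val x + \<epsilon>)"
      using val_gap[OF y(1) x(1)] gap by (intro mult_left_mono) (auto simp: gap_commute)
    finally show "best T x \<le> T * (val x + \<epsilon>)" .
  qed
qed

lemma best_mass_0: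
  assumes "\<forall>k. x k \<ge> 0" "mass x = 0"
  shows "best n x = 0"
  using best_nonneg[OF assms(1), of n] best_le[OF assms(1), of n] assms(2) by simp

text \<open>Homogeneity extends the bound to all masses. The error is proportional to mass, so over
  all histories of one stage it adds up to \<open>\<epsilon>\<close> times the initial mass.\<close>

lemma uniform_best:
  assumes "\<epsilon> > 0"
  obtains T0 where "\<And>T x. T \<ge> T0 \<Longrightarrow> \<forall>k. x k \<ge> 0 \<Longrightarrow> best T x \<le> T * (val x + \<epsilon> * mass x)"
proof -
  obtain T0 where T0: "\<And>T x. T \<ge> T0 \<Longrightarrow> \<forall>k. x k \<ge> 0 \<Longrightarrow> mass x = 1 \<Longrightarrow> best T x \<le> T * (val x + \<epsilon>)"
    using uniform_best_unit[OF assms] by metis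
  have "best T x \<le> T * (val x + \<epsilon> * mass x)" if T: "T \<ge> T0" and x: "\<forall>k. x k \<ge> 0" for T x
  proof (cases "mass x = 0")
    case True
    then show ?thesis using best_mass_0[OF x] val_nonneg[OF x] by simp
  next
    case False
    then have pos: "mass x > 0" using mass_nonneg[OF x] by simp
    let ?y = "\<lambda>k. (1 / mass x) * x k"
    have y: "\<forall>k. ?y k \<ge> 0" using x pos by simp
    have "mass ?y = 1" using pos by (subst mass_scale) simp
    from T0[OF T y this] pos show ?thesis
      by (simp only: best_scale[OF x] val_scale[OF x] divide_pos_pos zero_less_one) (simp add: field_simps)
  qed
  with that show thesis by blast
qed

text \<open>The flow is good over the horizon \<open>n + T\<close> with \<open>T\<close> much larger
  than \<open>n\<close>. Its last \<open>T\<close> stages earn about \<open>T * val x\<close>, and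
  by \<open>uniform_best\<close> hardly more than \<open>T\<close> times the expected value at stage
  \<open>n\<close>, so this value cannot have dropped much. The delay \<open>M\<close> depends on
  neither \<open>n\<close> nor \<open>x\<close>.\<close>

lemma block_unit:
  assumes "\<epsilon> > 0"
  obtains M :: real where "M \<ge> 0" "\<And>x n. \<forall>k. x k \<ge> 0 \<Longrightarrow> mass x = 1 \<Longrightarrow>
    \<exists>F. flow x F \<and> (\<forall>t\<le>n. t * (val x - \<epsilon>) - M \<le> window F 0 t) \<and>
      val x - \<epsilon> \<le> (\<Sum>h | length h = n. val (marg (F h)))"
proof -
  define \<delta> where "\<delta> = \<epsilon> / 4"
  have \<delta>: "\<delta> > 0" using assms by (simp add: \<delta>_def)
  obtain M :: nat where M: "\<And>x n. \<forall>k. x k \<ge> 0 \<Longrightarrow> mass x = 1 \<Longrightarrow>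
      \<exists>F m. flow x F \<and> m \<le> M \<and> (\<forall>t\<le>n. t * (val x - \<delta>) \<le> window F m t)"
    by (rule uniform_start[OF \<delta>]) blast
  obtain T0 where T0: "\<And>T x. T \<ge> T0 \<Longrightarrow> \<forall>k. x k \<ge> 0 \<Longrightarrow> best T x \<le> T * (val x + \<delta> * mass x)"
    by (rule uniform_best[OF \<delta>]) blast
  show thesis
  proof (rule that[of "real M"])
    fix x :: "'k \<Rightarrow> real" and n :: nat
    assume x: "\<forall>k. x k \<ge> 0" "mass x = 1"
    \<comment> \<open>\<open>T * \<delta>\<close> is to absorb the delay \<open>M\<close>, the at
      most \<open>n\<close> earned in the first \<open>n\<close> stages, and the possibly negative
      term \<open>n * (val x - \<delta>)\<close>, which is at least
      \<open>- (n * \<epsilon>)\<close>.\<close>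
    obtain T1 :: nat where T1: "(M + n * (1 + \<epsilon>)) / \<delta> \<le> real T1" using real_arch_simple by blast
    define T where "T = Suc (max T0 T1)"
    have T: "T \<ge> T0" "T > 0" "M + n * (1 + \<epsilon>) \<le> T * \<delta>"
    proof -
      have "real T1 \<le> T" by (simp add: T_def)
      with T1 have "(M + n * (1 + \<epsilon>)) / \<delta> \<le> T" by linarith
      then show "M + n * (1 + \<epsilon>) \<le> T * \<delta>" using \<delta> by (simp add: pos_divide_le_eq)
    qed (auto simp: T_def)
    from M[OF x, of "n + T"] obtain F m where F: "flow x F" and m: "m \<le> M"
      and Fm: "\<And>t. t \<le> n + T \<Longrightarrow> t * (val x - \<delta>) \<le> window F m t" by blast
    have val1: "val x \<le> 1" "val x \<ge> 0" using val_le_mass[OF x(1)] val_nonneg[OF x(1)] x(2) by auto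
    \<comment> \<open>The first \<open>m\<close> stages pay at least 0, while their target is at
      most 1 per stage; this is the loss \<open>M\<close>.\<close>
    have start: "t * (val x - \<delta>) - M \<le> window F 0 t" if t: "t \<le> n + T" for t
    proof (cases "t \<le> m")
      case True
      have "t * (val x - \<delta>) \<le> real t * 1" using val1 \<delta> by (intro mult_left_mono) auto
      then show ?thesis using True m window_nonneg[OF F, of 0 t] by simp
    next
      case False
      then obtain s where s: "t = m + s" using le_Suc_ex nat_le_linear by blast
      have "m * (val x - \<delta>) \<le> real m * 1" using val1 \<delta> by (intro mult_left_mono) auto
      moreover have "s * (val x - \<delta>) \<le> window F m s" using t s by (intro Fm) simp
      ultimately show ?thesis
        using m window_nonneg[OF F, of 0 m] by (simp add: s window_add algebra_simps)
    qed
    have "t * (val x - \<epsilon>) - M \<le> window F 0 t" if "t \<le> n" for t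
    proof -
      have "t * (val x - \<epsilon>) \<le> t * (val x - \<delta>)" using assms by (intro mult_left_mono) (auto simp: \<delta>_def)
      then show ?thesis using start[of t] that by simp
    qed
    moreover have "val x - \<epsilon> \<le> (\<Sum>h | length h = n. val (marg (F h)))" (is "_ \<le> ?V")
    proof -
      have "(n + T) * (val x - \<delta>) - M \<le> window F 0 n + window F n T"
        using start[of "n + T"] by (simp add: window_add)
      moreover have "window F 0 n \<le> n" using window_le[OF F, of 0 n] x(2) by simp
      moreover have "n * (val x - \<delta>) \<ge> - (n * \<epsilon>)"
        using mult_left_mono[of "- \<epsilon>" "val x - \<delta>" "real n"] val1 assms by (simp add: \<delta>_def)
      ultimately have "T * (val x - \<delta>) - T * \<delta> \<le> window F n T"
        using T(3) by (simp add: algebra_simps)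
      also have "window F n T = (\<Sum>h | length h = n. window (\<lambda>h'. F (h @ h')) 0 T)"
        by (simp add: window_tail)
      also have "\<dots> \<le> (\<Sum>h | length h = n. T * (val (marg (F h)) + \<delta> * mass (marg (F h))))"
        by (intro sum_mono order.trans[OF window_le_best[OF flow_tail[OF F]]] T0 T(1) flow_marg_nonneg[OF F])
      also have "\<dots> = T * (?V + \<delta>)"
        using flow_mass[OF F, of n] x(2)
        by (simp add: sum.distrib flip: sum_distrib_left)
      finally have "T * (val x - \<delta> - \<delta>) \<le> T * (?V + \<delta>)" by (simp add: algebra_simps)
      then have "val x - \<delta> - \<delta> \<le> ?V + \<delta>" using T(2) by simp
      then show ?thesis using \<delta> by (simp add: \<delta>_def)
    qed
    ultimately show "\<exists>F. flow x F \<and> (\<forall>t\<le>n. t * (val x - \<epsilon>) - M \<le> window F 0 t) \<and>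
      val x - \<epsilon> \<le> (\<Sum>h | length h = n. val (marg (F h)))" using F by blast
  qed simp
qed

lemma block:
  assumes "\<epsilon> > 0"
  obtains M :: real where "M \<ge> 0" "\<And>x n. \<forall>k. x k \<ge> 0 \<Longrightarrow>
    \<exists>F. flow x F \<and> (\<forall>t\<le>n. t * (val x - \<epsilon> * mass x) - M * mass x \<le> window F 0 t) \<and>
      val x - \<epsilon> * mass x \<le> (\<Sum>h | length h = n. val (marg (F h)))"
proof -
  obtain M :: real where M0: "M \<ge> 0" and M: "\<And>x n. \<forall>k. x k \<ge> 0 \<Longrightarrow> mass x = 1 \<Longrightarrow>
    \<exists>F. flow x F \<and> (\<forall>t\<le>n. t * (val x - \<epsilon>) - M \<le> window F 0 t) \<and>
      val x - \<epsilon> \<le> (\<Sum>h | length h = n. val (marg (F h)))"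
    by (rule block_unit[OF assms]) blast
  have "\<exists>F. flow x F \<and> (\<forall>t\<le>n. t * (val x - \<epsilon> * mass x) - M * mass x \<le> window F 0 t) \<and>
      val x - \<epsilon> * mass x \<le> (\<Sum>h | length h = n. val (marg (F h)))" if x: "\<forall>k. x k \<ge> 0" for x n
  proof (cases "mass x = 0")
    case True
    obtain F where F: "flow x F" by (rule flow_exists[OF x])
    have "val x = 0" using val_nonneg[OF x] val_le_mass[OF x] True by simp
    moreover have "(\<Sum>h | length h = n. val (marg (F h))) \<ge> 0"
      by (intro sum_nonneg val_nonneg flow_marg_nonneg[OF F])
    ultimately show ?thesis using F True window_nonneg[OF F] by (intro exI[of _ F]) auto
  next
    case False
    then have pos: "mass x > 0" using mass_nonneg[OF x] by simp
    let ?c = "mass x"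
    define y where "y = (\<lambda>k. (1 / ?c) * x k)"
    have y: "\<forall>k. y k \<ge> 0" using x pos by (simp add: y_def)
    have "mass y = 1" unfolding y_def using pos by (subst mass_scale) simp
    from M[OF y this, of n] obtain F where F: "flow y F"
      and Ft: "\<And>t. t \<le> n \<Longrightarrow> t * (val y - \<epsilon>) - M \<le> window F 0 t"
      and Fn: "val y - \<epsilon> \<le> (\<Sum>h | length h = n. val (marg (F h)))" by blast
    have xy: "x = (\<lambda>k. ?c * y k)" using pos by (simp add: y_def)
    have vx: "val x = ?c * val y" using val_scale[OF y pos] xy by simp
    let ?G = "\<lambda>h k i. ?c * F h k i"
    have "flow x ?G" by (subst (1) xy) (rule flow_scale[OF F mass_nonneg[OF x]])
    moreover have "t * (val x - \<epsilon> * ?c) - M * ?c \<le> window ?G 0 t" if "t \<le> n" for t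
      using mult_left_mono[OF Ft[OF that] mass_nonneg[OF x]]
      by (simp add: vx window_scale mass_nonneg[OF x] algebra_simps)
    moreover have "val x - \<epsilon> * ?c \<le> (\<Sum>h | length h = n. val (marg (?G h)))"
    proof -
      have "marg (?G h) = (\<lambda>k. ?c * marg (F h) k)" for h
        by (simp add: marg_def sum_distrib_left fun_eq_iff)
      then have "val (marg (?G h)) = ?c * val (marg (F h))" for h
        using val_scale[OF flow_marg_nonneg[OF F] pos] by simp
      then show ?thesis
        using mult_left_mono[OF Fn mass_nonneg[OF x]]
        by (simp add: vx sum_distrib_left algebra_simps)
    qed
    ultimately show ?thesis by blast
  qed
  with that M0 show thesis by blast
qed

section \<open>Gluing blocks into a single flow\<close>

lemma flow_glue:
  assumes B: "\<And>l y. \<forall>k. y k \<ge> 0 \<Longrightarrow> flow y (B l y)" and y: "\<forall>k. y k \<ge> 0"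
  shows "flow y (glue len B l y)"
proof -
  have nonneg: "glue len B l y h k i \<ge> 0" if "\<forall>k. y k \<ge> 0" for l y h k i
    using that
  proof (induction "length h" arbitrary: h l y rule: less_induct)
    case less
    show ?case
    proof (cases "length h < Suc (len l)")
      case True
      then show ?thesis using flow_nonneg[OF B[OF less.prems]] by (subst glue.simps) simp
    next
      case False
      then show ?thesis
        by (subst glue.simps) (simp add: less.hyps flow_marg_nonneg[OF B[OF less.prems]])
    qed
  qed
  have start: "marg (glue len B l y []) = y" if "\<forall>k. y k \<ge> 0" for l y
    using flow_start[OF B[OF that]] by (subst glue.simps) simp
  have step: "marg (glue len B l y (h @ [d])) = out (glue len B l y h) d" if "\<forall>k. y k \<ge> 0" for l y h d
    using that
  proof (induction "length h" arbitrary: h l y rule: less_induct)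
    case less
    note By = B[OF less.prems]
    consider "Suc (length h) < Suc (len l)" | "Suc (length h) = Suc (len l)" | "length h \<ge> Suc (len l)"
      by linarith
    then show ?case
    proof cases
      case 1
      then show ?thesis
        using flow_step[OF By] by (subst (1 2) glue.simps) simp
    next
      case 2
      \<comment> \<open>At the junction, \<open>h @ [d]\<close> is the empty history of the next
        block, whose starting measure is by construction the belief left by
        \<open>B l y\<close>.\<close>
      have "marg (glue len B l y (h @ [d])) = marg (B l y (h @ [d]))"
        using 2 by (subst glue.simps) (simp add: start flow_marg_nonneg[OF By])
      also have "\<dots> = out (glue len B l y h) d"
        using 2 flow_step[OF By] by (subst glue.simps) simp
      finally show ?thesis .
    next
      case 3
      then show ?thesis
        by (subst (1 2) glue.simps) (simp add: less.hyps flow_marg_nonneg[OF By])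
    qed
  qed
  show ?thesis
    unfolding flow_def using nonneg[OF y] start[OF y] step[OF y] by blast
qed

lemma window_glue_le:
  assumes "t \<le> Suc (len l)"
  shows "window (glue len B l y) 0 t = window (B l y) 0 t"
proof -
  have "stage (glue len B l y) s = stage (B l y) s" if "s < t" for s
    unfolding stage_def using that assms by (intro sum.cong refl) (auto simp: glue.simps)
  then show ?thesis by (simp add: window_def)
qed

lemma window_glue_add:
  "window (glue len B l y) 0 (Suc (len l) + t) = window (B l y) 0 (Suc (len l)) +
     (\<Sum>h | length h = Suc (len l). window (glue len B (Suc l) (marg (B l y h))) 0 t)"
proof -
  have "glue len B l y (h @ h') = glue len B (Suc l) (marg (B l y h)) h'"
    if "length h = Suc (len l)" for h h'
    using that by (subst glue.simps) simp
  then have "(\<Sum>h | length h = Suc (len l). window (\<lambda>h'. glue len B l y (h @ h')) 0 t) =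
      (\<Sum>h | length h = Suc (len l). window (glue len B (Suc l) (marg (B l y h))) 0 t)"
    by (intro sum.cong) auto
  then show ?thesis
    by (simp only: window_add window_tail window_glue_le[OF order_refl] add_0)
qed

text \<open>The delay \<open>M l\<close> may explode as the error \<open>\<epsilon> l\<close>
  shrinks. Since it does not depend on the length of the blocks, each block can be made long enough
  to pay for the delay of its successor.\<close>

lemma uniform_flow:
  assumes x: "\<forall>k. x k \<ge> 0" and "\<delta> > 0"
  obtains F M where "flow x F" "\<And>N. N * (val x - \<delta> * mass x) - M \<le> window F 0 N"
proof -
  define \<gamma> where "\<gamma> = \<delta> / 2"
  have \<gamma>: "\<gamma> > 0" using assms(2) by (simp add: \<gamma>_def)
  \<comment> \<open>\<open>e l\<close> is twice the sum of the errors from block \<open>l\<close>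
    on. The errors cost \<open>e 0 = \<gamma>\<close> in total and the delays another
    \<open>\<gamma>\<close> per stage, which together exhaust \<open>\<delta>\<close>.\<close>
  define \<epsilon> where "\<epsilon> l = \<gamma> * (1 / 2) ^ (l + 2)" for l :: nat
  define e where "e l = \<gamma> * (1 / 2) ^ l" for l :: nat
  have e: "e l = e (Suc l) + 2 * \<epsilon> l" "\<epsilon> l > 0" "\<epsilon> l \<le> e l" for l
    using \<gamma> by (auto simp: e_def \<epsilon>_def)
  define block_bound where "block_bound l M \<longleftrightarrow> M \<ge> 0 \<and> (\<forall>x n. (\<forall>k. x k \<ge> 0) \<longrightarrow>
    (\<exists>F. flow x F \<and> (\<forall>t\<le>n. t * (val x - \<epsilon> l * mass x) - M * mass x \<le> window F 0 t) \<and>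
      val x - \<epsilon> l * mass x \<le> (\<Sum>h | length h = n. val (marg (F h)))))" for l and M :: real
  have "\<forall>l. \<exists>M. block_bound l M"
  proof
    fix l
    show "\<exists>M. block_bound l M"
    proof (rule block[OF e(2)[of l]])
      fix M :: real
      assume M: "M \<ge> 0" "\<And>x n. \<forall>k. x k \<ge> 0 \<Longrightarrow>
        \<exists>F. flow x F \<and> (\<forall>t\<le>n. t * (val x - \<epsilon> l * mass x) - M * mass x \<le> window F 0 t) \<and>
          val x - \<epsilon> l * mass x \<le> (\<Sum>h | length h = n. val (marg (F h)))"
      show ?thesis
        unfolding block_bound_def by (rule exI[of _ M], rule conjI, rule M(1), rule allI, rule allI, rule impI, erule M(2))
    qed
  qed
  from choice[OF this] obtain M where M_bound: "\<forall>l. block_bound l (M l)" ..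
  have M: "\<exists>F. flow x F \<and> (\<forall>t\<le>n. t * (val x - \<epsilon> l * mass x) - M l * mass x \<le> window F 0 t) \<and>
      val x - \<epsilon> l * mass x \<le> (\<Sum>h | length h = n. val (marg (F h)))" if "\<forall>k. x k \<ge> 0" for l x n
    using M_bound that by (simp add: block_bound_def)
  \<comment> \<open>Block \<open>l\<close>, charged \<open>\<gamma>\<close> per stage, pays for the
    delay of block \<open>Suc l\<close>.\<close>
  have "\<forall>l. \<exists>n::nat. M (Suc l) / \<gamma> \<le> n" using real_arch_simple by blast
  from choice[OF this] obtain len :: "nat \<Rightarrow> nat" where len: "\<And>l. M (Suc l) / \<gamma> \<le> len l" by blast
  have len': "M (Suc l) \<le> \<gamma> * Suc (len l)" for l
    using len[of l] \<gamma> by (simp add: pos_divide_le_eq algebra_simps)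
  define B where "B l y = (SOME F. flow y F \<and>
      (\<forall>t\<le>Suc (len l). t * (val y - \<epsilon> l * mass y) - M l * mass y \<le> window F 0 t) \<and>
      val y - \<epsilon> l * mass y \<le> (\<Sum>h | length h = Suc (len l). val (marg (F h))))" for l y
  have B: "flow y (B l y)"
    "t \<le> Suc (len l) \<Longrightarrow> t * (val y - \<epsilon> l * mass y) - M l * mass y \<le> window (B l y) 0 t"
    "val y - \<epsilon> l * mass y \<le> (\<Sum>h | length h = Suc (len l). val (marg (B l y h)))"
    if "\<forall>k. y k \<ge> 0" for l y t
    using someI_ex[OF M[OF that, where l = l and n = "Suc (len l)"], folded B_def] by auto
  \<comment> \<open>Delays of later blocks are covered by the term \<open>\<gamma> * N\<close>; only
    the delay \<open>M l\<close> of the current block remains. This keeps the additive loss bounded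
    in the induction over \<open>N\<close>.\<close>
  have main: "N * (val y - e l * mass y) - (M l + \<gamma> * N) * mass y \<le> window (glue len B l y) 0 N"
    if "\<forall>k. y k \<ge> 0" for N l y
    using that
  proof (induction N arbitrary: l y rule: less_induct)
    case (less N)
    note y = less.prems
    have my: "mass y \<ge> 0" by (rule mass_nonneg[OF y])
    show ?case
    proof (cases "N \<le> Suc (len l)")
      case True
      have "N * (val y - e l * mass y) \<le> N * (val y - \<epsilon> l * mass y)"
        using e(3)[of l] my by (intro mult_left_mono) (auto intro: mult_right_mono)
      moreover have "(M l + \<gamma> * N) * mass y \<ge> M l * mass y"
        using my \<gamma> by (intro mult_right_mono) auto
      ultimately show ?thesis
        using B(2)[OF y True] window_glue_le[of N len l B y] True by linarith
    next
      case False
      then obtain s where s: "N = Suc (len l) + s" using le_Suc_ex nat_le_linear by blast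
      let ?n = "Suc (len l)"
      let ?z = "\<lambda>h. marg (B l y h)"
      have z: "\<forall>k. ?z h k \<ge> 0" for h by (rule flow_marg_nonneg[OF B(1)[OF y]])
      have mz: "(\<Sum>h | length h = ?n. mass (?z h)) = mass y" by (rule flow_mass[OF B(1)[OF y]])
      have "s * (val y - \<epsilon> l * mass y - e (Suc l) * mass y) - (M (Suc l) + \<gamma> * s) * mass y
          \<le> s * ((\<Sum>h | length h = ?n. val (?z h)) - e (Suc l) * mass y) - (M (Suc l) + \<gamma> * s) * mass y"
        using B(3)[OF y, of l] by (intro diff_right_mono mult_left_mono) simp_all
      also have "\<dots> = (\<Sum>h | length h = ?n. s * (val (?z h) - e (Suc l) * mass (?z h)) - (M (Suc l) + \<gamma> * s) * mass (?z h))"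
        by (simp only: sum_subtractf mz flip: sum_distrib_left)
      also have "\<dots> \<le> (\<Sum>h | length h = ?n. window (glue len B (Suc l) (?z h)) 0 s)"
        using s by (intro sum_mono less.IH z) auto
      also have "\<dots> = window (glue len B l y) 0 N - window (B l y) 0 ?n"
        unfolding s by (simp only: window_glue_add)
      finally have "s * (val y - \<epsilon> l * mass y - e (Suc l) * mass y) - (M (Suc l) + \<gamma> * s) * mass y
          + (?n * (val y - \<epsilon> l * mass y) - M l * mass y) \<le> window (glue len B l y) 0 N"
        using B(2)[OF y order_refl, of l] by linarith
      moreover have "s * (val y - e l * mass y) \<le> s * (val y - \<epsilon> l * mass y - e (Suc l) * mass y)"
      proof -
        have "e (Suc l) * mass y + \<epsilon> l * mass y \<le> e l * mass y"
          using e(1)[of l] e(2)[of l] my by (simp flip: distrib_right add: mult_right_mono)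
        then show ?thesis by (intro mult_left_mono) auto
      qed
      moreover have "?n * (val y - e l * mass y) \<le> ?n * (val y - \<epsilon> l * mass y)"
        using e(3)[of l] my by (intro mult_left_mono) (auto intro: mult_right_mono)
      moreover have "M (Suc l) * mass y \<le> \<gamma> * ?n * mass y"
        using len'[of l] my by (intro mult_right_mono) auto
      moreover have "N * (val y - e l * mass y) = ?n * (val y - e l * mass y) + s * (val y - e l * mass y)"
        unfolding s by (simp only: of_nat_add distrib_right)
      moreover have "(M l + \<gamma> * N) * mass y = M l * mass y + \<gamma> * ?n * mass y + \<gamma> * s * mass y"
        unfolding s by (simp only: of_nat_add) (simp only: distrib_left distrib_right)
      moreover have "(M (Suc l) + \<gamma> * s) * mass y = M (Suc l) * mass y + \<gamma> * s * mass y"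
        by (simp only: distrib_right)
      ultimately show ?thesis by linarith
    qed
  qed
  show thesis
  proof (rule that[of "glue len B 0 x" "M 0 * mass x"])
    show "flow x (glue len B 0 x)" by (rule flow_glue[OF B(1) x])
    show "N * (val x - \<delta> * mass x) - M 0 * mass x \<le> window (glue len B 0 x) 0 N" for N
      using main[OF x, of N 0] by (simp add: e_def \<gamma>_def algebra_simps)
  qed
qed

end

section \<open>A minimax theorem for flows\<close>

text \<open>Separate the payoff vectors, closed downwards, from the orthant above \<open>V\<close>.
  Downward closure forces a nonnegative normal vector, and normalising it gives the mixed action.
  \<open>\<Psi>\<close> carries the part of the payoff outside this minimum.\<close>

lemma separate_min:
  fixes \<Psi> :: "'f \<Rightarrow> real" and u :: "'f \<Rightarrow> 'j::finite \<Rightarrow> real"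
  assumes "X \<noteq> {}"
    and conv: "\<And>F G a b. F \<in> X \<Longrightarrow> G \<in> X \<Longrightarrow> a \<ge> 0 \<Longrightarrow> b \<ge> 0 \<Longrightarrow> a + b = 1 \<Longrightarrow>
      \<exists>H\<in>X. a * \<Psi> F + b * \<Psi> G \<le> \<Psi> H \<and> (\<forall>j. a * u F j + b * u G j \<le> u H j)"
    and le: "\<And>F. F \<in> X \<Longrightarrow> \<Psi> F + Min (range (u F)) \<le> V"
  shows "\<exists>p. (\<forall>j. p j \<ge> 0) \<and> (\<Sum>j\<in>UNIV. p j) = 1 \<and> (\<forall>F\<in>X. \<Psi> F + (\<Sum>j\<in>UNIV. p j * u F j) \<le> V)"
proof -
  define S where "S = {w :: real^'j. \<exists>F\<in>X. \<forall>j. w $ j \<le> \<Psi> F + u F j}"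
  define T where "T = {w :: real^'j. \<forall>j. V < w $ j}"
  have "convex S"
  proof (rule convexI)
    fix x y :: "real^'j" and a b :: real
    assume x: "x \<in> S" and y: "y \<in> S" and ab: "a \<ge> 0" "b \<ge> 0" "a + b = 1"
    from x obtain F where F: "F \<in> X" "\<And>j. x $ j \<le> \<Psi> F + u F j" by (auto simp: S_def)
    from y obtain G where G: "G \<in> X" "\<And>j. y $ j \<le> \<Psi> G + u G j" by (auto simp: S_def)
    from conv[OF F(1) G(1) ab] obtain H where H: "H \<in> X" "a * \<Psi> F + b * \<Psi> G \<le> \<Psi> H"
      "\<And>j. a * u F j + b * u G j \<le> u H j" by blast
    have "(a *\<^sub>R x + b *\<^sub>R y) $ j \<le> \<Psi> H + u H j" for j
      using mult_left_mono[OF F(2)[of j] ab(1)] mult_left_mono[OF G(2)[of j] ab(2)] H(2) H(3)[of j]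
      by (simp add: distrib_left)
    then show "a *\<^sub>R x + b *\<^sub>R y \<in> S" using H(1) by (auto simp: S_def)
  qed
  moreover have "convex T"
  proof (rule convexI)
    fix x y :: "real^'j" and a b :: real
    assume x: "x \<in> T" and y: "y \<in> T" and ab: "a \<ge> 0" "b \<ge> 0" "a + b = 1"
    have "V < a * x $ j + b * y $ j" for j
    proof -
      have "- V > a * (- x $ j) + b * (- y $ j)"
        using x y ab by (intro convex_bound_lt) (auto simp: T_def)
      then show ?thesis by simp
    qed
    then show "a *\<^sub>R x + b *\<^sub>R y \<in> T" by (simp add: T_def)
  qed
  moreover obtain F0 where F0: "F0 \<in> X" using assms(1) by blast
  then have S0: "(\<chi> j. \<Psi> F0 + u F0 j) \<in> S" by (auto simp: S_def)
  then have "S \<noteq> {}" by blast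
  moreover have T0: "(\<chi> j. V + \<eta>) \<in> T" if "\<eta> > 0" for \<eta> using that by (simp add: T_def)
  then have "T \<noteq> {}" using zero_less_one by blast
  moreover have "S \<inter> T = {}"
  proof (rule equals0I)
    fix w assume "w \<in> S \<inter> T"
    then obtain F where F: "F \<in> X" "\<And>j. V < \<Psi> F + u F j"
      by (auto simp: S_def T_def) (meson less_le_trans)
    have "Min (range (u F)) \<in> range (u F)" by (rule Min_in) auto
    then obtain j where "Min (range (u F)) = u F j" by (rule rangeE)
    then show False using F(2)[of j] le[OF F(1)] by simp
  qed
  ultimately obtain a b where a: "a \<noteq> 0" and aS: "\<And>x. x \<in> S \<Longrightarrow> a \<bullet> x \<le> b" and aT: "\<And>x. x \<in> T \<Longrightarrow> a \<bullet> x \<ge> b"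
    using separating_hyperplane_sets[of S T] by blast
  have a0: "a $ j \<ge> 0" for j
  proof (rule ccontr)
    assume neg: "\<not> a $ j \<ge> 0"
    let ?x = "\<chi> j. \<Psi> F0 + u F0 j"
    \<comment> \<open>Lowering coordinate \<open>j\<close> by \<open>t\<close> stays in
      \<open>S\<close> but, if \<open>a $ j < 0\<close>, raises the inner product above
      \<open>b\<close>.\<close>
    define t where "t = (\<bar>b - a \<bullet> ?x\<bar> + 1) / - (a $ j)"
    have t: "t \<ge> 0" unfolding t_def using neg by (intro divide_nonneg_nonneg) auto
    have "?x - t *\<^sub>R axis j 1 \<in> S"
      unfolding S_def mem_Collect_eq
      by (rule bexI[OF _ F0]) (use t in \<open>auto simp: axis_def\<close>)
    from aS[OF this] have "a \<bullet> ?x - t * a $ j \<le> b"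
      by (simp add: inner_diff_right inner_axis)
    moreover have "- (t * a $ j) = \<bar>b - a \<bullet> ?x\<bar> + 1" using neg by (simp add: t_def)
    ultimately show False by linarith
  qed
  define A where "A = (\<Sum>j\<in>UNIV. a $ j)"
  have "A \<noteq> 0"
  proof
    assume "A = 0"
    then have "a = 0" using a0 by (simp add: A_def sum_nonneg_eq_0_iff vec_eq_iff)
    with a show False by simp
  qed
  then have A: "A > 0" using a0 by (simp add: A_def sum_nonneg less_le)
  have "b \<le> A * V"
  proof (rule field_le_epsilon)
    fix e :: real assume "e > 0"
    then have "b \<le> a \<bullet> (\<chi> j. V + e / A)" using A by (intro aT T0) simp
    also have "\<dots> = A * (V + e / A)" by (simp add: inner_vec_def A_def sum_distrib_right)
    finally show "b \<le> A * V + e" using A by (simp add: distrib_left)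
  qed
  moreover have "A * \<Psi> F + (\<Sum>j\<in>UNIV. a $ j * u F j) \<le> b" if "F \<in> X" for F
  proof -
    have "(\<chi> j. \<Psi> F + u F j) \<in> S" using that by (auto simp: S_def)
    from aS[OF this] show ?thesis
      by (simp add: inner_vec_def distrib_left sum.distrib A_def sum_distrib_right)
  qed
  ultimately have "\<Psi> F + (\<Sum>j\<in>UNIV. a $ j / A * u F j) \<le> V" if "F \<in> X" for F
  proof -
    have "A * (\<Psi> F + (\<Sum>j\<in>UNIV. a $ j / A * u F j)) = A * \<Psi> F + (\<Sum>j\<in>UNIV. a $ j * u F j)"
      using A by (simp add: distrib_left sum_distrib_left)
    also have "\<dots> \<le> A * V" using \<open>b \<le> A * V\<close> \<open>\<And>F. F \<in> X \<Longrightarrow> A * \<Psi> F + (\<Sum>j\<in>UNIV. a $ j * u F j) \<le> b\<close>[OF that] by simp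
    finally show ?thesis using A by simp
  qed
  then show ?thesis
    using A a0 by (intro exI[of _ "\<lambda>j. a $ j / A"]) (auto simp: A_def simp flip: sum_divide_distrib)
qed

lemma Min_range_concave:
  fixes u v w :: "'j::finite \<Rightarrow> real"
  assumes "\<And>j. a * u j + b * v j \<le> w j" "a \<ge> 0" "b \<ge> 0"
  shows "a * Min (range u) + b * Min (range v) \<le> Min (range w)"
proof -
  have "a * Min (range u) + b * Min (range v) \<le> w j" for j
  proof -
    have "a * Min (range u) \<le> a * u j" "b * Min (range v) \<le> b * v j"
      using assms(2,3) by (auto intro!: mult_left_mono)
    then show ?thesis using assms(1)[of j] by linarith
  qed
  then show ?thesis by (intro Min.boundedI) auto
qed

text \<open>The minima are replaced by mixed actions one index at a time, so that the separation
  takes place in \<open>real^'j\<close> although \<open>S\<close> is not a type.\<close>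

lemma separate_sum_min:
  fixes \<Psi> :: "'f \<Rightarrow> real" and u :: "'s \<Rightarrow> 'f \<Rightarrow> 'j::finite \<Rightarrow> real"
  assumes "finite S" "X \<noteq> {}"
    and "\<And>F G a b. F \<in> X \<Longrightarrow> G \<in> X \<Longrightarrow> a \<ge> 0 \<Longrightarrow> b \<ge> 0 \<Longrightarrow> a + b = 1 \<Longrightarrow>
      \<exists>H\<in>X. a * \<Psi> F + b * \<Psi> G \<le> \<Psi> H \<and> (\<forall>s j. a * u s F j + b * u s G j = u s H j)"
    and "\<And>F. F \<in> X \<Longrightarrow> \<Psi> F + (\<Sum>s\<in>S. Min (range (u s F))) \<le> V"
  shows "\<exists>p. (\<forall>s j. p s j \<ge> 0) \<and> (\<forall>s. (\<Sum>j\<in>UNIV. p s j) = 1) \<and>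
    (\<forall>F\<in>X. \<Psi> F + (\<Sum>s\<in>S. \<Sum>j\<in>UNIV. p s j * u s F j) \<le> V)"
  using assms(1,3,4)
proof (induction S arbitrary: \<Psi> rule: finite_induct)
  case empty
  then show ?case
    by (intro exI[of _ "\<lambda>_ _. 1 / of_nat CARD('j)"]) auto
next
  case (insert s S)
  \<comment> \<open>The minima over the remaining indices are concave, so they can sit in the
    concave part while the one at \<open>s\<close> is resolved. Afterwards the mixed term at
    \<open>s\<close> joins \<open>\<Psi>\<close> for the induction.\<close>
  define \<Phi> where "\<Phi> F = \<Psi> F + (\<Sum>s\<in>S. Min (range (u s F)))" for F
  have "\<exists>H\<in>X. a * \<Phi> F + b * \<Phi> G \<le> \<Phi> H \<and> (\<forall>j. a * u s F j + b * u s G j \<le> u s H j)"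
    if "F \<in> X" "G \<in> X" and ab: "a \<ge> 0" "b \<ge> 0" "a + b = 1" for F G a b
  proof -
    from insert.prems(1)[OF that] obtain H where H: "H \<in> X" "a * \<Psi> F + b * \<Psi> G \<le> \<Psi> H"
      "\<And>s j. a * u s F j + b * u s G j = u s H j" by blast
    have "(\<Sum>s\<in>S. a * Min (range (u s F)) + b * Min (range (u s G))) \<le> (\<Sum>s\<in>S. Min (range (u s H)))"
      using H(3) ab by (intro sum_mono Min_range_concave) auto
    then have "a * \<Phi> F + b * \<Phi> G \<le> \<Phi> H"
      using H(2) by (simp add: \<Phi>_def distrib_left sum.distrib sum_distrib_left)
    with H show ?thesis by (metis order_refl)
  qed
  moreover have "\<Phi> F + Min (range (u s F)) \<le> V" if "F \<in> X" for F
    using insert.prems(2)[OF that] insert.hyps by (simp add: \<Phi>_def)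
  ultimately obtain r where r: "\<And>j. r j \<ge> 0" "(\<Sum>j\<in>UNIV. r j) = 1"
    and rV: "\<And>F. F \<in> X \<Longrightarrow> \<Phi> F + (\<Sum>j\<in>UNIV. r j * u s F j) \<le> V"
    using separate_min[OF assms(2), of \<Phi> "u s" V] by blast
  define \<Psi>' where "\<Psi>' F = \<Psi> F + (\<Sum>j\<in>UNIV. r j * u s F j)" for F
  have "\<exists>H\<in>X. a * \<Psi>' F + b * \<Psi>' G \<le> \<Psi>' H \<and> (\<forall>s j. a * u s F j + b * u s G j = u s H j)"
    if FG: "F \<in> X" "G \<in> X" and ab: "a \<ge> 0" "b \<ge> 0" "a + b = 1" for F G a b
  proof -
    from insert.prems(1)[OF that] obtain H where H: "H \<in> X" "a * \<Psi> F + b * \<Psi> G \<le> \<Psi> H"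
      "\<And>s j. a * u s F j + b * u s G j = u s H j" by blast
    have "a * (\<Sum>j\<in>UNIV. r j * u s F j) + b * (\<Sum>j\<in>UNIV. r j * u s G j) = (\<Sum>j\<in>UNIV. r j * u s H j)"
      by (simp add: sum_distrib_left distrib_left mult.left_commute flip: sum.distrib H(3))
    then have "a * \<Psi>' F + b * \<Psi>' G \<le> \<Psi>' H"
      using H(2) by (simp add: \<Psi>'_def distrib_left)
    with H show ?thesis by blast
  qed
  moreover have "\<Psi>' F + (\<Sum>s\<in>S. Min (range (u s F))) \<le> V" if "F \<in> X" for F
    using rV[OF that] by (simp add: \<Psi>'_def \<Phi>_def)
  ultimately obtain p where p: "\<And>s j. p s j \<ge> 0" "\<And>s. (\<Sum>j\<in>UNIV. p s j) = 1"
    and pV: "\<And>F. F \<in> X \<Longrightarrow> \<Psi>' F + (\<Sum>s\<in>S. \<Sum>j\<in>UNIV. p s j * u s F j) \<le> V"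
    using insert.IH[of \<Psi>'] by blast
  have "\<Psi> F + (\<Sum>s'\<in>insert s S. \<Sum>j\<in>UNIV. (p(s := r)) s' j * u s' F j) \<le> V" if "F \<in> X" for F
  proof -
    have "(\<Sum>s'\<in>S. \<Sum>j\<in>UNIV. (p(s := r)) s' j * u s' F j) = (\<Sum>s'\<in>S. \<Sum>j\<in>UNIV. p s' j * u s' F j)"
      using insert.hyps by (intro sum.cong) auto
    then show ?thesis using pV[OF that] insert.hyps by (simp add: \<Psi>'_def)
  qed
  then show ?case using p r by (intro exI[of _ "p(s := r)"]) auto
qed

context controlled_chain
begin

text \<open>The flows from \<open>x\<close> form a convex set on which each
  \<open>lin (F h) j\<close> is affine. One family of mixed actions, indexed by signals alone,
  therefore works against all flows at once.\<close>

lemma window_minimax: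
  assumes x: "\<forall>k. x k \<ge> 0"
  obtains p :: "'d list \<Rightarrow> 'j \<Rightarrow> real" where "\<And>h j. p h j \<ge> 0" "\<And>h. (\<Sum>j\<in>UNIV. p h j) = 1"
    "\<And>F. flow x F \<Longrightarrow> (\<Sum>t<n. \<Sum>h | length h = m + t. \<Sum>j\<in>UNIV. p h j * lin (F h) j) \<le> best n x"
proof -
  define S where "S = (\<Union>t<n. {h :: 'd list. length h = m + t})"
  have sumS: "(\<Sum>h\<in>S. f h) = (\<Sum>t<n. \<Sum>h | length h = m + t. f h)" for f :: "'d list \<Rightarrow> real"
    unfolding S_def by (rule sum.UNION_disjoint) (auto simp: finite_length_eq)
  have "\<exists>p. (\<forall>h j. p h j \<ge> 0) \<and> (\<forall>h. (\<Sum>j\<in>UNIV. p h j) = 1) \<and>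
    (\<forall>F\<in>{F. flow x F}. 0 + (\<Sum>h\<in>S. \<Sum>j\<in>UNIV. p h j * lin (F h) j) \<le> best n x)"
  proof (rule separate_sum_min)
    show "finite S" by (simp add: S_def finite_length_eq)
    show "{F. flow x F} \<noteq> {}" by (rule flow_exists[OF x]) auto
    show "0 + (\<Sum>h\<in>S. Min (range (lin (F h)))) \<le> best n x" if "F \<in> {F. flow x F}" for F
      using window_le_best[of x F m n] that
      by (simp add: sumS window_def stage_def rew_def)
    show "\<exists>H\<in>{F. flow x F}. a * 0 + b * 0 \<le> (0::real) \<and> (\<forall>h j. a * lin (F h) j + b * lin (G h) j = lin (H h) j)"
      if FG: "F \<in> {F. flow x F}" "G \<in> {F. flow x F}" and ab: "a \<ge> 0" "b \<ge> 0" "a + b = 1" for F G a b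
    proof (intro bexI conjI allI)
      \<comment> \<open>Booleans index the two summands, so that closure of flows under finite sums
        yields convex combinations.\<close>
      let ?A = "\<lambda>c. if c then \<lambda>h k i. a * F h k i else (\<lambda>h k i. b * G h k i)"
      let ?H = "\<lambda>h k i. \<Sum>c\<in>UNIV. ?A c h k i"
      have "flow (\<lambda>k. \<Sum>c\<in>UNIV. (if c then \<lambda>k. a * x k else (\<lambda>k. b * x k)) k) ?H"
        using FG ab by (intro flow_sum) (auto intro: flow_scale)
      also have "(\<lambda>k. \<Sum>c\<in>UNIV. (if c then \<lambda>k. a * x k else (\<lambda>k. b * x k)) k) = x"
        using ab by (auto simp: UNIV_bool fun_eq_iff add.commute simp flip: distrib_right)
      finally show "?H \<in> {F. flow x F}" by simp
      show "a * lin (F h) j + b * lin (G h) j = lin (?H h) j" for h j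
        by (subst lin_sum) (simp add: UNIV_bool lin_scale)
    qed simp
  qed
  with that show thesis by (auto simp: sumS)
qed

end

section \<open>Laws of plays\<close>

lemma pmf_bind_single:
  assumes "\<And>x. x \<noteq> a \<Longrightarrow> pmf (f x) y = 0"
  shows "pmf (bind_pmf p f) y = pmf p a * pmf (f a) y"
proof -
  have eq: "pmf (f x) y = indicator {a} x * pmf (f a) y" for x
    by (cases "x = a") (simp_all add: assms)
  have "pmf (bind_pmf p f) y = (\<integral>x. indicator {a} x * pmf (f a) y \<partial>measure_pmf p)"
    unfolding pmf_bind by (rule Bochner_Integration.integral_cong[OF refl eq])
  then show ?thesis by (simp add: measure_pmf_single)
qed

lemma pmf_stage_law:
  "pmf (stage_law \<pi> q \<sigma> \<tau> n \<omega>) (k, c, d, i, j) =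
     pmf (draw_law \<pi> q n \<omega>) (k, c, d) * pmf (\<sigma> (history1 \<omega> n) c) i * pmf (\<tau> (history2 \<omega> n) d) j"
proof -
  have "pmf (stage_law \<pi> q \<sigma> \<tau> n \<omega>) (k, c, d, i, j) =
     pmf (draw_law \<pi> q n \<omega>) (k, c, d) * pmf (bind_pmf (\<sigma> (history1 \<omega> n) c)
       (\<lambda>i'. bind_pmf (\<tau> (history2 \<omega> n) d) (\<lambda>j'. return_pmf (k, c, d, i', j')))) (k, c, d, i, j)"
    unfolding stage_law_def
    by (subst pmf_bind_single[where a = "(k, c, d)"]) (auto simp: pmf_eq_0_set_pmf split: prod.splits)
  also have "pmf (bind_pmf (\<sigma> (history1 \<omega> n) c)
       (\<lambda>i'. bind_pmf (\<tau> (history2 \<omega> n) d) (\<lambda>j'. return_pmf (k, c, d, i', j')))) (k, c, d, i, j)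
     = pmf (\<sigma> (history1 \<omega> n) c) i * pmf (bind_pmf (\<tau> (history2 \<omega> n) d) (\<lambda>j'. return_pmf (k, c, d, i, j'))) (k, c, d, i, j)"
    by (subst pmf_bind_single[where a = i]) (auto simp: pmf_eq_0_set_pmf)
  also have "pmf (bind_pmf (\<tau> (history2 \<omega> n) d) (\<lambda>j'. return_pmf (k, c, d, i, j'))) (k, c, d, i, j)
     = pmf (\<tau> (history2 \<omega> n) d) j"
    by (subst pmf_bind_single[where a = j]) auto
  finally show ?thesis by simp
qed

lemma sum_prod5:
  fixes f :: "'k::finite \<times> 'c::finite \<times> 'd::finite \<times> 'i::finite \<times> 'j::finite \<Rightarrow> real"
  shows "(\<Sum>a\<in>UNIV. f a) =
    (\<Sum>k\<in>UNIV. \<Sum>c\<in>UNIV. \<Sum>d\<in>UNIV. \<Sum>i\<in>UNIV. \<Sum>j\<in>UNIV. f (k, c, d, i, j))"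
  by (simp add: sum.cartesian_product case_prod_unfold flip: UNIV_Times_UNIV)

lemma sum_swap6:
  fixes f :: "'a \<Rightarrow> 'b \<Rightarrow> 'c \<Rightarrow> 'd \<Rightarrow> 'e \<Rightarrow> 'f \<Rightarrow> real"
  shows "(\<Sum>x\<in>X. \<Sum>k\<in>K. \<Sum>c\<in>C. \<Sum>d\<in>D. \<Sum>i\<in>I. \<Sum>j\<in>J. f x k c d i j) =
    (\<Sum>d\<in>D. \<Sum>j\<in>J. \<Sum>k\<in>K. \<Sum>i\<in>I. \<Sum>x\<in>X. \<Sum>c\<in>C. f x k c d i j)"
  unfolding sum.cartesian_product
  by (rule sum.reindex_bij_witness[where i = "\<lambda>(d, j, k, i, x, c). (x, k, c, d, i, j)"
        and j = "\<lambda>(x, k, c, d, i, j). (d, j, k, i, x, c)"]) auto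

definition hist1 :: "('k \<times> 'c \<times> 'd \<times> 'i \<times> 'j) list \<Rightarrow> ('c \<times> 'i) list" where
  "hist1 xs = map (\<lambda>(k, c, d, i, j). (c, i)) xs"

definition hist2 :: "('k \<times> 'c \<times> 'd \<times> 'i \<times> 'j) list \<Rightarrow> ('d \<times> 'j) list" where
  "hist2 xs = map (\<lambda>(k, c, d, i, j). (d, j)) xs"

lemma history1_nth: "history1 (\<lambda>m. xs ! m) (length xs) = hist1 xs"
  by (intro nth_equalityI) (auto simp: history1_def hist1_def)

lemma history2_nth: "history2 (\<lambda>m. xs ! m) (length xs) = hist2 xs"
  by (intro nth_equalityI) (auto simp: history2_def hist2_def)

locale repeated_game = controlled_chain Q g
  for Q :: "'k::finite \<Rightarrow> 'i::finite \<Rightarrow> 'k \<Rightarrow> 'd::finite \<Rightarrow> real"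
    and g :: "'k \<Rightarrow> 'i \<Rightarrow> 'j::finite \<Rightarrow> real" +
  fixes \<pi> :: "('k \<times> 'c::finite \<times> 'd) pmf"
    and q :: "'k \<Rightarrow> 'i \<Rightarrow> 'j \<Rightarrow> ('k \<times> 'c \<times> 'd) pmf"
  assumes marginal: "(\<Sum>c\<in>UNIV. pmf (q k i j) (k', c, d)) = Q k i k' d"
begin

definition weight :: "('c, 'i) strategy \<Rightarrow> ('d, 'j) strategy \<Rightarrow> ('k \<times> 'c \<times> 'd \<times> 'i \<times> 'j) list \<Rightarrow> real" where
  "weight \<sigma> \<tau> xs = (\<Prod>m<length xs. pmf (stage_law \<pi> q \<sigma> \<tau> m (\<lambda>m. xs ! m)) (xs ! m))"

definition draw :: "('k \<times> 'c \<times> 'd \<times> 'i \<times> 'j) list \<Rightarrow> ('k \<times> 'c \<times> 'd) pmf" where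
  "draw xs = draw_law \<pi> q (length xs) (\<lambda>m. xs ! m)"

definition expected :: "('c, 'i) strategy \<Rightarrow> ('d, 'j) strategy \<Rightarrow> nat \<Rightarrow> real" where
  "expected \<sigma> \<tau> n = (\<integral>\<omega>. (case \<omega> n of (k, c, d, i, j) \<Rightarrow> g k i j) \<partial>play_measure \<pi> q \<sigma> \<tau>)"

text \<open>The unnormalised belief after the first signal of player 2; its mass is the probability
  of that signal. Each first signal thus starts a flow of its own.\<close>

definition start :: "'d \<Rightarrow> 'k \<Rightarrow> real" where
  "start d k = (\<Sum>c\<in>UNIV. pmf \<pi> (k, c, d))"

text \<open>\<open>occ \<sigma> \<tau> hs d k i\<close> is the probability that player 2 has the past history \<open>hs\<close>, then
  receives the signal \<open>d\<close>, while the state is \<open>k\<close> and player 1 chooses \<open>i\<close>.\<close>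

definition occ :: "('c, 'i) strategy \<Rightarrow> ('d, 'j) strategy \<Rightarrow> ('d \<times> 'j) list \<Rightarrow> 'd \<Rightarrow> 'k \<Rightarrow> 'i \<Rightarrow> real" where
  "occ \<sigma> \<tau> hs d k i = (\<Sum>xs | hist2 xs = hs.
     weight \<sigma> \<tau> xs * (\<Sum>c\<in>UNIV. pmf (draw xs) (k, c, d) * pmf (\<sigma> (hist1 xs) c) i))"

lemma draw_Nil: "draw [] = \<pi>"
  by (simp add: draw_def draw_law_def)

lemma draw_snoc: "draw (xs @ [(k, c, d, i, j)]) = q k i j"
  by (simp add: draw_def draw_law_def)

lemma weight_nonneg: "weight \<sigma> \<tau> xs \<ge> 0"
  by (simp add: weight_def prod_nonneg)

lemma weight_Nil: "weight \<sigma> \<tau> [] = 1"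
  by (simp add: weight_def)

lemma weight_snoc:
  "weight \<sigma> \<tau> (xs @ [(k, c, d, i, j)]) = weight \<sigma> \<tau> xs *
    (pmf (draw xs) (k, c, d) * pmf (\<sigma> (hist1 xs) c) i * pmf (\<tau> (hist2 xs) d) j)"
proof -
  let ?ys = "xs @ [(k, c, d, i, j)]"
  have eq: "stage_law \<pi> q \<sigma> \<tau> m (\<lambda>m. ?ys ! m) = stage_law \<pi> q \<sigma> \<tau> m (\<lambda>m. xs ! m)" if "m \<le> length xs" for m
    using that by (intro stage_law_cong) (simp add: nth_append)
  have "weight \<sigma> \<tau> ?ys = (\<Prod>m<length xs. pmf (stage_law \<pi> q \<sigma> \<tau> m (\<lambda>m. xs ! m)) (xs ! m)) *
      pmf (stage_law \<pi> q \<sigma> \<tau> (length xs) (\<lambda>m. xs ! m)) (k, c, d, i, j)"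
  proof -
    have "weight \<sigma> \<tau> ?ys = (\<Prod>m<length xs. pmf (stage_law \<pi> q \<sigma> \<tau> m (\<lambda>m. ?ys ! m)) (?ys ! m)) *
      pmf (stage_law \<pi> q \<sigma> \<tau> (length xs) (\<lambda>m. ?ys ! m)) (k, c, d, i, j)"
      by (simp add: weight_def)
    also have "(\<Prod>m<length xs. pmf (stage_law \<pi> q \<sigma> \<tau> m (\<lambda>m. ?ys ! m)) (?ys ! m)) =
        (\<Prod>m<length xs. pmf (stage_law \<pi> q \<sigma> \<tau> m (\<lambda>m. xs ! m)) (xs ! m))"
    proof (rule prod.cong[OF refl])
      fix m assume "m \<in> {..<length xs}"
      then show "pmf (stage_law \<pi> q \<sigma> \<tau> m (\<lambda>m. ?ys ! m)) (?ys ! m) =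
          pmf (stage_law \<pi> q \<sigma> \<tau> m (\<lambda>m. xs ! m)) (xs ! m)"
        using eq[of m] by (simp only: lessThan_iff nth_append_left less_imp_le)
    qed
    finally show ?thesis using eq[OF order_refl] by simp
  qed
  then show ?thesis
    by (simp add: weight_def pmf_stage_law history1_nth history2_nth draw_def)
qed

section \<open>From infinite plays to finite histories\<close>

lemma sets_play_measure:
  "sets (play_measure \<pi> q \<sigma> \<tau>) = sets (PiM UNIV (\<lambda>_. count_space UNIV))"
proof -
  interpret Ionescu_Tulcea
    "\<lambda>n \<omega>. measure_pmf (stage_law \<pi> q \<sigma> \<tau> n \<omega>)" "\<lambda>_. count_space UNIV"
    by (rule Ionescu_Tulcea_stage_law)
  show ?thesis unfolding play_measure_def by simp
qed

lemma measure_cylinder: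
  "measure (play_measure \<pi> q \<sigma> \<tau>) {\<omega>. \<forall>m<length xs. \<omega> m = xs ! m} = weight \<sigma> \<tau> xs"
  unfolding measure_def emeasure_play_measure_cylinder weight_def
  by (simp add: prod_ennreal prod_nonneg)

text \<open>The payoff of stage \<open>n\<close> depends on finitely many finite-valued coordinates,
  hence is a finite combination of indicators of cylinders.\<close>

lemma expected_eq_sum_weight:
  "expected \<sigma> \<tau> n = (\<Sum>xs | length xs = Suc n. weight \<sigma> \<tau> xs * (case xs ! n of (k, c, d, i, j) \<Rightarrow> g k i j))"
proof -
  let ?M = "play_measure \<pi> q \<sigma> \<tau>"
  let ?cyl = "\<lambda>xs. {\<omega>. \<forall>m<length xs. \<omega> m = xs ! m}"
  let ?S = "{xs :: ('k \<times> 'c \<times> 'd \<times> 'i \<times> 'j) list. length xs = Suc n}"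
  let ?g = "\<lambda>a. case a of (k, c, d, i, j) \<Rightarrow> g k i j"
  interpret prob_space ?M by (rule prob_space_play_measure)
  have cyl: "?cyl xs \<in> sets ?M" for xs
  proof -
    have "?cyl xs = PiE UNIV (\<lambda>m. if m < length xs then {xs ! m} else UNIV)"
      by (auto simp: PiE_UNIV_domain split: if_splits)
    then show ?thesis
      unfolding sets_play_measure by (simp only:) (rule sets_PiM_I_countable, simp_all)
  qed
  have eq: "?g (\<omega> n) = (\<Sum>xs\<in>?S. ?g (xs ! n) * indicator (?cyl xs) \<omega>)" for \<omega>
  proof -
    let ?xs = "map \<omega> [0..<Suc n]"
    have "(\<Sum>xs\<in>?S. ?g (xs ! n) * indicator (?cyl xs) \<omega>) = (\<Sum>xs\<in>?S. if xs = ?xs then ?g (\<omega> n) else 0)"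
    proof (rule sum.cong[OF refl])
      fix xs assume xs: "xs \<in> ?S"
      have "\<omega> \<in> ?cyl xs \<longleftrightarrow> xs = ?xs"
        using xs by (auto simp: list_eq_iff_nth_eq simp del: upt_Suc)
      moreover have "?g (xs ! n) = ?g (\<omega> n)" if "xs = ?xs"
        unfolding that by (simp del: upt_Suc)
      ultimately show "?g (xs ! n) * indicator (?cyl xs) \<omega> = (if xs = ?xs then ?g (\<omega> n) else 0)"
        by (cases "xs = ?xs") (simp_all del: upt_Suc)
    qed
    also have "\<dots> = ?g (\<omega> n)"
      by (subst sum.delta) (auto simp: finite_length_eq)
    finally show ?thesis by simp
  qed
  have "expected \<sigma> \<tau> n = (\<integral>\<omega>. (\<Sum>xs\<in>?S. ?g (xs ! n) * indicator (?cyl xs) \<omega>) \<partial>?M)"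
    unfolding expected_def by (rule Bochner_Integration.integral_cong[OF refl eq])
  also have "\<dots> = (\<Sum>xs\<in>?S. \<integral>\<omega>. ?g (xs ! n) * indicator (?cyl xs) \<omega> \<partial>?M)"
    by (intro Bochner_Integration.integral_sum integrable_mult_right integrable_real_indicator cyl)
      (simp add: emeasure_eq_measure)
  also have "\<dots> = (\<Sum>xs\<in>?S. weight \<sigma> \<tau> xs * ?g (xs ! n))"
  proof (rule sum.cong[OF refl])
    fix xs
    show "(\<integral>\<omega>. ?g (xs ! n) * indicator (?cyl xs) \<omega> \<partial>?M) = weight \<sigma> \<tau> xs * ?g (xs ! n)"
      using sets.Int_space_eq2[OF cyl[of xs]] measure_cylinder[where xs = xs]
      by (simp only: integral_mult_right_zero Bochner_Integration.integral_indicator mult.commute)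
  qed
  finally show ?thesis .
qed

lemma expected_nonneg: "expected \<sigma> \<tau> n \<ge> 0"
  unfolding expected_eq_sum_weight
  by (intro sum_nonneg mult_nonneg_nonneg weight_nonneg) (simp add: g_nonneg split: prod.split)

lemma mean_payoff_eq: "mean_payoff \<pi> q g N \<sigma> \<tau> = (\<Sum>n<N. expected \<sigma> \<tau> n) / N"
proof -
  let ?M = "play_measure \<pi> q \<sigma> \<tau>"
  let ?g = "\<lambda>a. case a of (k, c, d, i, j) \<Rightarrow> g k i j"
  interpret prob_space ?M by (rule prob_space_play_measure)
  have "(\<lambda>\<omega>. ?g (\<omega> n)) \<in> borel_measurable ?M" for n
    unfolding measurable_cong_sets[OF sets_play_measure refl] by measurable
  then have "integrable ?M (\<lambda>\<omega>. ?g (\<omega> n))" for n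
    by (intro integrable_const_bound[where B = 1]) (auto simp: g_nonneg g_le_1 split: prod.split)
  then show ?thesis
    by (simp add: mean_payoff_def expected_def)
qed

lemma occ_nonneg: "occ \<sigma> \<tau> hs d k i \<ge> 0"
  unfolding occ_def by (intro sum_nonneg mult_nonneg_nonneg weight_nonneg) simp_all

lemma marg_occ:
  "marg (occ \<sigma> \<tau> hs d) k = (\<Sum>xs | hist2 xs = hs. weight \<sigma> \<tau> xs * (\<Sum>c\<in>UNIV. pmf (draw xs) (k, c, d)))"
proof -
  have one: "(\<Sum>i\<in>UNIV. pmf p i) = 1" for p :: "'i pmf"
    by (simp add: sum_pmf_eq_1)
  have "marg (occ \<sigma> \<tau> hs d) k = (\<Sum>xs | hist2 xs = hs. \<Sum>i\<in>UNIV.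
      weight \<sigma> \<tau> xs * (\<Sum>c\<in>UNIV. pmf (draw xs) (k, c, d) * pmf (\<sigma> (hist1 xs) c) i))"
    unfolding marg_def occ_def by (rule sum.swap)
  also have "\<dots> = (\<Sum>xs | hist2 xs = hs. weight \<sigma> \<tau> xs * (\<Sum>c\<in>UNIV. pmf (draw xs) (k, c, d)))"
    by (intro sum.cong refl, subst sum_distrib_left[symmetric], subst sum.swap)
      (simp add: one flip: sum_distrib_left)
  finally show ?thesis .
qed

lemma hist2_Nil: "{xs. hist2 xs = []} = {[]}"
  by (auto simp: hist2_def)

lemma marg_occ_Nil: "marg (occ \<sigma> \<tau> [] d) = start d"
  by (simp add: marg_occ hist2_Nil weight_Nil draw_Nil start_def fun_eq_iff)

lemma hist2_eq_snoc:
  "hist2 xs = hs @ [(d, j)] \<longleftrightarrow> (\<exists>ys k c i. xs = ys @ [(k, c, d, i, j)] \<and> hist2 ys = hs)"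
  by (cases xs rule: rev_cases) (auto simp: hist2_def)

lemma sum_hist2_snoc:
  fixes f :: "('k \<times> 'c \<times> 'd \<times> 'i \<times> 'j) list \<Rightarrow> real"
  shows "(\<Sum>xs | hist2 xs = hs @ [(d, j)]. f xs) =
    (\<Sum>xs | hist2 xs = hs. \<Sum>k\<in>UNIV. \<Sum>c\<in>UNIV. \<Sum>i\<in>UNIV. f (xs @ [(k, c, d, i, j)]))"
proof -
  have "bij_betw (\<lambda>(xs, k, c, i). xs @ [(k, c, d, i, j)]) ({xs. hist2 xs = hs} \<times> UNIV)
      {xs :: ('k \<times> 'c \<times> 'd \<times> 'i \<times> 'j) list. hist2 xs = hs @ [(d, j)]}"
    by (rule bij_betw_byWitness[where f' = "\<lambda>xs. (butlast xs, fst (last xs), fst (snd (last xs)), fst (snd (snd (snd (last xs)))))"])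
      (auto simp: hist2_eq_snoc)
  from sum.reindex_bij_betw[OF this, of f] show ?thesis
    by (simp add: sum.cartesian_product case_prod_unfold flip: UNIV_Times_UNIV)
qed

text \<open>This is where (HB') acts. Given what player 2 has observed, \<open>j\<close> is
  independent of the state and of \<open>i\<close>, and the transition to the next state and signal
  ignores it; so \<open>j\<close> contributes only its probability as a factor.\<close>

lemma marg_occ_snoc:
  "marg (occ \<sigma> \<tau> (hs @ [(d, j)]) d') = (\<lambda>k'. pmf (\<tau> hs d) j * out (occ \<sigma> \<tau> hs d) d' k')"
proof
  fix k'
  have "marg (occ \<sigma> \<tau> (hs @ [(d, j)]) d') k' = (\<Sum>xs | hist2 xs = hs. \<Sum>k\<in>UNIV. \<Sum>c\<in>UNIV. \<Sum>i\<in>UNIV.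
      weight \<sigma> \<tau> xs * (pmf (draw xs) (k, c, d) * pmf (\<sigma> (hist1 xs) c) i * pmf (\<tau> hs d) j) * Q k i k' d')"
    unfolding marg_occ sum_hist2_snoc
    by (intro sum.cong refl) (simp add: weight_snoc draw_snoc marginal)
  also have "\<dots> = pmf (\<tau> hs d) j * (\<Sum>xs | hist2 xs = hs. \<Sum>k\<in>UNIV. \<Sum>i\<in>UNIV. \<Sum>c\<in>UNIV.
      weight \<sigma> \<tau> xs * (pmf (draw xs) (k, c, d) * pmf (\<sigma> (hist1 xs) c) i) * Q k i k' d')"
    by (simp add: sum_distrib_left ac_simps, intro sum.cong refl, rule sum.swap)
  also have "\<dots> = pmf (\<tau> hs d) j * out (occ \<sigma> \<tau> hs d) d' k'"
    unfolding out_def occ_def sum_distrib_right sum_distrib_left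
    by (simp only: sum.swap[of _ _ "{xs. hist2 xs = hs}"])
  finally show "marg (occ \<sigma> \<tau> (hs @ [(d, j)]) d') k' = pmf (\<tau> hs d) j * out (occ \<sigma> \<tau> hs d) d' k'" .
qed

text \<open>Plays are grouped by the information of player 2; given it, his action is independent of
  the state and of the action of player 1.\<close>

lemma expected_eq_sum_occ:
  "expected \<sigma> \<tau> n = (\<Sum>hs | length hs = n. \<Sum>d\<in>UNIV. \<Sum>j\<in>UNIV. pmf (\<tau> hs d) j * lin (occ \<sigma> \<tau> hs d) j)"
proof -
  let ?f = "\<lambda>xs k c d i j. weight \<sigma> \<tau> xs * (pmf (draw xs) (k, c, d) * pmf (\<sigma> (hist1 xs) c) i * pmf (\<tau> (hist2 xs) d) j) * g k i j"
  let ?S = "{xs :: ('k \<times> 'c \<times> 'd \<times> 'i \<times> 'j) list. length xs = n}"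
  have "expected \<sigma> \<tau> n = (\<Sum>xs\<in>?S. \<Sum>k\<in>UNIV. \<Sum>c\<in>UNIV. \<Sum>d\<in>UNIV. \<Sum>i\<in>UNIV. \<Sum>j\<in>UNIV. ?f xs k c d i j)"
    unfolding expected_eq_sum_weight sum_length_snoc sum_prod5
    by (intro sum.cong refl) (auto simp: weight_snoc nth_append)
  also have "\<dots> = (\<Sum>hs | length hs = n. \<Sum>xs | xs \<in> ?S \<and> hist2 xs = hs.
      \<Sum>k\<in>UNIV. \<Sum>c\<in>UNIV. \<Sum>d\<in>UNIV. \<Sum>i\<in>UNIV. \<Sum>j\<in>UNIV. ?f xs k c d i j)"
    by (rule sum.group[symmetric]) (auto simp: finite_length_eq hist2_def)
  also have "\<dots> = (\<Sum>hs | length hs = n. \<Sum>d\<in>UNIV. \<Sum>j\<in>UNIV. pmf (\<tau> hs d) j * lin (occ \<sigma> \<tau> hs d) j)"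
  proof (intro sum.cong refl)
    fix hs :: "('d \<times> 'j) list" assume "hs \<in> {hs. length hs = n}"
    then have S: "{xs. xs \<in> ?S \<and> hist2 xs = hs} = {xs. hist2 xs = hs}" by (auto simp: hist2_def)
    let ?h = "\<lambda>xs k c d i j. weight \<sigma> \<tau> xs * (pmf (draw xs) (k, c, d) * pmf (\<sigma> (hist1 xs) c) i * pmf (\<tau> hs d) j) * g k i j"
    have "(\<Sum>xs | hist2 xs = hs. \<Sum>k\<in>UNIV. \<Sum>c\<in>UNIV. \<Sum>d\<in>UNIV. \<Sum>i\<in>UNIV. \<Sum>j\<in>UNIV. ?f xs k c d i j)
        = (\<Sum>xs | hist2 xs = hs. \<Sum>k\<in>UNIV. \<Sum>c\<in>UNIV. \<Sum>d\<in>UNIV. \<Sum>i\<in>UNIV. \<Sum>j\<in>UNIV. ?h xs k c d i j)"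
      by (intro sum.cong refl) auto
    also have "\<dots> = (\<Sum>d\<in>UNIV. \<Sum>j\<in>UNIV. \<Sum>k\<in>UNIV. \<Sum>i\<in>UNIV. \<Sum>xs | hist2 xs = hs. \<Sum>c\<in>UNIV. ?h xs k c d i j)"
      by (rule sum_swap6)
    also have "\<dots> = (\<Sum>d\<in>UNIV. \<Sum>j\<in>UNIV. pmf (\<tau> hs d) j * lin (occ \<sigma> \<tau> hs d) j)"
      unfolding lin_def occ_def by (simp add: sum_distrib_left sum_distrib_right ac_simps)
    finally show "(\<Sum>xs | xs \<in> ?S \<and> hist2 xs = hs. \<Sum>k\<in>UNIV. \<Sum>c\<in>UNIV. \<Sum>d\<in>UNIV. \<Sum>i\<in>UNIV. \<Sum>j\<in>UNIV. ?f xs k c d i j)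
       = (\<Sum>d\<in>UNIV. \<Sum>j\<in>UNIV. pmf (\<tau> hs d) j * lin (occ \<sigma> \<tau> hs d) j)"
      unfolding S .
  qed
  finally show ?thesis .
qed

end

section \<open>Guarantees of the two players\<close>

lemma pmf_of_weights:
  fixes f :: "'a::finite \<Rightarrow> real"
  assumes "\<And>a. f a \<ge> 0" "(\<Sum>a\<in>UNIV. f a) = 1"
  obtains p where "\<And>a. pmf p a = f a"
proof -
  have "(\<integral>\<^sup>+ a. ennreal (f a) \<partial>count_space UNIV) = 1"
    using assms by (simp add: nn_integral_count_space_finite sum_ennreal)
  with assms(1) show thesis by (intro that[of "embed_pmf f"] pmf_embed_pmf)
qed

lemma sum_map_fst_snoc:
  fixes f :: "('d::finite \<times> 'j::finite) list \<Rightarrow> real"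
  shows "(\<Sum>hs | map fst hs = ds @ [d]. f hs) = (\<Sum>hs | map fst hs = ds. \<Sum>j\<in>UNIV. f (hs @ [(d, j)]))"
proof -
  have eq: "map fst hs = ds @ [d] \<longleftrightarrow> (\<exists>hs' j. hs = hs' @ [(d, j)] \<and> map fst hs' = ds)"
    for hs :: "('d \<times> 'j) list"
    by (cases hs rule: rev_cases) auto
  have "bij_betw (\<lambda>(hs, j). hs @ [(d, j)]) ({hs. map fst hs = ds} \<times> UNIV)
      {hs :: ('d \<times> 'j) list. map fst hs = ds @ [d]}"
    by (rule bij_betw_byWitness[where f' = "\<lambda>hs. (butlast hs, snd (last hs))"]) (auto simp: eq)
  from sum.reindex_bij_betw[OF this, of f] show ?thesis
    by (simp add: sum.cartesian_product case_prod_unfold)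
qed

lemma sum_pmf_UNIV: "(\<Sum>a\<in>UNIV. pmf p a) = 1" for p :: "'a::finite pmf"
  by (simp add: sum_pmf_eq_1)

context repeated_game
begin

section \<open>Strategies of player 2 based on his signals alone\<close>

lemma start_nonneg: "\<forall>k. start d k \<ge> 0"
  by (simp add: start_def sum_nonneg)

lemma sum_mass_start: "(\<Sum>d\<in>UNIV. mass (start d)) = 1"
proof -
  have "(\<Sum>d\<in>UNIV. mass (start d)) = (\<Sum>k\<in>UNIV. \<Sum>d\<in>UNIV. \<Sum>c\<in>UNIV. pmf \<pi> (k, c, d))"
    unfolding mass_def start_def by (rule sum.swap)
  also have "\<dots> = (\<Sum>k\<in>UNIV. \<Sum>c\<in>UNIV. \<Sum>d\<in>UNIV. pmf \<pi> (k, c, d))"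
    by (intro sum.cong refl sum.swap)
  also have "\<dots> = (\<Sum>y\<in>UNIV. pmf \<pi> y)"
    by (simp add: sum.cartesian_product case_prod_unfold flip: UNIV_Times_UNIV)
  finally show ?thesis by (simp add: sum_pmf_UNIV)
qed

definition signal_law :: "('c, 'i) strategy \<Rightarrow> ('d, 'j) strategy \<Rightarrow> 'd list \<Rightarrow> 'k \<Rightarrow> 'i \<Rightarrow> real" where
  "signal_law \<sigma> \<tau> l k i = (\<Sum>hs | map fst hs = butlast l. occ \<sigma> \<tau> hs (last l) k i)"

text \<open>Player 1 may learn past actions of player 2 from his signals. This does not help him:
  summing over these actions leaves a flow.\<close>

lemma flow_signal_law:
  assumes \<tau>: "\<And>hs d. \<tau> hs d = \<theta> (map fst hs @ [d])"
  shows "flow (start d) (\<lambda>h. signal_law \<sigma> \<tau> (d # h))"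
proof -
  have marg: "marg (signal_law \<sigma> \<tau> l) k = (\<Sum>hs | map fst hs = butlast l. marg (occ \<sigma> \<tau> hs (last l)) k)" for l k
    unfolding marg_def signal_law_def by (rule sum.swap)
  have "marg (signal_law \<sigma> \<tau> (l @ [d'])) k' = out (signal_law \<sigma> \<tau> l) d' k'" if "l \<noteq> []" for l d' k'
  proof -
    have "marg (signal_law \<sigma> \<tau> (l @ [d'])) k' = (\<Sum>hs | map fst hs = l. marg (occ \<sigma> \<tau> hs d') k')"
      by (simp add: marg)
    also have "\<dots> = (\<Sum>hs | map fst hs = butlast l @ [last l]. marg (occ \<sigma> \<tau> hs d') k')"
      using that by simp
    also have "\<dots> = (\<Sum>hs | map fst hs = butlast l. \<Sum>j\<in>UNIV. pmf (\<tau> hs (last l)) j * out (occ \<sigma> \<tau> hs (last l)) d' k')"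
      unfolding sum_map_fst_snoc marg_occ_snoc ..
    also have "\<dots> = (\<Sum>hs | map fst hs = butlast l. out (occ \<sigma> \<tau> hs (last l)) d' k')"
      by (simp add: sum_pmf_UNIV flip: sum_distrib_right)
    also have "\<dots> = out (signal_law \<sigma> \<tau> l) d' k'"
      unfolding out_def signal_law_def sum_distrib_right
      by (simp only: sum.swap[of _ _ "{hs. map fst hs = butlast l}"])
    finally show ?thesis .
  qed
  from this[of "d # _"] show ?thesis
    by (simp add: flow_def fun_eq_iff marg marg_occ_Nil)
      (simp add: signal_law_def sum_nonneg occ_nonneg)
qed

lemma expected_open_loop:
  assumes \<tau>: "\<And>hs d. \<tau> hs d = \<theta> (map fst hs @ [d])"
  shows "expected \<sigma> \<tau> n = (\<Sum>d\<in>UNIV. \<Sum>h | length h = n. \<Sum>j\<in>UNIV.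
    pmf (\<theta> (d # h)) j * lin (signal_law \<sigma> \<tau> (d # h)) j)"
proof -
  have "expected \<sigma> \<tau> n = (\<Sum>ds | length ds = n. \<Sum>hs | hs \<in> {hs. length hs = n} \<and> map fst hs = ds.
      \<Sum>d\<in>UNIV. \<Sum>j\<in>UNIV. pmf (\<tau> hs d) j * lin (occ \<sigma> \<tau> hs d) j)"
    unfolding expected_eq_sum_occ by (rule sum.group[symmetric]) (auto simp: finite_length_eq)
  also have "\<dots> = (\<Sum>ds | length ds = n. \<Sum>d\<in>UNIV. \<Sum>j\<in>UNIV.
      pmf (\<theta> (ds @ [d])) j * lin (signal_law \<sigma> \<tau> (ds @ [d])) j)"
  proof (rule sum.cong[OF refl])
    fix ds :: "'d list" assume "ds \<in> {ds. length ds = n}"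
    then have S: "{hs :: ('d \<times> 'j) list. hs \<in> {hs. length hs = n} \<and> map fst hs = ds} = {hs. map fst hs = ds}" by auto
    have "(\<Sum>hs | map fst hs = ds. \<Sum>d\<in>UNIV. \<Sum>j\<in>UNIV. pmf (\<tau> hs d) j * lin (occ \<sigma> \<tau> hs d) j)
      = (\<Sum>hs | map fst hs = ds. \<Sum>d\<in>UNIV. \<Sum>j\<in>UNIV. pmf (\<theta> (ds @ [d])) j * lin (occ \<sigma> \<tau> hs d) j)"
      by (intro sum.cong refl) (simp add: \<tau>)
    also have "\<dots> = (\<Sum>d\<in>UNIV. \<Sum>j\<in>UNIV. pmf (\<theta> (ds @ [d])) j * (\<Sum>hs | map fst hs = ds. lin (occ \<sigma> \<tau> hs d) j))"
      unfolding sum_distrib_left by (simp only: sum.swap[of _ _ "{hs. map fst hs = ds}"])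
    also have "\<dots> = (\<Sum>d\<in>UNIV. \<Sum>j\<in>UNIV. pmf (\<theta> (ds @ [d])) j * lin (signal_law \<sigma> \<tau> (ds @ [d])) j)"
      unfolding lin_sum[symmetric] by (simp add: signal_law_def[abs_def])
    finally show "(\<Sum>hs | hs \<in> {hs. length hs = n} \<and> map fst hs = ds.
        \<Sum>d\<in>UNIV. \<Sum>j\<in>UNIV. pmf (\<tau> hs d) j * lin (occ \<sigma> \<tau> hs d) j)
      = (\<Sum>d\<in>UNIV. \<Sum>j\<in>UNIV. pmf (\<theta> (ds @ [d])) j * lin (signal_law \<sigma> \<tau> (ds @ [d])) j)"
      unfolding S .
  qed
  also have "\<dots> = (\<Sum>l | length l = Suc n. \<Sum>j\<in>UNIV. pmf (\<theta> l) j * lin (signal_law \<sigma> \<tau> l) j)"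
    by (simp only: sum_length_snoc)
  finally show ?thesis by (simp only: sum_length_Suc)
qed

text \<open>Neither \<sigma> nor the belief at the start of a block has to be known: the minimax
  strategy for the window starting at \<open>l * N\<close> is computed from \<open>start d\<close>
  and is valid against every flow from there.\<close>

lemma player2_block_strategy:
  assumes "N > 0"
  obtains \<tau> where "\<And>\<sigma> n. (\<Sum>t<n. expected \<sigma> \<tau> t) \<le> (n / N + 1) * (\<Sum>d\<in>UNIV. best N (start d))"
proof -
  define good where "good d l p \<longleftrightarrow> (\<forall>h j. p h j \<ge> 0) \<and> (\<forall>h. (\<Sum>j\<in>UNIV. p h j) = 1) \<and>
    (\<forall>F. flow (start d) F \<longrightarrow> (\<Sum>t<N. \<Sum>h | length h = l * N + t. \<Sum>j\<in>UNIV. p h j * lin (F h) j) \<le> best N (start d))"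
    for d l and p :: "'d list \<Rightarrow> 'j \<Rightarrow> real"
  have "\<exists>p. good d l p" for d l
  proof (rule window_minimax[OF start_nonneg[of d], where n = N and m = "l * N"])
    fix p :: "'d list \<Rightarrow> 'j \<Rightarrow> real"
    assume "\<And>h j. p h j \<ge> 0" "\<And>h. (\<Sum>j\<in>UNIV. p h j) = 1"
      "\<And>F. flow (start d) F \<Longrightarrow>
        (\<Sum>t<N. \<Sum>h | length h = l * N + t. \<Sum>j\<in>UNIV. p h j * lin (F h) j) \<le> best N (start d)"
    then show ?thesis unfolding good_def by (intro exI[of _ p]) simp
  qed
  then have ex: "good d l (SOME p. good d l p)" for d l by (rule someI_ex)
  \<comment> \<open>The length of \<open>h\<close> tells the current block, hence which of the
    minimax families applies.\<close>
  define p where "p d h = (SOME p. good d (length h div N) p) h" for d and h :: "'d list"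
  have p: "p d h j \<ge> 0" "(\<Sum>j\<in>UNIV. p d h j) = 1" for d h j
    using ex[of d "length h div N"] by (auto simp: p_def good_def)
  define \<theta> where "\<theta> l = (SOME P. \<forall>j. pmf P j = p (hd l) (tl l) j)" for l
  have \<theta>: "pmf (\<theta> (d # h)) j = p d h j" for d h j
  proof -
    obtain P where "\<And>j. pmf P j = p d h j" by (rule pmf_of_weights[of "p d h"]) (auto simp: p)
    then have "\<exists>P. \<forall>j. pmf P j = p d h j" by blast
    from someI_ex[OF this] show ?thesis by (simp add: \<theta>_def)
  qed
  define \<tau> where "\<tau> hs d = \<theta> (map fst hs @ [d])" for hs :: "('d \<times> 'j) list" and d
  let ?B = "\<Sum>d\<in>UNIV. best N (start d)"
  have B: "?B \<ge> 0" by (intro sum_nonneg best_nonneg start_nonneg)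
  have block: "(\<Sum>t<N. expected \<sigma> \<tau> (l * N + t)) \<le> ?B" for \<sigma> l
  proof -
    have "(\<Sum>t<N. expected \<sigma> \<tau> (l * N + t)) = (\<Sum>d\<in>UNIV. \<Sum>t<N. \<Sum>h | length h = l * N + t. \<Sum>j\<in>UNIV.
        p d h j * lin (signal_law \<sigma> \<tau> (d # h)) j)"
      unfolding expected_open_loop[of \<tau> \<theta>, OF \<tau>_def] \<theta> by (rule sum.swap)
    also have "\<dots> = (\<Sum>d\<in>UNIV. \<Sum>t<N. \<Sum>h | length h = l * N + t. \<Sum>j\<in>UNIV.
        (SOME p. good d l p) h j * lin (signal_law \<sigma> \<tau> (d # h)) j)"
      by (intro sum.cong refl) (auto simp: p_def)
    also have "\<dots> \<le> ?B"
    proof (rule sum_mono)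
      fix d
      show "(\<Sum>t<N. \<Sum>h | length h = l * N + t. \<Sum>j\<in>UNIV.
        (SOME p. good d l p) h j * lin (signal_law \<sigma> \<tau> (d # h)) j) \<le> best N (start d)"
        using ex[of d l] flow_signal_law[of \<tau> \<theta>, OF \<tau>_def] unfolding good_def by blast
    qed
    finally show ?thesis .
  qed
  have blocks: "(\<Sum>t<l * N. expected \<sigma> \<tau> t) \<le> l * ?B" for \<sigma> and l :: nat
  proof (induction l)
    case (Suc l)
    have "(\<Sum>t<Suc l * N. expected \<sigma> \<tau> t) = (\<Sum>t<l * N. expected \<sigma> \<tau> t) + (\<Sum>t<N. expected \<sigma> \<tau> (l * N + t))"
      using sum.nat_group[of "expected \<sigma> \<tau>" N "Suc l"] sum.nat_group[of "expected \<sigma> \<tau>" N l]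
        sum.shift_bounds_nat_ivl[of "expected \<sigma> \<tau>" 0 "l * N" N]
      by (simp add: atLeast0LessThan mult.commute add.commute)
    with Suc block[of \<sigma> l] show ?case by (simp add: algebra_simps)
  qed simp
  show thesis
  proof (rule that[of \<tau>])
    fix \<sigma> n
    \<comment> \<open>An unfinished last block is counted in full, which is allowed because payoffs
      are nonnegative.\<close>
    let ?l = "n div N + 1"
    have "n \<le> ?l * N" using dividend_less_div_times[OF assms, of n] by simp
    then have "(\<Sum>t<n. expected \<sigma> \<tau> t) \<le> (\<Sum>t<?l * N. expected \<sigma> \<tau> t)"
      by (intro sum_mono2) (auto simp: expected_nonneg)
    also have "\<dots> \<le> ?l * ?B" by (rule blocks)
    also have "\<dots> \<le> (n / N + 1) * ?B"
      using B of_nat_div_le_of_nat[of n N, where ?'a = real] by (intro mult_right_mono) auto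
    finally show "(\<Sum>t<n. expected \<sigma> \<tau> t) \<le> (n / N + 1) * ?B" .
  qed
qed

section \<open>Realising a flow by a strategy of player 1\<close>

definition action_weight :: "('d, 'j) strategy \<Rightarrow> ('d \<times> 'j) list \<Rightarrow> real" where
  "action_weight \<tau> hs = (\<Prod>m<length hs. pmf (\<tau> (take m hs) (fst (hs ! m))) (snd (hs ! m)))"

lemma action_weight_Nil: "action_weight \<tau> [] = 1"
  by (simp add: action_weight_def)

lemma action_weight_snoc: "action_weight \<tau> (hs @ [a]) = action_weight \<tau> hs * pmf (\<tau> hs (fst a)) (snd a)"
  by (simp add: action_weight_def nth_append)

lemma action_weight_nonneg: "action_weight \<tau> hs \<ge> 0"
  by (simp add: action_weight_def prod_nonneg)

text \<open>For a fixed signal sequence the actions of player 2 have total weight 1, whatever \<tau>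
  is, so they can be summed out from the last one backwards.\<close>

lemma sum_action_weight:
  "(\<Sum>hs | length hs = n. action_weight \<tau> hs * \<phi> (map fst hs)) = (\<Sum>ds | length ds = n. \<phi> ds)"
proof (induction n arbitrary: \<phi>)
  case 0
  then show ?case by (simp add: action_weight_Nil)
next
  case (Suc n)
  have "(\<Sum>hs | length hs = Suc n. action_weight \<tau> hs * \<phi> (map fst hs))
      = (\<Sum>hs | length hs = n. \<Sum>d\<in>UNIV. \<Sum>j\<in>UNIV. action_weight \<tau> hs * pmf (\<tau> hs d) j * \<phi> (map fst hs @ [d]))"
    unfolding sum_length_snoc
    by (simp add: sum.cartesian_product action_weight_snoc case_prod_unfold flip: UNIV_Times_UNIV)
  also have "\<dots> = (\<Sum>hs | length hs = n. action_weight \<tau> hs * (\<Sum>d\<in>UNIV. \<phi> (map fst hs @ [d])))"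
  proof (rule sum.cong[OF refl])
    fix hs :: "('d \<times> 'j) list"
    have "(\<Sum>d\<in>UNIV. \<Sum>j\<in>UNIV. action_weight \<tau> hs * pmf (\<tau> hs d) j * \<phi> (map fst hs @ [d]))
        = (\<Sum>d\<in>UNIV. action_weight \<tau> hs * (\<Sum>j\<in>UNIV. pmf (\<tau> hs d) j) * \<phi> (map fst hs @ [d]))"
      by (simp only: sum_distrib_left sum_distrib_right)
    then show "(\<Sum>d\<in>UNIV. \<Sum>j\<in>UNIV. action_weight \<tau> hs * pmf (\<tau> hs d) j * \<phi> (map fst hs @ [d]))
        = action_weight \<tau> hs * (\<Sum>d\<in>UNIV. \<phi> (map fst hs @ [d]))"
      by (simp only: sum_pmf_UNIV mult_1_right sum_distrib_left)
  qed
  also have "\<dots> = (\<Sum>ds | length ds = n. \<Sum>d\<in>UNIV. \<phi> (ds @ [d]))" by (rule Suc.IH)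
  finally show ?case by (simp only: sum_length_snoc)
qed

text \<open>By (HA') player 1 reads the state and the signals of player 2 off his own signals, and
  can play the conditional law of the flow. Then \<tau> only multiplies the flow by
  \<open>action_weight\<close>, and each reply costs player 2 at least \<open>rew\<close>.\<close>

lemma player1_flow_strategy:
  fixes khat :: "'c \<Rightarrow> 'k" and dhat :: "'c \<Rightarrow> 'd"
  assumes inf_\<pi>: "\<And>k c d. pmf \<pi> (k, c, d) \<noteq> 0 \<Longrightarrow> khat c = k \<and> dhat c = d"
    and inf_q: "\<And>k' i j k c d. pmf (q k' i j) (k, c, d) \<noteq> 0 \<Longrightarrow> khat c = k \<and> dhat c = d"
    and F: "\<And>d. flow (start d) (F d)"
  obtains \<sigma> where "\<And>\<tau> n. (\<Sum>d\<in>UNIV. stage (F d) n) \<le> expected \<sigma> \<tau> n"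
proof -
  define s where "s l k = (SOME P. \<forall>i. pmf P i = plan_of (F (hd l)) (tl l) k i)" for l k
  have s: "pmf (s l k) i = plan_of (F (hd l)) (tl l) k i" for l k i
  proof -
    have "is_plan (plan_of (F (hd l)))" by (rule is_plan_plan_of) (rule flow_nonneg[OF F])
    then have "plan_of (F (hd l)) (tl l) k i \<ge> 0" "(\<Sum>i\<in>UNIV. plan_of (F (hd l)) (tl l) k i) = 1" for i
      by (simp_all add: is_plan_def)
    then obtain P where "\<And>i. pmf P i = plan_of (F (hd l)) (tl l) k i"
      using pmf_of_weights[of "plan_of (F (hd l)) (tl l) k"] by metis
    then have "\<exists>P. \<forall>i. pmf P i = plan_of (F (hd l)) (tl l) k i" by blast
    from someI_ex[OF this] show ?thesis by (simp add: s_def)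
  qed
  define \<sigma> where "\<sigma> h c = s (map (\<lambda>(c, i). dhat c) h @ [dhat c]) (khat c)" for h :: "('c \<times> 'i) list" and c
  have draw: "khat c = k \<and> dhat c = d" if "pmf (draw xs) (k, c, d) \<noteq> 0" for xs k c d
    using that inf_\<pi> inf_q by (cases xs rule: rev_cases) (auto simp: draw_Nil draw_snoc)
  \<comment> \<open>(HA') is an almost sure statement, so the decoding is correct only on plays of
    positive weight; the others contribute nothing.\<close>
  have signals: "map (\<lambda>(c, i). dhat c) (hist1 xs) = map fst (hist2 xs)" if "weight \<sigma> \<tau> xs \<noteq> 0" for \<tau> xs
    using that
  proof (induction xs rule: rev_induct)
    case (snoc a xs)
    obtain k c d i j where a: "a = (k, c, d, i, j)" by (cases a)
    have "weight \<sigma> \<tau> xs \<noteq> 0" "dhat c = d"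
      using snoc.prems draw[of xs k c d] by (auto simp: a weight_snoc)
    then show ?case using snoc.IH by (simp add: a hist1_def hist2_def)
  qed (simp add: hist1_def hist2_def)
  have occ_plan: "occ \<sigma> \<tau> hs d k i = marg (occ \<sigma> \<tau> hs d) k * pmf (s (map fst hs @ [d]) k) i" for \<tau> hs d k i
  proof -
    have "weight \<sigma> \<tau> xs * (pmf (draw xs) (k, c, d) * pmf (\<sigma> (hist1 xs) c) i) =
        weight \<sigma> \<tau> xs * pmf (draw xs) (k, c, d) * pmf (s (map fst hs @ [d]) k) i" if "hist2 xs = hs" for xs c
      using signals[of \<tau> xs] draw[of xs k c d] that
      by (cases "weight \<sigma> \<tau> xs = 0 \<or> pmf (draw xs) (k, c, d) = 0") (auto simp: \<sigma>_def)
    then show ?thesis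
      unfolding marg_occ occ_def sum_distrib_left sum_distrib_right by (intro sum.cong refl) simp
  qed
  \<comment> \<open>Conditional on the formula for the marginal, because the two are obtained
    alternately: the marginal at a history gives the law with the action, and that gives the
    marginal one signal later. \<open>hd\<close> selects the flow by the first signal and
    \<open>tl\<close> is the history within it.\<close>
  have occ: "occ \<sigma> \<tau> hs d = (\<lambda>k i. action_weight \<tau> hs * F (hd (map fst hs @ [d])) (tl (map fst hs @ [d])) k i)"
    if "marg (occ \<sigma> \<tau> hs d) = (\<lambda>k. action_weight \<tau> hs * marg (F (hd (map fst hs @ [d])) (tl (map fst hs @ [d]))) k)" for \<tau> hs d
    using marg_mult_plan_of[of "F d'" for d', OF flow_nonneg[OF F]]
    by (simp add: fun_eq_iff occ_plan that s mult.assoc)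
  have marg: "marg (occ \<sigma> \<tau> hs d) = (\<lambda>k. action_weight \<tau> hs * marg (F (hd (map fst hs @ [d])) (tl (map fst hs @ [d]))) k)" for \<tau> hs d
  proof (induction hs arbitrary: d rule: rev_induct)
    case Nil
    then show ?case by (simp add: action_weight_Nil marg_occ_Nil flow_start[OF F])
  next
    case (snoc a hs)
    obtain d0 j where a: "a = (d0, j)" by (cases a)
    let ?l = "map fst hs @ [d0]"
    have l: "hd (?l @ [d]) = hd ?l" "tl (?l @ [d]) = tl ?l @ [d]" by (cases hs; simp)+
    have "marg (F (hd (?l @ [d])) (tl (?l @ [d]))) = out (F (hd ?l) (tl ?l)) d"
      unfolding l by (rule flow_step[OF F])
    then show ?case
      using occ[OF snoc.IH[of d0]]
      by (simp add: a marg_occ_snoc action_weight_snoc fun_eq_iff out_def sum_distrib_left ac_simps)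
  qed
  show thesis
  proof (rule that[of \<sigma>])
    fix \<tau> n
    have "(\<Sum>d\<in>UNIV. stage (F d) n) = (\<Sum>l | length l = Suc n. rew (F (hd l) (tl l)))"
      by (simp add: sum_length_Suc stage_def)
    also have "\<dots> = (\<Sum>ds | length ds = n. \<Sum>d\<in>UNIV. rew (F (hd (ds @ [d])) (tl (ds @ [d]))))"
      by (simp only: sum_length_snoc)
    also have "\<dots> = (\<Sum>hs | length hs = n. action_weight \<tau> hs *
        (\<Sum>d\<in>UNIV. rew (F (hd (map fst hs @ [d])) (tl (map fst hs @ [d])))))"
      by (rule sum_action_weight[symmetric])
    also have "\<dots> = (\<Sum>hs | length hs = n. \<Sum>d\<in>UNIV. rew (occ \<sigma> \<tau> hs d))"
      unfolding occ[OF marg] by (simp add: rew_scale action_weight_nonneg sum_distrib_left)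
    also have "\<dots> \<le> expected \<sigma> \<tau> n"
      unfolding expected_eq_sum_occ
    proof (intro sum_mono)
      fix hs d
      have "rew (occ \<sigma> \<tau> hs d) = (\<Sum>j\<in>UNIV. pmf (\<tau> hs d) j * rew (occ \<sigma> \<tau> hs d))"
        by (simp add: sum_pmf_UNIV flip: sum_distrib_right)
      also have "\<dots> \<le> (\<Sum>j\<in>UNIV. pmf (\<tau> hs d) j * lin (occ \<sigma> \<tau> hs d) j)"
        by (intro sum_mono mult_left_mono rew_le) simp
      finally show "rew (occ \<sigma> \<tau> hs d) \<le> (\<Sum>j\<in>UNIV. pmf (\<tau> hs d) j * lin (occ \<sigma> \<tau> hs d) j)" .
    qed
    finally show "(\<Sum>d\<in>UNIV. stage (F d) n) \<le> expected \<sigma> \<tau> n" .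
  qed
qed

lemma lower_value_ge:
  fixes khat :: "'c \<Rightarrow> 'k" and dhat :: "'c \<Rightarrow> 'd"
  assumes inf_\<pi>: "\<And>k c d. pmf \<pi> (k, c, d) \<noteq> 0 \<Longrightarrow> khat c = k \<and> dhat c = d"
    and inf_q: "\<And>k' i j k c d. pmf (q k' i j) (k, c, d) \<noteq> 0 \<Longrightarrow> khat c = k \<and> dhat c = d"
    and "\<delta> > 0"
  shows "ereal ((\<Sum>d\<in>UNIV. val (start d)) - \<delta>) \<le> lower_value \<pi> q g"
proof -
  let ?v = "\<Sum>d\<in>UNIV. val (start d)"
  \<comment> \<open>Half of \<open>\<delta>\<close> is spent on the flows, whose starting masses sum
    to 1; the other half absorbs the constants \<open>M d\<close> once \<open>N\<close> is
    large.\<close>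
  have "\<exists>F M. flow (start d) F \<and> (\<forall>N. N * (val (start d) - \<delta> / 2 * mass (start d)) - M \<le> window F 0 N)" for d
    by (rule uniform_flow[OF start_nonneg, of "\<delta> / 2" d]) (use \<open>\<delta> > 0\<close> in auto)
  then obtain F M where F: "\<And>d. flow (start d) (F d)"
    and FM: "\<And>d N. N * (val (start d) - \<delta> / 2 * mass (start d)) - M d \<le> window (F d) 0 N"
    by metis
  obtain \<sigma> where \<sigma>: "\<And>\<tau> n. (\<Sum>d\<in>UNIV. stage (F d) n) \<le> expected \<sigma> \<tau> n"
    by (rule player1_flow_strategy[OF inf_\<pi> inf_q F]) blast+
  have payoff: "N * (?v - \<delta> / 2) - (\<Sum>d\<in>UNIV. M d) \<le> (\<Sum>n<N. expected \<sigma> \<tau> n)" for N \<tau>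
  proof -
    have "N * (?v - \<delta> / 2) - (\<Sum>d\<in>UNIV. M d) = (\<Sum>d\<in>UNIV. N * (val (start d) - \<delta> / 2 * mass (start d)) - M d)"
    proof -
      have "(\<Sum>d\<in>UNIV. val (start d) - \<delta> / 2 * mass (start d)) = ?v - \<delta> / 2"
        by (simp only: sum_subtractf sum_distrib_left[symmetric] sum_mass_start mult_1_right)
      then show ?thesis 
        by (metis (no_types, lifting) sum.cong sum_subtractf sum_distrib_left)
    qed
    also have "\<dots> \<le> (\<Sum>d\<in>UNIV. window (F d) 0 N)" by (intro sum_mono FM)
    also have "\<dots> = (\<Sum>n<N. \<Sum>d\<in>UNIV. stage (F d) n)" unfolding window_def by (subst sum.swap) simp
    also have "\<dots> \<le> (\<Sum>n<N. expected \<sigma> \<tau> n)" by (intro sum_mono \<sigma>)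
    finally show ?thesis .
  qed
  obtain N0 :: nat where N0: "2 * (\<Sum>d\<in>UNIV. M d) / \<delta> \<le> real N0" using real_arch_simple by blast
  have "ereal (?v - \<delta>) \<le> (INF \<tau>. ereal (mean_payoff \<pi> q g N \<sigma> \<tau>))" if "N \<ge> Suc N0" for N
  proof (rule INF_greatest)
    fix \<tau>
    have "2 * (\<Sum>d\<in>UNIV. M d) / \<delta> \<le> N" using N0 that by simp
    then have "(\<Sum>d\<in>UNIV. M d) \<le> N * (\<delta> / 2)" using \<open>\<delta> > 0\<close> by (simp add: field_simps)
    then have "N * (?v - \<delta>) \<le> (\<Sum>n<N. expected \<sigma> \<tau> n)"
      using payoff[of N \<tau>] by (simp add: algebra_simps)
    then show "ereal (?v - \<delta>) \<le> ereal (mean_payoff \<pi> q g N \<sigma> \<tau>)"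
      using that by (simp add: mean_payoff_eq pos_le_divide_eq mult.commute)
  qed
  then have "ereal (?v - \<delta>) \<le> liminf (\<lambda>n. INF \<tau>. ereal (mean_payoff \<pi> q g n \<sigma> \<tau>))"
    by (intro Liminf_bounded) (auto simp: eventually_sequentially)
  also have "\<dots> \<le> lower_value \<pi> q g"
    unfolding lower_value_def by (rule SUP_upper) simp
  finally show ?thesis .
qed

lemma upper_value_le:
  assumes "\<delta> > 0"
  shows "upper_value \<pi> q g \<le> ereal ((\<Sum>d\<in>UNIV. val (start d)) + \<delta>)"
proof -
  let ?v = "\<Sum>d\<in>UNIV. val (start d)"
  have \<delta>2: "\<delta> / 2 > 0" using assms by simp
  obtain T0 where T0: "\<And>T x. T \<ge> T0 \<Longrightarrow> \<forall>k. x k \<ge> 0 \<Longrightarrow> best T x \<le> T * (val x + \<delta> / 2 * mass x)"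
    by (rule uniform_best[OF \<delta>2]) blast
  define N where "N = Suc T0"
  let ?B = "\<Sum>d\<in>UNIV. best N (start d)"
  have "?B \<le> (\<Sum>d\<in>UNIV. N * (val (start d) + \<delta> / 2 * mass (start d)))"
    by (intro sum_mono T0 start_nonneg) (simp add: N_def)
  also have "\<dots> = N * (?v + \<delta> / 2)"
    by (simp only: sum.distrib sum_distrib_left[symmetric] sum_mass_start mult_1_right)
  finally have B: "?B / N \<le> ?v + \<delta> / 2" by (simp add: N_def field_simps)
  obtain \<tau> where \<tau>: "\<And>\<sigma> n. (\<Sum>t<n. expected \<sigma> \<tau> t) \<le> (n / N + 1) * ?B"
    by (rule player2_block_strategy[of N]) (auto simp: N_def)
  \<comment> \<open>Past this stage the extra block counted in the bound costs at most
    \<open>\<delta> / 2\<close> per stage.\<close>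
  obtain N0 :: nat where N0: "2 * ?B / \<delta> \<le> real N0" using real_arch_simple by blast
  have "(SUP \<sigma>. ereal (mean_payoff \<pi> q g n \<sigma> \<tau>)) \<le> ereal (?v + \<delta>)" if n: "n \<ge> Suc N0" for n
  proof (rule SUP_least)
    fix \<sigma>
    have "2 * ?B / \<delta> \<le> n" using N0 n by simp
    then have "?B \<le> n * (\<delta> / 2)" using assms by (simp add: field_simps)
    moreover have "n * (?B / N) \<le> n * (?v + \<delta> / 2)" using B by (intro mult_left_mono) auto
    ultimately have "(\<Sum>t<n. expected \<sigma> \<tau> t) \<le> n * (?v + \<delta>)"
      using \<tau>[where n = n and \<sigma> = \<sigma>] by (simp add: algebra_simps)
    then show "ereal (mean_payoff \<pi> q g n \<sigma> \<tau>) \<le> ereal (?v + \<delta>)"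
      using n by (simp add: mean_payoff_eq pos_divide_le_eq mult.commute)
  qed
  then have "limsup (\<lambda>n. SUP \<sigma>. ereal (mean_payoff \<pi> q g n \<sigma> \<tau>)) \<le> ereal (?v + \<delta>)"
    by (intro Limsup_bounded) (auto simp: eventually_sequentially)
  moreover have "upper_value \<pi> q g \<le> limsup (\<lambda>n. SUP \<sigma>. ereal (mean_payoff \<pi> q g n \<sigma> \<tau>))"
    unfolding upper_value_def by (rule INF_lower) simp
  ultimately show ?thesis by (rule order_trans[rotated])
qed

end

section \<open>Comparison of the two values and pointwise form of the hypotheses\<close>

lemma lower_value_le_upper_value: "lower_value \<pi> q g \<le> upper_value \<pi> q g"
  unfolding lower_value_def upper_value_def
proof (intro SUP_least INF_greatest)
  fix \<sigma> \<tau>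
  have "(INF \<tau>. ereal (mean_payoff \<pi> q g n \<sigma> \<tau>)) \<le> (SUP \<sigma>. ereal (mean_payoff \<pi> q g n \<sigma> \<tau>))" for n
    by (rule order_trans[OF INF_lower SUP_upper]) simp_all
  then have "liminf (\<lambda>n. INF \<tau>. ereal (mean_payoff \<pi> q g n \<sigma> \<tau>))
      \<le> liminf (\<lambda>n. SUP \<sigma>. ereal (mean_payoff \<pi> q g n \<sigma> \<tau>))"
    by (intro Liminf_mono always_eventually) simp
  also have "\<dots> \<le> limsup (\<lambda>n. SUP \<sigma>. ereal (mean_payoff \<pi> q g n \<sigma> \<tau>))"
    by (rule Liminf_le_Limsup) simp
  finally show "liminf (\<lambda>n. INF \<tau>. ereal (mean_payoff \<pi> q g n \<sigma> \<tau>))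
      \<le> limsup (\<lambda>n. SUP \<sigma>. ereal (mean_payoff \<pi> q g n \<sigma> \<tau>))" .
qed

lemma pmf_eq_0_of_prob_eq_1:
  assumes "measure_pmf.prob p A = 1" "x \<notin> A"
  shows "pmf p x = 0"
proof -
  have "pmf p x = measure_pmf.prob p {x}" by (simp add: measure_pmf_single)
  also have "\<dots> \<le> measure_pmf.prob p (UNIV - A)"
    using assms(2) by (intro measure_pmf.finite_measure_mono) auto
  also have "\<dots> = 0"
    using measure_pmf.prob_compl[of A p] assms(1) by simp
  finally show ?thesis using pmf_nonneg[of p x] by linarith
qed

lemma pmf_map_fst_snd_snd:
  fixes p :: "('k \<times> 'c::finite \<times> 'd) pmf"
  shows "pmf (map_pmf (\<lambda>(k, c, d). (k, d)) p) (k, d) = (\<Sum>c\<in>UNIV. pmf p (k, c, d))"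
proof -
  have "(\<lambda>(k, c, d). (k, d)) -` {(k, d)} = (\<lambda>c :: 'c. (k, c, d)) ` UNIV" by auto
  then have "pmf (map_pmf (\<lambda>(k, c, d). (k, d)) p) (k, d) = measure_pmf.prob p ((\<lambda>c. (k, c, d)) ` UNIV)"
    by (simp add: pmf_map)
  also have "\<dots> = (\<Sum>c\<in>UNIV. pmf p (k, c, d))"
    by (subst measure_measure_pmf_finite) (auto simp: sum.reindex inj_on_def)
  finally show ?thesis .
qed

theorem theorem3p4:
  fixes \<pi> :: "('k::finite \<times> 'c::finite \<times> 'd::finite) pmf"
    and q :: "'k \<Rightarrow> 'i::finite \<Rightarrow> 'j::finite \<Rightarrow> ('k \<times> 'c \<times> 'd) pmf"
    and g :: "'k \<Rightarrow> 'i \<Rightarrow> 'j \<Rightarrow> real"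
  assumes "\<And>k i j. g k i j \<in> {0..1}"
    and "player1_informed \<pi> q"
    and "player1_controls_transition q"
  shows "has_uniform_value \<pi> q g"
proof -
  \<comment> \<open>\<open>undefined\<close> is just some action of player 2; by (HB') the marginal
    is the same for all of them.\<close>
  define Q where "Q k i k' d = (\<Sum>c\<in>UNIV. pmf (q k i undefined) (k', c, d))" for k i k' d
  have marginal: "(\<Sum>c\<in>UNIV. pmf (q k i j) (k', c, d)) = Q k i k' d" for k i j k' d
    using assms(3) unfolding Q_def player1_controls_transition_def by (metis pmf_map_fst_snd_snd)
  interpret repeated_game Q g \<pi> q
  proof
    fix k :: 'k and i :: 'i
    have "(\<Sum>d\<in>UNIV. \<Sum>k'\<in>UNIV. Q k i k' d) = (\<Sum>k'\<in>UNIV. \<Sum>d\<in>UNIV. \<Sum>c\<in>UNIV. pmf (q k i undefined) (k', c, d))"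
      unfolding Q_def by (rule sum.swap)
    also have "\<dots> = (\<Sum>k'\<in>UNIV. \<Sum>c\<in>UNIV. \<Sum>d\<in>UNIV. pmf (q k i undefined) (k', c, d))"
      by (intro sum.cong refl sum.swap)
    also have "\<dots> = (\<Sum>y\<in>UNIV. pmf (q k i undefined) y)"
      by (simp add: sum.cartesian_product case_prod_unfold flip: UNIV_Times_UNIV)
    finally show "(\<Sum>d\<in>UNIV. \<Sum>k'\<in>UNIV. Q k i k' d) = 1" by (simp add: sum_pmf_UNIV)
  qed (use assms(1) marginal in \<open>auto simp: Q_def sum_nonneg\<close>)
  \<comment> \<open>The common value: the values after each first signal of player 2, weighted
    through the masses of the unnormalised beliefs.\<close>
  let ?v = "\<Sum>d\<in>UNIV. val (start d)"
  obtain khat :: "'c \<Rightarrow> 'k" and dhat :: "'c \<Rightarrow> 'd"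
    where E\<pi>: "measure_pmf.prob \<pi> {(k, c, d). khat c = k \<and> dhat c = d} = 1"
      and Eq: "\<And>k i j. measure_pmf.prob (q k i j) {(k, c, d). khat c = k \<and> dhat c = d} = 1"
    using assms(2) unfolding player1_informed_def Let_def by blast
  have inf_\<pi>: "khat c = k \<and> dhat c = d" if "pmf \<pi> (k, c, d) \<noteq> 0" for k c d
    using pmf_eq_0_of_prob_eq_1[OF E\<pi>, of "(k, c, d)"] that by auto
  have inf_q: "khat c = k \<and> dhat c = d" if "pmf (q k' i j) (k, c, d) \<noteq> 0" for k' i j k c d
    using pmf_eq_0_of_prob_eq_1[OF Eq[of k' i j], of "(k, c, d)"] that by auto
  have "ereal ?v \<le> lower_value \<pi> q g"
  proof (rule ereal_le_epsilon2)
    fix \<delta> :: real assume "\<delta> > 0"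
    have "ereal (?v - \<delta>) \<le> lower_value \<pi> q g"
      by (rule lower_value_ge[OF inf_\<pi> inf_q \<open>\<delta> > 0\<close>])
    then show "ereal ?v \<le> lower_value \<pi> q g + ereal \<delta>"
      by (cases "lower_value \<pi> q g") auto
  qed
  moreover have "upper_value \<pi> q g \<le> ereal ?v"
    by (rule ereal_le_epsilon2) (use upper_value_le in auto)
  ultimately show ?thesis
    unfolding has_uniform_value_def
    using lower_value_le_upper_value[of \<pi> q g] by (meson antisym order_trans)
qed

end
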